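(* Let $K$ be a field of characteristic $2$. Let $\mathfrak{b}$ be the Lie algebra over $K$ generated by elements $a, b$, $x_i$, $y_i$ ($i\ge 1$) subject to the relations $$x_i = [a,b,b] + [x_{i+1},{}_{2^i} b], \qquad y_i = [a,b,a] + [y_{i+1},{}_{2^i} b] \qquad \text{for all } i\ge 1.$$ Then the Lie algebra $\mathfrak{a}=\mathfrak{b}/\gamma_\omega(\mathfrak{b})$ is parafree and $H_2(\mathfrak{a},K)\neq 0$.
   Context: Brackets are left-normalized: $[a_1,\dots,a_i]:=[[a_1,\dots,a_{i-1}],a_i]$. Engel commutators: $[a,{}_0 b]:=a$ and $[a,{}_{i+1}b]:=[[a,{}_i b],b]$ for $i\ge 0$. For a Lie algebra $\mathfrak{g}$ over a commutative ring $R$, $\gamma_i(\mathfrak{g})$ is the lower central series ($\gamma_1(\mathfrak{g})=\mathfrak{g}$, $\gamma_{i+1}(\mathfrak{g})=[\gamma_i(\mathfrak{g}),\mathfrak{g}]$) and $\gamma_\omega(\mathfrak{g})=\bigcap_{i\ge1}\gamma_i(\mathfrak{g})$. A Lie algebra $\mathfrak{g}$ over $R$ is parafree if $\gamma_\omega(\mathfrak{g})=0$ and there exists a free Lie algebra $\mathfrak{f}$ over $R$ with a homomorphism $\mathfrak{f}\to\mathfrak{g}$ inducing isomorphisms $\mathfrak{f}/\gamma_i(\mathfrak{f})\cong\mathfrak{g}/\gamma_i(\mathfrak{g})$ for all $i\ge 1$. Homology is $H_i(\mathfrak{g},-)=\mathrm{Tor}_i^{U(\mathfrak{g})}(R,-)$,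 where $U(\mathfrak{g})$ is the universal enveloping algebra and $R$ is the trivial $U(\mathfrak{g})$-module; here $R=K$, with trivial coefficients $K$. *)

theory Defs
  imports "HOL-Algebra.Algebra" "HOL-Algebra.Algebraic_Closure_Type"
begin

section \<open>Lie algebras\<close>

text \<open>
  Scalars come from a type of class \<^class>\<open>comm_ring_1\<close>, viewed as a ring record through
  \<^const>\<open>ring_of_type_algebra\<close>. A (not necessarily associative) algebra is a
  \<^typ>\<open>('k, 'a) module\<close> record whose \<^const>\<open>monoid.mult\<close> field is the product of the algebra; for a
  Lie algebra this is the Lie bracket. The field \<^const>\<open>monoid.one\<close> of the record plays no role.
\<close>

locale lie_algebra =
  module ring_of_type_algebra L
  for L :: "('k::comm_ring_1, 'a) module" (structure) +
  assumes lie_closed [simp, intro]: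
      "x \<in> carrier L \<Longrightarrow> y \<in> carrier L \<Longrightarrow> x \<otimes>\<^bsub>L\<^esub> y \<in> carrier L"
    and lie_add_left:
      "x \<in> carrier L \<Longrightarrow> y \<in> carrier L \<Longrightarrow> z \<in> carrier L \<Longrightarrow>
        (x \<oplus>\<^bsub>L\<^esub> y) \<otimes>\<^bsub>L\<^esub> z = x \<otimes>\<^bsub>L\<^esub> z \<oplus>\<^bsub>L\<^esub> y \<otimes>\<^bsub>L\<^esub> z"
    and lie_add_right:
      "x \<in> carrier L \<Longrightarrow> y \<in> carrier L \<Longrightarrow> z \<in> carrier L \<Longrightarrow>
        x \<otimes>\<^bsub>L\<^esub> (y \<oplus>\<^bsub>L\<^esub> z) = x \<otimes>\<^bsub>L\<^esub> y \<oplus>\<^bsub>L\<^esub> x \<otimes>\<^bsub>L\<^esub> z"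
    and lie_smult_left:
      "x \<in> carrier L \<Longrightarrow> y \<in> carrier L \<Longrightarrow> (c \<odot>\<^bsub>L\<^esub> x) \<otimes>\<^bsub>L\<^esub> y = c \<odot>\<^bsub>L\<^esub> (x \<otimes>\<^bsub>L\<^esub> y)"
    and lie_smult_right:
      "x \<in> carrier L \<Longrightarrow> y \<in> carrier L \<Longrightarrow> x \<otimes>\<^bsub>L\<^esub> (c \<odot>\<^bsub>L\<^esub> y) = c \<odot>\<^bsub>L\<^esub> (x \<otimes>\<^bsub>L\<^esub> y)"
    and lie_alternating: "x \<in> carrier L \<Longrightarrow> x \<otimes>\<^bsub>L\<^esub> x = \<zero>\<^bsub>L\<^esub>"
    and lie_jacobi:
      "x \<in> carrier L \<Longrightarrow> y \<in> carrier L \<Longrightarrow> z \<in> carrier L \<Longrightarrow>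
        x \<otimes>\<^bsub>L\<^esub> (y \<otimes>\<^bsub>L\<^esub> z) \<oplus>\<^bsub>L\<^esub> y \<otimes>\<^bsub>L\<^esub> (z \<otimes>\<^bsub>L\<^esub> x) \<oplus>\<^bsub>L\<^esub> z \<otimes>\<^bsub>L\<^esub> (x \<otimes>\<^bsub>L\<^esub> y) = \<zero>\<^bsub>L\<^esub>"

definition alg_hom ::
  "('k::comm_ring_1, 'a) module \<Rightarrow> ('k, 'b) module \<Rightarrow> ('a \<Rightarrow> 'b) set" where
  "alg_hom A B = {h \<in> carrier A \<rightarrow> carrier B.
     (\<forall>x\<in>carrier A. \<forall>y\<in>carrier A. h (x \<oplus>\<^bsub>A\<^esub> y) = h x \<oplus>\<^bsub>B\<^esub> h y) \<and>
     (\<forall>x\<in>carrier A. \<forall>y\<in>carrier A. h (x \<otimes>\<^bsub>A\<^esub> y) = h x \<otimes>\<^bsub>B\<^esub> h y) \<and>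
     (\<forall>c. \<forall>x\<in>carrier A. h (c \<odot>\<^bsub>A\<^esub> x) = c \<odot>\<^bsub>B\<^esub> h x)}"

definition alg_iso ::
  "('k::comm_ring_1, 'a) module \<Rightarrow> ('k, 'b) module \<Rightarrow> ('a \<Rightarrow> 'b) set" where
  "alg_iso A B = {h \<in> alg_hom A B. bij_betw h (carrier A) (carrier B)}"

definition alg_ideal :: "'a set \<Rightarrow> ('k::comm_ring_1, 'a) module \<Rightarrow> bool" where
  "alg_ideal I A \<longleftrightarrow> submodule I ring_of_type_algebra A \<and>
     (\<forall>x\<in>carrier A. \<forall>y\<in>I. x \<otimes>\<^bsub>A\<^esub> y \<in> I \<and> y \<otimes>\<^bsub>A\<^esub> x \<in> I)"

definition alg_genideal :: "('k::comm_ring_1, 'a) module \<Rightarrow> 'a set \<Rightarrow> 'a set" where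
  "alg_genideal A S = \<Inter>{I. alg_ideal I A \<and> S \<subseteq> I}"

definition alg_span :: "('k::comm_ring_1, 'a) module \<Rightarrow> 'a set \<Rightarrow> 'a set" where
  "alg_span A S = \<Inter>{H. submodule H ring_of_type_algebra A \<and> S \<subseteq> H}"

definition alg_quot ::
  "('k::comm_ring_1, 'a) module \<Rightarrow> 'a set \<Rightarrow> ('k, 'a set) module" (infixl \<open>AQuot\<close> 65) where
  "A AQuot I = ring.extend (A Quot I)
     (module.fields (\<lambda>c C. \<Union>x\<in>C. I +>\<^bsub>A\<^esub> (c \<odot>\<^bsub>A\<^esub> x)))"

text \<open>The map \<open>x + I \<mapsto> h x + J\<close> of quotients by \<open>I\<close> and by the ideal \<open>J\<close> of \<open>B\<close>.\<close>

definition quot_map ::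
  "('k::comm_ring_1, 'b) module \<Rightarrow> 'b set \<Rightarrow> ('a \<Rightarrow> 'b) \<Rightarrow> 'a set \<Rightarrow> 'b set" where
  "quot_map B J h C = (\<Union>x\<in>C. J +>\<^bsub>B\<^esub> h x)"

primrec engel :: "('k, 'a) module \<Rightarrow> 'a \<Rightarrow> nat \<Rightarrow> 'a \<Rightarrow> 'a" where
  "engel L x 0 y = x"
| "engel L x (Suc i) y = engel L x i y \<otimes>\<^bsub>L\<^esub> y"

text \<open>The lower central series is indexed from 1; the value at 0 is a dummy.\<close>

fun lower_central :: "('k::comm_ring_1, 'a) module \<Rightarrow> nat \<Rightarrow> 'a set" where
  "lower_central L 0 = carrier L"
| "lower_central L (Suc 0) = carrier L"
| "lower_central L (Suc (Suc i)) =
     alg_span L {x \<otimes>\<^bsub>L\<^esub> y | x y. x \<in> lower_central L (Suc i) \<and> y \<in> carrier L}"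

definition lower_central_omega :: "('k::comm_ring_1, 'a) module \<Rightarrow> 'a set" where
  "lower_central_omega L = (\<Inter>i\<in>{1..}. lower_central L i)"


section \<open>Free Lie algebras and presentations\<close>

text \<open>
  The free non-associative algebra on \<open>S\<close> has the free magma on \<open>S\<close> as a basis; its elements
  are finitely supported functions on magma words. The free Lie algebra is its quotient by the
  ideal generated by all \<open>f f\<close> and all Jacobi expressions.
\<close>

datatype 'x magma = Gen 'x | Prod "'x magma" "'x magma"

definition free_nonassoc :: "'x set \<Rightarrow> ('k::comm_ring_1, 'x magma \<Rightarrow> 'k) module" where
  "free_nonassoc S =
    \<lparr>carrier = {f. finite {t. f t \<noteq> 0} \<and> (\<forall>t. f t \<noteq> 0 \<longrightarrow> set_magma t \<subseteq> S)},
     monoid.mult = (\<lambda>f g t. case t of Gen x \<Rightarrow> 0 | Prod u v \<Rightarrow> f u * g v),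
     monoid.one = (\<lambda>t. 0),
     ring.zero = (\<lambda>t. 0),
     add = (\<lambda>f g t. f t + g t),
     module.smult = (\<lambda>c f t. c * f t)\<rparr>"

definition lie_identities :: "('k, 'a) module \<Rightarrow> 'a set" where
  "lie_identities A =
     {x \<otimes>\<^bsub>A\<^esub> x | x. x \<in> carrier A} \<union>
     {x \<otimes>\<^bsub>A\<^esub> (y \<otimes>\<^bsub>A\<^esub> z) \<oplus>\<^bsub>A\<^esub> y \<otimes>\<^bsub>A\<^esub> (z \<otimes>\<^bsub>A\<^esub> x) \<oplus>\<^bsub>A\<^esub> z \<otimes>\<^bsub>A\<^esub> (x \<otimes>\<^bsub>A\<^esub> y) | x y z.
        x \<in> carrier A \<and> y \<in> carrier A \<and> z \<in> carrier A}"

definition free_lie :: "'x set \<Rightarrow> ('k::comm_ring_1, ('x magma \<Rightarrow> 'k) set) module" where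
  "free_lie S = free_nonassoc S AQuot
     alg_genideal (free_nonassoc S) (lie_identities (free_nonassoc S))"

definition lie_gen :: "'x set \<Rightarrow> 'x \<Rightarrow> ('x magma \<Rightarrow> 'k::comm_ring_1) set" where
  "lie_gen S x =
     alg_genideal (free_nonassoc S) (lie_identities (free_nonassoc S))
       +>\<^bsub>free_nonassoc S\<^esub> (\<lambda>t. if t = Gen x then 1 else 0)"

definition lie_presented ::
  "'x set \<Rightarrow> ('x magma \<Rightarrow> 'k::comm_ring_1) set set \<Rightarrow>
   ('k, ('x magma \<Rightarrow> 'k) set set) module" where
  "lie_presented S rels = free_lie S AQuot alg_genideal (free_lie S) rels"

text \<open>
  The free Lie algebra may be taken on a subset \<open>S\<close> of the type of \<open>L\<close> itself: an isomorphism of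
  the quotients by the second terms of the lower central series makes \<open>S\<close> inject into
  \<^term>\<open>carrier L\<close>.
\<close>

definition parafree :: "('k::comm_ring_1, 'a) module \<Rightarrow> bool" where
  "parafree L \<longleftrightarrow> lie_algebra L \<and> lower_central_omega L = {\<zero>\<^bsub>L\<^esub>} \<and>
     (\<exists>S :: 'a set. \<exists>h \<in> alg_hom (free_lie S) L. \<forall>i\<ge>1.
        quot_map L (lower_central L i) h \<in>
          alg_iso (free_lie S AQuot lower_central (free_lie S) i) (L AQuot lower_central L i))"


section \<open>Universal enveloping algebras\<close>

text \<open>The free associative unital algebra on \<open>S\<close>, with basis the words over \<open>S\<close>.\<close>

definition free_assoc :: "'x set \<Rightarrow> ('x list \<Rightarrow> 'k::comm_ring_1) ring" where
  "free_assoc S =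
    \<lparr>carrier = {f. finite {w. f w \<noteq> 0} \<and> (\<forall>w. f w \<noteq> 0 \<longrightarrow> set w \<subseteq> S)},
     monoid.mult = (\<lambda>f g w. \<Sum>i\<le>length w. f (take i w) * g (drop i w)),
     monoid.one = (\<lambda>w. if w = [] then 1 else 0),
     ring.zero = (\<lambda>w. 0),
     add = (\<lambda>f g w. f w + g w)\<rparr>"

definition word :: "'x list \<Rightarrow> 'x list \<Rightarrow> 'k::comm_ring_1" where
  "word v = (\<lambda>w. if w = v then 1 else 0)"

text \<open>
  The first two families of relations turn the free associative algebra on the underlying set
  of \<open>L\<close> into the tensor algebra of the module \<open>L\<close>.
\<close>

definition env_relations :: "('k::comm_ring_1, 'a) module \<Rightarrow> ('a list \<Rightarrow> 'k) set" where
  "env_relations L =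
     {(\<lambda>w. word [x \<oplus>\<^bsub>L\<^esub> y] w - word [x] w - word [y] w) | x y.
        x \<in> carrier L \<and> y \<in> carrier L} \<union>
     {(\<lambda>w. word [c \<odot>\<^bsub>L\<^esub> x] w - c * word [x] w) | c x. x \<in> carrier L} \<union>
     {(\<lambda>w. word [x, y] w - word [y, x] w - word [x \<otimes>\<^bsub>L\<^esub> y] w) | x y.
        x \<in> carrier L \<and> y \<in> carrier L}"

definition env_algebra :: "('k::comm_ring_1, 'a) module \<Rightarrow> ('a list \<Rightarrow> 'k) set ring" where
  "env_algebra L =
     free_assoc (carrier L) Quot Idl\<^bsub>free_assoc (carrier L)\<^esub> (env_relations L)"

text \<open>
  The augmentation sends a class to the constant term of any representative; all relations have
  constant term 0.
\<close>

definition env_aug :: "('a list \<Rightarrow> 'k::comm_ring_1) set \<Rightarrow> 'k" where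
  "env_aug u = the_elem ((\<lambda>f. f []) ` u)"

text \<open>The trivial module, which is both a left and a right module.\<close>

definition trivial_module :: "(('a list \<Rightarrow> 'k::comm_ring_1) set, 'k) module" where
  "trivial_module = ring.extend ring_of_type_algebra (module.fields (\<lambda>u c. env_aug u * c))"


section \<open>Tor over a noncommutative ring\<close>

text \<open>
  For a right module \<open>M\<close>, \<open>r \<odot>\<^bsub>M\<^esub> m\<close> is to be read as \<open>m r\<close>.
  The tensor product of a right module \<open>M\<close> with a left module \<open>N\<close> is an abelian group, written
  multiplicatively.
\<close>

definition tensor_relations ::
  "('r, 'x) ring_scheme \<Rightarrow> ('r, 'm) module \<Rightarrow> ('r, 'n) module \<Rightarrow> ('m \<times> 'n \<Rightarrow>\<^sub>0 int) set" where
  "tensor_relations R M N =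
     {frag_of (m \<oplus>\<^bsub>M\<^esub> m', n) - frag_of (m, n) - frag_of (m', n) | m m' n.
        m \<in> carrier M \<and> m' \<in> carrier M \<and> n \<in> carrier N} \<union>
     {frag_of (m, n \<oplus>\<^bsub>N\<^esub> n') - frag_of (m, n) - frag_of (m, n') | m n n'.
        m \<in> carrier M \<and> n \<in> carrier N \<and> n' \<in> carrier N} \<union>
     {frag_of (r \<odot>\<^bsub>M\<^esub> m, n) - frag_of (m, r \<odot>\<^bsub>N\<^esub> n) | r m n.
        r \<in> carrier R \<and> m \<in> carrier M \<and> n \<in> carrier N}"

definition tensor_null ::
  "('r, 'x) ring_scheme \<Rightarrow> ('r, 'm) module \<Rightarrow> ('r, 'n) module \<Rightarrow> ('m \<times> 'n \<Rightarrow>\<^sub>0 int) set" where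
  "tensor_null R M N =
     generate (free_Abelian_group (carrier M \<times> carrier N)) (tensor_relations R M N)"

definition tensor ::
  "('r, 'x) ring_scheme \<Rightarrow> ('r, 'm) module \<Rightarrow> ('r, 'n) module \<Rightarrow> ('m \<times> 'n \<Rightarrow>\<^sub>0 int) set monoid"
  where
  "tensor R M N = free_Abelian_group (carrier M \<times> carrier N) Mod tensor_null R M N"

text \<open>The map \<open>h \<otimes> N\<close> with values in \<^term>\<open>tensor R M' N\<close>, for a homomorphism \<open>h\<close> into \<open>M'\<close>.\<close>

definition tensor_map ::
  "('r, 'x) ring_scheme \<Rightarrow> ('r, 'b) module \<Rightarrow> ('r, 'n) module \<Rightarrow> ('m \<Rightarrow> 'b) \<Rightarrow>
   ('m \<times> 'n \<Rightarrow>\<^sub>0 int) set \<Rightarrow> ('b \<times> 'n \<Rightarrow>\<^sub>0 int) set" where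
  "tensor_map R M' N h C =
     (\<Union>z\<in>C. tensor_null R M' N
        #>\<^bsub>free_Abelian_group (carrier M' \<times> carrier N)\<^esub>
        frag_extend (\<lambda>(m, n). frag_of (h m, n)) z)"

text \<open>The free right module with basis \<open>S\<close>.\<close>

definition free_rmodule :: "('r, 'x) ring_scheme \<Rightarrow> 's set \<Rightarrow> ('r, 's \<Rightarrow> 'r) module" where
  "free_rmodule R S =
    \<lparr>carrier = {f. (\<forall>s. f s \<in> carrier R) \<and> finite {s. f s \<noteq> \<zero>\<^bsub>R\<^esub>} \<and> (\<forall>s. s \<notin> S \<longrightarrow> f s = \<zero>\<^bsub>R\<^esub>)},
     monoid.mult = undefined,
     monoid.one = undefined,
     ring.zero = (\<lambda>s. \<zero>\<^bsub>R\<^esub>),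
     add = (\<lambda>f g s. f s \<oplus>\<^bsub>R\<^esub> g s),
     module.smult = (\<lambda>r f s. f s \<otimes>\<^bsub>R\<^esub> r)\<rparr>"

text \<open>
  The standard free resolution \<open>\<dots> \<rightarrow> F\<^sub>2 \<rightarrow> F\<^sub>1 \<rightarrow> F\<^sub>0 \<rightarrow> M \<rightarrow> 0\<close> of a right module \<open>M\<close>: the basis
  of \<open>F\<^sub>0\<close> is the set of all elements of \<open>M\<close>, and \<open>F\<^sub>n\<^sub>+\<^sub>1\<close> has one basis element for every formal
  finite combination \<open>[(s\<^sub>1, r\<^sub>1), \<dots>, (s\<^sub>k, r\<^sub>k)]\<close> of basis elements \<open>s\<^sub>j\<close> of \<open>F\<^sub>n\<close> whose value
  \<open>s\<^sub>1 r\<^sub>1 + \<dots> + s\<^sub>k r\<^sub>k\<close> lies in the kernel of the map out of \<open>F\<^sub>n\<close>; the differential sends it to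
  that value. Labelling all bases by a single datatype puts all \<open>F\<^sub>n\<close> into a single type.
\<close>

datatype ('m, 'r) cell = Base 'm | Syz "(('m, 'r) cell \<times> 'r) list"

definition chain :: "('r, 'x) ring_scheme \<Rightarrow> ('s \<times> 'r) list \<Rightarrow> 's \<Rightarrow> 'r" where
  "chain R ps = foldr (\<lambda>(s, r) f. f(s := r \<oplus>\<^bsub>R\<^esub> f s)) ps (\<lambda>s. \<zero>\<^bsub>R\<^esub>)"

fun cell_boundary :: "('r, 'x) ring_scheme \<Rightarrow> ('m, 'r) cell \<Rightarrow> ('m, 'r) cell \<Rightarrow> 'r" where
  "cell_boundary R (Base m) = (\<lambda>c. \<zero>\<^bsub>R\<^esub>)"
| "cell_boundary R (Syz ps) = chain R ps"

definition res_boundary ::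
  "('r, 'x) ring_scheme \<Rightarrow> (('m, 'r) cell \<Rightarrow> 'r) \<Rightarrow> (('m, 'r) cell \<Rightarrow> 'r)" where
  "res_boundary R f =
     (\<lambda>c. \<Oplus>\<^bsub>R\<^esub> s \<in> {s. f s \<noteq> \<zero>\<^bsub>R\<^esub>}. cell_boundary R s c \<otimes>\<^bsub>R\<^esub> f s)"

definition res_aug ::
  "('r, 'x) ring_scheme \<Rightarrow> ('r, 'm) module \<Rightarrow> (('m, 'r) cell \<Rightarrow> 'r) \<Rightarrow> 'm" where
  "res_aug R M f =
     (\<Oplus>\<^bsub>M\<^esub> s \<in> {s. f s \<noteq> \<zero>\<^bsub>R\<^esub>}. case s of Base m \<Rightarrow> f s \<odot>\<^bsub>M\<^esub> m | Syz ps \<Rightarrow> \<zero>\<^bsub>M\<^esub>)"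

primrec res_basis ::
  "('r, 'x) ring_scheme \<Rightarrow> ('r, 'm) module \<Rightarrow> nat \<Rightarrow> ('m, 'r) cell set" where
  "res_basis R M 0 = Base ` carrier M"
| "res_basis R M (Suc n) =
     {Syz ps | ps. set ps \<subseteq> res_basis R M n \<times> carrier R \<and>
        (if n = 0 then res_aug R M (chain R ps) = \<zero>\<^bsub>M\<^esub>
         else res_boundary R (chain R ps) = (\<lambda>c. \<zero>\<^bsub>R\<^esub>))}"

definition res_module ::
  "('r, 'x) ring_scheme \<Rightarrow> ('r, 'm) module \<Rightarrow> nat \<Rightarrow> ('r, ('m, 'r) cell \<Rightarrow> 'r) module" where
  "res_module R M n = free_rmodule R (res_basis R M n)"

definition Tor ::
  "nat \<Rightarrow> ('r, 'x) ring_scheme \<Rightarrow> ('r, 'm) module \<Rightarrow> ('r, 'n) module \<Rightarrow>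
   ((('m, 'r) cell \<Rightarrow> 'r) \<times> 'n \<Rightarrow>\<^sub>0 int) set set monoid" where
  "Tor n R M N =
    (let T = (\<lambda>k. tensor R (res_module R M k) N);
         d = (\<lambda>k. tensor_map R (res_module R M k) N (res_boundary R));
         Z = (if n = 0 then carrier (T 0) else kernel (T n) (T (n - 1)) (d (n - 1)))
     in (T n)\<lparr>carrier := Z\<rparr> Mod (d n ` carrier (T (Suc n))))"

definition lie_homology ::
  "nat \<Rightarrow> ('k::comm_ring_1, 'a) module \<Rightarrow>
   (((('k, ('a list \<Rightarrow> 'k) set) cell \<Rightarrow> ('a list \<Rightarrow> 'k) set) \<times> 'k) \<Rightarrow>\<^sub>0 int) set set monoid" where
  "lie_homology n L = Tor n (env_algebra L) trivial_module trivial_module"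


section \<open>The Lie algebras \<open>\<bb>\<close> and \<open>\<aa>\<close>\<close>

datatype gen = GenA | GenB | GenX nat | GenY nat

definition gens :: "gen set" where
  "gens = {GenA, GenB} \<union> GenX ` {1..} \<union> GenY ` {1..}"

definition b_relations :: "(gen magma \<Rightarrow> 'k::comm_ring_1) set set" where
  "b_relations =
    (let L = free_lie gens;
         a = lie_gen gens GenA;
         b = lie_gen gens GenB;
         x = (\<lambda>i. lie_gen gens (GenX i));
         y = (\<lambda>i. lie_gen gens (GenY i))
     in {x i \<ominus>\<^bsub>L\<^esub> (((a \<otimes>\<^bsub>L\<^esub> b) \<otimes>\<^bsub>L\<^esub> b) \<oplus>\<^bsub>L\<^esub> engel L (x (i + 1)) (2 ^ i) b) | i. i \<ge> 1} \<union>
        {y i \<ominus>\<^bsub>L\<^esub> (((a \<otimes>\<^bsub>L\<^esub> b) \<otimes>\<^bsub>L\<^esub> a) \<oplus>\<^bsub>L\<^esub> engel L (y (i + 1)) (2 ^ i) b) | i. i \<ge> 1})"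

definition lie_b :: "('k::comm_ring_1, (gen magma \<Rightarrow> 'k) set set) module" where
  "lie_b = lie_presented gens b_relations"

definition lie_a :: "('k::comm_ring_1, (gen magma \<Rightarrow> 'k) set set set) module" where
  "lie_a = lie_b AQuot lower_central_omega lie_b"

end

theory Submission
  imports Defs "HOL-Library.Function_Algebras"
begin

text \<open>
  Write \<open>N = \<gamma>\<^sub>\<omega>(\<bb>)\<close>, so that \<open>\<aa> = \<bb>/N\<close>.

  Parafreeness holds over every commutative ring. Unfolding the relations \<open>d\<close> times writes \<open>x\<^sub>j\<close>
  and \<open>y\<^sub>j\<close> as Lie polynomials in \<open>a, b\<close> up to a remainder in \<open>\<gamma>\<^sub>d\<close> (\<open>b_approx\<close>), and in a
  nilpotent Lie algebra the same unfolding solves the relations for arbitrary images of \<open>a, b\<close>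
  (\<open>nilpotent_b_family\<close>). Hence the free Lie algebra on \<open>a, b\<close> and \<open>\<aa>\<close> have the same quotients
  by the terms of their lower central series (\<open>parafree_a\<close>).

  The class in the second homology comes from \<open>z = [y\<^sub>1, b] + [x\<^sub>1, a]\<close>. In characteristic 2 the map
  \<open>ad b\<close> to the power \<open>2\<^sup>n\<close> is a derivation, and this allows to move the third letter of
  \<open>[a, b, a, b, \<dots>, b]\<close>, with a final block of \<open>2\<^sup>n - 1\<close> letters \<open>b\<close>, to the end
  (\<open>engel_exchange\<close>). So in the \<open>n\<close>-fold unfolding of \<open>z\<close> all terms in \<open>a, b\<close> alone
  cancel, only terms of high degree remain, and \<open>z \<in> N\<close> (\<open>b_family_omega\<close>). In \<open>U(\<aa>)\<close> the equation
  \<open>z = 0\<close> reads \<open>y\<^sub>1 b - b y\<^sub>1 + x\<^sub>1 a - a x\<^sub>1 = 0\<close>, a 2-cycle with trivial coefficients.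

  To see that the cycle is not a boundary, let \<open>b\<close> act on the space \<open>V\<close> of functions on the integers
  by the shift by one, and let all other generators act by zero. There is a derivation
  \<open>\<delta> : \<bb> \<rightarrow> V\<close> that kills \<open>a, b, x\<^sub>i\<close> and sends \<open>y\<^sub>i\<close> to the function supported at \<open>2 - 2\<^sup>i\<close> with
  value 1 there; then \<open>\<delta> z\<close> is supported at 1. The crucial fact is that \<open>\<delta>\<close> maps \<open>N\<close> into the
  submodule \<open>W\<close> of functions supported in positive degrees. Given this, \<open>\<delta>\<close> induces a crossed
  homomorphism \<open>U(\<aa>) \<rightarrow> V/W\<close>, and the extension of \<open>V/W\<close> by \<open>W\<close> together with evaluation of \<open>W\<close> in
  degree 1 turns it into a functional on the second homology (\<open>Tor_2_trivial_nonzero\<close>), whose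
  value on the cycle is \<open>(\<delta> z)(1) = 1\<close> (\<open>lie_homology_2_nonzero\<close>).

  To control \<open>\<delta>\<close> on \<open>N\<close>, it is made one component of a homomorphism from \<open>\<bb>\<close> to an algebra of tuples
  \<open>(u, f, F, g)\<close>, where \<open>f\<close> is a power series in one variable, \<open>F\<close> a power series in two variables and
  \<open>g\<close> the value of \<open>\<delta>\<close>. The first three components carry a filtration that forces them to vanish
  on \<open>N\<close>. The relations of \<open>\<bb>\<close> make the series of \<open>x\<^sub>i\<close> and \<open>y\<^sub>i\<close> lacunary, with terms only in
  degrees close to powers of 2, and \<open>g\<close> can be read off from the terms of \<open>F\<close> of total degree near
  \<open>2\<^sup>J\<close> for large \<open>J\<close> (\<open>asymptotic\<close>): up to binomial coefficients they are the values of \<open>g\<close>. Below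
  \<open>2\<^sup>J\<close> suitable binomial coefficients are odd, so \<open>F = 0\<close> forces \<open>g\<close> to vanish in all degrees \<open>\<le> 0\<close>
  (\<open>asymptotic_vanish\<close>).
\<close>


section \<open>Nonassociative algebras, quotients and homomorphisms\<close>

lemma type_ring_simps [simp]:
  "carrier ring_of_type_algebra = UNIV"
  "x \<oplus>\<^bsub>ring_of_type_algebra\<^esub> y = x + y"
  "x \<otimes>\<^bsub>ring_of_type_algebra\<^esub> y = x * y"
  "\<one>\<^bsub>ring_of_type_algebra\<^esub> = 1"
  "\<zero>\<^bsub>ring_of_type_algebra\<^esub> = 0"
  by (simp_all add: ring_of_type_algebra_def)

lemma UN_eq_const: "z \<in> Z \<Longrightarrow> (\<And>u. u \<in> Z \<Longrightarrow> f u = C) \<Longrightarrow> (\<Union>u\<in>Z. f u) = C"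
  by auto

locale nonassoc_algebra =
  module ring_of_type_algebra A
  for A :: "('k::comm_ring_1, 'a) module" (structure) +
  assumes mult_closed [simp, intro]:
      "x \<in> carrier A \<Longrightarrow> y \<in> carrier A \<Longrightarrow> x \<otimes> y \<in> carrier A"
    and mult_add_left:
      "x \<in> carrier A \<Longrightarrow> y \<in> carrier A \<Longrightarrow> z \<in> carrier A \<Longrightarrow>
        (x \<oplus> y) \<otimes> z = x \<otimes> z \<oplus> y \<otimes> z"
    and mult_add_right:
      "x \<in> carrier A \<Longrightarrow> y \<in> carrier A \<Longrightarrow> z \<in> carrier A \<Longrightarrow>
        x \<otimes> (y \<oplus> z) = x \<otimes> y \<oplus> x \<otimes> z"
    and mult_smult_left:
      "x \<in> carrier A \<Longrightarrow> y \<in> carrier A \<Longrightarrow> (c \<odot> x) \<otimes> y = c \<odot> (x \<otimes> y)"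
    and mult_smult_right:
      "x \<in> carrier A \<Longrightarrow> y \<in> carrier A \<Longrightarrow> x \<otimes> (c \<odot> y) = c \<odot> (x \<otimes> y)"
begin

lemma scale_zero_left [simp]: "x \<in> carrier A \<Longrightarrow> 0 \<odot> x = \<zero>"
  using smult_l_null by simp

lemma scale_zero_right [simp]: "c \<odot> \<zero> = \<zero>"
  using smult_r_null by simp

lemma scale_one [simp]: "x \<in> carrier A \<Longrightarrow> 1 \<odot> x = x"
  using smult_one by simp

lemma scale_add_left: "x \<in> carrier A \<Longrightarrow> (c + d) \<odot> x = c \<odot> x \<oplus> d \<odot> x"
  using smult_l_distr[of c d x] by simp

lemma scale_add_right:
  "x \<in> carrier A \<Longrightarrow> y \<in> carrier A \<Longrightarrow> c \<odot> (x \<oplus> y) = c \<odot> x \<oplus> c \<odot> y"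
  using smult_r_distr[of c x y] by simp

lemma scale_assoc: "x \<in> carrier A \<Longrightarrow> (c * d) \<odot> x = c \<odot> (d \<odot> x)"
  using smult_assoc1[of c d x] by simp

lemma minus_eq_scale: "x \<in> carrier A \<Longrightarrow> \<ominus> x = (- 1) \<odot> x"
proof -
  assume x: "x \<in> carrier A"
  have "(- 1) \<odot> x \<oplus> x = (- 1 + 1) \<odot> x"
    using x by (simp only: scale_add_left scale_one)
  then have "(- 1) \<odot> x \<oplus> x = \<zero>"
    using x by simp
  then show ?thesis
    using x by (simp add: M.minus_equality)
qed

lemma eq_of_minus_zero:
  assumes "x \<in> carrier A" "y \<in> carrier A" "x \<ominus> y = \<zero>"
  shows "x = y"
proof -
  have "x \<oplus> \<ominus> y = \<zero>"
    using assms(3) by (simp add: a_minus_def)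
  then show ?thesis
    using assms(1,2) M.minus_equality[of x "\<ominus> y"] by simp
qed

lemma mult_zero_left [simp]: "x \<in> carrier A \<Longrightarrow> \<zero> \<otimes> x = \<zero>"
  using mult_smult_left[of x x 0] by simp

lemma mult_zero_right [simp]: "x \<in> carrier A \<Longrightarrow> x \<otimes> \<zero> = \<zero>"
  using mult_smult_right[of x x 0] by simp

lemma mult_minus_left: "x \<in> carrier A \<Longrightarrow> y \<in> carrier A \<Longrightarrow> (\<ominus> x) \<otimes> y = \<ominus> (x \<otimes> y)"
  by (simp add: minus_eq_scale mult_smult_left)

lemma mult_minus_right: "x \<in> carrier A \<Longrightarrow> y \<in> carrier A \<Longrightarrow> x \<otimes> (\<ominus> y) = \<ominus> (x \<otimes> y)"
  by (simp add: minus_eq_scale mult_smult_right)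

lemma minus_self: "x \<in> carrier A \<Longrightarrow> x \<ominus> x = \<zero>"
  by (simp add: a_minus_def M.r_neg)

lemma mult_diff:
  assumes "x \<in> carrier A" "y \<in> carrier A" "v \<in> carrier A" "w \<in> carrier A"
  shows "x \<otimes> y \<ominus> v \<otimes> w = (x \<ominus> v) \<otimes> y \<oplus> v \<otimes> (y \<ominus> w)"
  using assms
  by (simp add: a_minus_def mult_add_left mult_add_right mult_minus_left mult_minus_right
      M.a_assoc[symmetric]) (simp add: M.a_assoc M.l_neg)

lemma submodule_iff:
  "submodule H ring_of_type_algebra A \<longleftrightarrow>
     H \<subseteq> carrier A \<and> \<zero> \<in> H \<and> (\<forall>x\<in>H. \<forall>y\<in>H. x \<oplus> y \<in> H) \<and> (\<forall>c. \<forall>x\<in>H. c \<odot> x \<in> H)"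
  (is "?l = ?r")
proof
  assume H: ?l
  have "\<zero> \<in> H"
    using subgroup.one_closed[OF submodule.axioms(1)[OF H]] by simp
  then show ?r
    using submoduleE[OF H] by simp
next
  assume r: ?r
  show ?l
  proof (rule submoduleI)
    fix x assume "x \<in> H"
    with r have "x \<in> carrier A" "(- 1) \<odot> x \<in> H" by blast+
    then show "\<ominus> x \<in> H" by (simp add: minus_eq_scale)
  qed (use r in auto)
qed

lemma submodule_closed:
  assumes "submodule H ring_of_type_algebra A"
  shows "H \<subseteq> carrier A" "\<zero> \<in> H" "x \<in> H \<Longrightarrow> y \<in> H \<Longrightarrow> x \<oplus> y \<in> H" "x \<in> H \<Longrightarrow> c \<odot> x \<in> H"
    "x \<in> H \<Longrightarrow> \<ominus> x \<in> H" "x \<in> H \<Longrightarrow> y \<in> H \<Longrightarrow> x \<ominus> y \<in> H"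
  using assms submoduleE[OF assms] unfolding submodule_iff a_minus_def by auto

lemma span_submodule:
  assumes "S \<subseteq> carrier A"
  shows "submodule (alg_span A S) ring_of_type_algebra A" "S \<subseteq> alg_span A S"
proof -
  have "submodule (carrier A) ring_of_type_algebra A"
    by (rule carrier_is_submodule)
  then show "submodule (alg_span A S) ring_of_type_algebra A"
    using assms unfolding alg_span_def submodule_iff by (auto; blast)
  show "S \<subseteq> alg_span A S"
    unfolding alg_span_def by blast
qed

lemma span_least: "submodule H ring_of_type_algebra A \<Longrightarrow> S \<subseteq> H \<Longrightarrow> alg_span A S \<subseteq> H"
  unfolding alg_span_def by blast

lemma genideal_ideal:
  assumes "S \<subseteq> carrier A"
  shows "alg_ideal (alg_genideal A S) A" "S \<subseteq> alg_genideal A S"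
proof -
  have "alg_ideal (carrier A) A"
    using carrier_is_submodule unfolding alg_ideal_def by auto
  then have "alg_genideal A S \<subseteq> carrier A"
    using assms unfolding alg_genideal_def by blast
  then show "alg_ideal (alg_genideal A S) A"
    unfolding alg_ideal_def submodule_iff by (auto simp: alg_genideal_def alg_ideal_def submodule_iff)
  show "S \<subseteq> alg_genideal A S"
    unfolding alg_genideal_def by blast
qed

lemma genideal_least: "alg_ideal I A \<Longrightarrow> S \<subseteq> I \<Longrightarrow> alg_genideal A S \<subseteq> I"
  unfolding alg_genideal_def by blast

end

lemma nonassoc_algebraI:
  fixes A :: "('k::comm_ring_1, 'a) module"
  assumes "abelian_group A"
    and "\<And>c x. x \<in> carrier A \<Longrightarrow> c \<odot>\<^bsub>A\<^esub> x \<in> carrier A"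
    and "\<And>c d x. x \<in> carrier A \<Longrightarrow> (c + d) \<odot>\<^bsub>A\<^esub> x = c \<odot>\<^bsub>A\<^esub> x \<oplus>\<^bsub>A\<^esub> d \<odot>\<^bsub>A\<^esub> x"
    and "\<And>c x y. x \<in> carrier A \<Longrightarrow> y \<in> carrier A \<Longrightarrow> c \<odot>\<^bsub>A\<^esub> (x \<oplus>\<^bsub>A\<^esub> y) = c \<odot>\<^bsub>A\<^esub> x \<oplus>\<^bsub>A\<^esub> c \<odot>\<^bsub>A\<^esub> y"
    and "\<And>c d x. x \<in> carrier A \<Longrightarrow> (c * d) \<odot>\<^bsub>A\<^esub> x = c \<odot>\<^bsub>A\<^esub> (d \<odot>\<^bsub>A\<^esub> x)"
    and "\<And>x. x \<in> carrier A \<Longrightarrow> 1 \<odot>\<^bsub>A\<^esub> x = x"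
    and "\<And>x y. x \<in> carrier A \<Longrightarrow> y \<in> carrier A \<Longrightarrow> x \<otimes>\<^bsub>A\<^esub> y \<in> carrier A"
    and "\<And>x y z. x \<in> carrier A \<Longrightarrow> y \<in> carrier A \<Longrightarrow> z \<in> carrier A \<Longrightarrow>
        (x \<oplus>\<^bsub>A\<^esub> y) \<otimes>\<^bsub>A\<^esub> z = x \<otimes>\<^bsub>A\<^esub> z \<oplus>\<^bsub>A\<^esub> y \<otimes>\<^bsub>A\<^esub> z"
    and "\<And>x y z. x \<in> carrier A \<Longrightarrow> y \<in> carrier A \<Longrightarrow> z \<in> carrier A \<Longrightarrow>
        x \<otimes>\<^bsub>A\<^esub> (y \<oplus>\<^bsub>A\<^esub> z) = x \<otimes>\<^bsub>A\<^esub> y \<oplus>\<^bsub>A\<^esub> x \<otimes>\<^bsub>A\<^esub> z"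
    and "\<And>c x y. x \<in> carrier A \<Longrightarrow> y \<in> carrier A \<Longrightarrow> (c \<odot>\<^bsub>A\<^esub> x) \<otimes>\<^bsub>A\<^esub> y = c \<odot>\<^bsub>A\<^esub> (x \<otimes>\<^bsub>A\<^esub> y)"
    and "\<And>c x y. x \<in> carrier A \<Longrightarrow> y \<in> carrier A \<Longrightarrow> x \<otimes>\<^bsub>A\<^esub> (c \<odot>\<^bsub>A\<^esub> y) = c \<odot>\<^bsub>A\<^esub> (x \<otimes>\<^bsub>A\<^esub> y)"
  shows "nonassoc_algebra A"
proof (rule nonassoc_algebra.intro)
  have "cring (ring_of_type_algebra :: 'k ring)"
    by (rule cring_from_type_algebra)
  then show "module (ring_of_type_algebra :: 'k ring) A"
    by (rule moduleI) (use assms in simp_all)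
qed (unfold_locales, use assms in simp_all)

sublocale lie_algebra \<subseteq> nonassoc_algebra L
  by unfold_locales
    (simp_all add: lie_add_left lie_add_right lie_smult_left lie_smult_right)

lemma alg_homD:
  assumes "h \<in> alg_hom A B"
  shows "x \<in> carrier A \<Longrightarrow> h x \<in> carrier B"
    "x \<in> carrier A \<Longrightarrow> y \<in> carrier A \<Longrightarrow> h (x \<oplus>\<^bsub>A\<^esub> y) = h x \<oplus>\<^bsub>B\<^esub> h y"
    "x \<in> carrier A \<Longrightarrow> y \<in> carrier A \<Longrightarrow> h (x \<otimes>\<^bsub>A\<^esub> y) = h x \<otimes>\<^bsub>B\<^esub> h y"
    "x \<in> carrier A \<Longrightarrow> h (c \<odot>\<^bsub>A\<^esub> x) = c \<odot>\<^bsub>B\<^esub> h x"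
  using assms by (auto simp: alg_hom_def)

lemma alg_homI:
  assumes "\<And>x. x \<in> carrier A \<Longrightarrow> h x \<in> carrier B"
    "\<And>x y. x \<in> carrier A \<Longrightarrow> y \<in> carrier A \<Longrightarrow> h (x \<oplus>\<^bsub>A\<^esub> y) = h x \<oplus>\<^bsub>B\<^esub> h y"
    "\<And>x y. x \<in> carrier A \<Longrightarrow> y \<in> carrier A \<Longrightarrow> h (x \<otimes>\<^bsub>A\<^esub> y) = h x \<otimes>\<^bsub>B\<^esub> h y"
    "\<And>c x. x \<in> carrier A \<Longrightarrow> h (c \<odot>\<^bsub>A\<^esub> x) = c \<odot>\<^bsub>B\<^esub> h x"
  shows "h \<in> alg_hom A B"
  using assms by (auto simp: alg_hom_def)

lemma alg_hom_zero:
  assumes "nonassoc_algebra A" "nonassoc_algebra B" "h \<in> alg_hom A B"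
  shows "h \<zero>\<^bsub>A\<^esub> = \<zero>\<^bsub>B\<^esub>"
proof -
  interpret A: nonassoc_algebra A by fact
  interpret B: nonassoc_algebra B by fact
  show ?thesis
    using alg_homD(4)[OF assms(3), of "\<zero>\<^bsub>A\<^esub>" 0] alg_homD(1)[OF assms(3), of "\<zero>\<^bsub>A\<^esub>"] by simp
qed

lemma alg_hom_minus:
  assumes "nonassoc_algebra A" "nonassoc_algebra B" "h \<in> alg_hom A B" "x \<in> carrier A" "y \<in> carrier A"
  shows "h (x \<ominus>\<^bsub>A\<^esub> y) = h x \<ominus>\<^bsub>B\<^esub> h y"
proof -
  interpret A: nonassoc_algebra A by fact
  interpret B: nonassoc_algebra B by fact
  show ?thesis
    using assms(4,5) by (simp add: a_minus_def A.minus_eq_scale B.minus_eq_scale alg_homD[OF assms(3)])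
qed

lemma engel_closed:
  assumes "nonassoc_algebra A" "x \<in> carrier A" "y \<in> carrier A"
  shows "engel A x n y \<in> carrier A"
proof -
  interpret nonassoc_algebra A by fact
  show ?thesis using assms by (induction n) auto
qed

lemma alg_hom_engel:
  assumes "nonassoc_algebra A" "h \<in> alg_hom A B" "x \<in> carrier A" "y \<in> carrier A"
  shows "h (engel A x n y) = engel B (h x) n (h y)"
  by (induction n) (simp_all add: alg_homD[OF assms(2)] engel_closed[OF assms(1)] assms(3,4))

text \<open>
  Quotients inherit the algebra identities along the projection, where they need to be checked on
  images only.
\<close>

lemma surj_hom_nonassoc_algebra:
  assumes "nonassoc_algebra A" "h \<in> alg_hom A B" "carrier B = h ` carrier A" "\<zero>\<^bsub>B\<^esub> = h \<zero>\<^bsub>A\<^esub>"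
  shows "nonassoc_algebra B"
proof -
  interpret nonassoc_algebra A by fact
  note h = alg_homD(2-4)[OF assms(2), symmetric]
  have "abelian_group B"
  proof (rule abelian_groupI)
    show "\<exists>y\<in>carrier B. y \<oplus>\<^bsub>B\<^esub> x = \<zero>\<^bsub>B\<^esub>" if "x \<in> carrier B" for x
    proof -
      obtain u where u: "u \<in> carrier A" "x = h u" using \<open>x \<in> carrier B\<close> assms(3) by auto
      then have "h (\<ominus>\<^bsub>A\<^esub> u) \<in> carrier B" "h (\<ominus>\<^bsub>A\<^esub> u) \<oplus>\<^bsub>B\<^esub> x = \<zero>\<^bsub>B\<^esub>"
        using assms(3,4) by (simp_all add: h M.l_neg)
      then show ?thesis by blast
    qed
  qed (use assms(3,4) in \<open>auto simp: h M.a_ac\<close>)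
  then show ?thesis
    by (rule nonassoc_algebraI)
      (use assms(3,4) in \<open>auto simp: h scale_add_left scale_add_right scale_assoc mult_add_left
        mult_add_right mult_smult_left mult_smult_right\<close>)
qed

lemma surj_hom_lie_algebra:
  assumes "lie_algebra A" "h \<in> alg_hom A B" "carrier B = h ` carrier A" "\<zero>\<^bsub>B\<^esub> = h \<zero>\<^bsub>A\<^esub>"
  shows "lie_algebra B"
proof -
  interpret lie_algebra A by fact
  interpret B: nonassoc_algebra B
    by (rule surj_hom_nonassoc_algebra[OF nonassoc_algebra_axioms assms(2-4)])
  note h = alg_homD(2-4)[OF assms(2), symmetric]
  show ?thesis
    by unfold_locales
      (use assms(3,4) in \<open>auto simp: B.mult_add_left B.mult_add_right B.mult_smult_left
        B.mult_smult_right h lie_alternating lie_jacobi\<close>)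
qed

context nonassoc_algebra
begin

context
  fixes I
  assumes ideal: "alg_ideal I A"
begin

lemma ideal_submodule: "submodule I ring_of_type_algebra A"
  using ideal by (simp add: alg_ideal_def)

lemma ideal_mult: "x \<in> carrier A \<Longrightarrow> y \<in> I \<Longrightarrow> x \<otimes> y \<in> I" "x \<in> carrier A \<Longrightarrow> y \<in> I \<Longrightarrow> y \<otimes> x \<in> I"
  using ideal by (auto simp: alg_ideal_def)

lemmas ideal_closed = submodule_closed[OF ideal_submodule]

lemma ideal_carrier: "x \<in> I \<Longrightarrow> x \<in> carrier A"
  using ideal_closed(1) by blast

lemma ideal_abelian_subgroup: "abelian_subgroup I A"
  using submodule.axioms(1)[OF ideal_submodule] M.abelian_group_axioms
  by (intro abelian_subgroupI3 additive_subgroup.intro)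

interpretation I: abelian_subgroup I A
  by (rule ideal_abelian_subgroup)

lemma coset_eq_iff:
  assumes "x \<in> carrier A" "y \<in> carrier A"
  shows "I +> x = I +> y \<longleftrightarrow> x \<ominus> y \<in> I"
proof
  assume "I +> x = I +> y"
  then have "x \<in> I +> y" using I.a_rcos_self[OF assms(1)] by simp
  then obtain i where "i \<in> I" "x = i \<oplus> y" by (auto simp: a_r_coset_def')
  then show "x \<ominus> y \<in> I"
    using assms ideal_carrier by (simp add: a_minus_def M.a_assoc M.r_neg)
next
  assume "x \<ominus> y \<in> I"
  moreover have "x = (x \<ominus> y) \<oplus> y"
    using assms by (simp add: a_minus_def M.a_assoc M.l_neg)
  ultimately have "x \<in> I +> y" by (auto simp: a_r_coset_def')
  then show "I +> x = I +> y"
    using M.a_repr_independence[OF _ assms(2) I.a_subgroup] by simp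
qed

lemma coset_eq_self_iff: "x \<in> carrier A \<Longrightarrow> I +> x = I \<longleftrightarrow> x \<in> I"
  using coset_eq_iff[of x "\<zero>"] M.a_coset_add_zero[OF ideal_closed(1)]
  by (simp add: a_minus_def minus_eq_scale)

lemma mem_coset_iff:
  assumes "y \<in> carrier A"
  shows "x \<in> I +> y \<longleftrightarrow> x \<in> carrier A \<and> I +> x = I +> y"
  using M.a_repr_independence[OF _ assms I.a_subgroup] I.a_rcos_self
    M.a_r_coset_subset_G[OF ideal_closed(1) assms] by blast

lemma coset_memD:
  assumes "y \<in> carrier A" "x \<in> I +> y"
  shows "x \<in> carrier A" "x \<ominus> y \<in> I"
proof -
  show x: "x \<in> carrier A" using assms mem_coset_iff by simp
  show "x \<ominus> y \<in> I" using assms mem_coset_iff coset_eq_iff[OF x assms(1)] by simp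
qed

lemma quot_carrier: "carrier (A AQuot I) = (\<lambda>x. I +> x) ` carrier A"
  by (auto simp: alg_quot_def ring.defs module.defs FactRing_def A_RCOSETS_def')

lemma quot_zero: "\<zero>\<^bsub>A AQuot I\<^esub> = I"
  by (simp add: alg_quot_def ring.defs module.defs FactRing_def)

lemma quot_add:
  "x \<in> carrier A \<Longrightarrow> y \<in> carrier A \<Longrightarrow>
    (I +> x) \<oplus>\<^bsub>A AQuot I\<^esub> (I +> y) = I +> (x \<oplus> y)"
  by (simp add: alg_quot_def ring.defs module.defs FactRing_def I.a_rcos_sum)

lemma quot_mult:
  assumes "x \<in> carrier A" "y \<in> carrier A"
  shows "(I +> x) \<otimes>\<^bsub>A AQuot I\<^esub> (I +> y) = I +> (x \<otimes> y)"
proof -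
  have *: "I +> (u \<otimes> v) = I +> (x \<otimes> y)" if "u \<in> I +> x" "v \<in> I +> y" for u v
  proof -
    have u: "u \<in> carrier A" "u \<ominus> x \<in> I" and v: "v \<in> carrier A" "v \<ominus> y \<in> I"
      using coset_memD[OF assms(1) that(1)] coset_memD[OF assms(2) that(2)] by simp_all
    have "u \<otimes> v \<ominus> x \<otimes> y = (u \<ominus> x) \<otimes> v \<oplus> x \<otimes> (v \<ominus> y)"
      using assms u(1) v(1) by (intro mult_diff)
    also have "\<dots> \<in> I"
      using assms u v by (intro ideal_closed(3) ideal_mult)
    finally show ?thesis using assms u v by (simp add: coset_eq_iff)
  qed
  have "x \<in> I +> x" "y \<in> I +> y" using assms I.a_rcos_self by auto
  then have "(\<Union>u\<in>I +> x. \<Union>v\<in>I +> y. I +> (u \<otimes> v)) = I +> (x \<otimes> y)"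
    by (intro UN_eq_const[where z=x] UN_eq_const[where z=y] *)
  then show ?thesis
    by (simp add: alg_quot_def ring.defs module.defs FactRing_def rcoset_mult_def)
qed

lemma quot_smult:
  assumes "x \<in> carrier A"
  shows "c \<odot>\<^bsub>A AQuot I\<^esub> (I +> x) = I +> (c \<odot> x)"
proof -
  have *: "I +> (c \<odot> u) = I +> (c \<odot> x)" if "u \<in> I +> x" for u
  proof -
    have u: "u \<in> carrier A" "u \<ominus> x \<in> I"
      using coset_memD[OF _ that] assms by simp_all
    have "c \<odot> u \<ominus> c \<odot> x = c \<odot> (u \<ominus> x)"
      using assms u(1) by (simp add: a_minus_def scale_add_right minus_eq_scale scale_assoc[symmetric])
    also have "\<dots> \<in> I" using u by (intro ideal_closed(4))
    finally show ?thesis using assms u by (simp add: coset_eq_iff)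
  qed
  have "x \<in> I +> x" using assms I.a_rcos_self by auto
  then have "(\<Union>u\<in>I +> x. I +> (c \<odot> u)) = I +> (c \<odot> x)"
    by (intro UN_eq_const[where z=x] *)
  then show ?thesis
    by (simp add: alg_quot_def ring.defs module.defs FactRing_def)
qed

lemma quot_proj_hom: "(\<lambda>x. I +> x) \<in> alg_hom A (A AQuot I)"
  by (rule alg_homI) (auto simp: quot_carrier quot_add quot_mult quot_smult)

lemma quot_nonassoc_algebra: "nonassoc_algebra (A AQuot I)"
  by (rule surj_hom_nonassoc_algebra[OF nonassoc_algebra_axioms quot_proj_hom])
    (simp_all add: quot_carrier quot_zero M.a_coset_add_zero[OF ideal_closed(1)])

lemma quot_lie_algebra: "lie_algebra A \<Longrightarrow> lie_algebra (A AQuot I)"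
  by (rule surj_hom_lie_algebra[OF _ quot_proj_hom])
    (simp_all add: quot_carrier quot_zero M.a_coset_add_zero[OF ideal_closed(1)])

end

end

lemma quot_induced_hom:
  assumes A: "nonassoc_algebra A" and I: "alg_ideal I A" and B: "nonassoc_algebra B"
    and h: "h \<in> alg_hom A B" and ker: "\<And>x. x \<in> I \<Longrightarrow> h x = \<zero>\<^bsub>B\<^esub>"
  obtains g where "g \<in> alg_hom (A AQuot I) B" "\<And>x. x \<in> carrier A \<Longrightarrow> g (I +>\<^bsub>A\<^esub> x) = h x"
proof -
  interpret A: nonassoc_algebra A by fact
  interpret B: nonassoc_algebra B by fact
  define g where "g C = h (SOME x. x \<in> C)" for C
  have g: "g (I +>\<^bsub>A\<^esub> x) = h x" if x: "x \<in> carrier A" for x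
  proof -
    have "x \<in> I +>\<^bsub>A\<^esub> x" using A.mem_coset_iff[OF I x] x by simp
    then have "(SOME u. u \<in> I +>\<^bsub>A\<^esub> x) \<in> I +>\<^bsub>A\<^esub> x"
      by (rule someI)
    then obtain u where u_def: "g (I +>\<^bsub>A\<^esub> x) = h u" and mem: "u \<in> I +>\<^bsub>A\<^esub> x"
      unfolding g_def by blast
    note u = A.coset_memD[OF I x mem]
    have "h u \<ominus>\<^bsub>B\<^esub> h x = \<zero>\<^bsub>B\<^esub>"
      unfolding alg_hom_minus[OF A B h u(1) x, symmetric] by (rule ker[OF u(2)])
    then have "h u = h x"
      by (rule B.eq_of_minus_zero[OF alg_homD(1)[OF h u(1)] alg_homD(1)[OF h x]])
    then show ?thesis by (simp only: u_def)
  qed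
  show ?thesis
  proof
    show "g \<in> alg_hom (A AQuot I) B"
      by (rule alg_homI)
        (auto simp: A.quot_carrier[OF I] A.quot_add[OF I] A.quot_mult[OF I] A.quot_smult[OF I] g
          alg_homD[OF h])
  qed (rule g)
qed

lemma quot_map_coset:
  assumes A: "nonassoc_algebra A" and I: "alg_ideal I A" and B: "nonassoc_algebra B"
    and J: "alg_ideal J B" and h: "h \<in> alg_hom A B" and IJ: "h ` I \<subseteq> J" and x: "x \<in> carrier A"
  shows "quot_map B J h (I +>\<^bsub>A\<^esub> x) = J +>\<^bsub>B\<^esub> h x"
proof -
  interpret A: nonassoc_algebra A by fact
  interpret B: nonassoc_algebra B by fact
  have "J +>\<^bsub>B\<^esub> h u = J +>\<^bsub>B\<^esub> h x" if "u \<in> I +>\<^bsub>A\<^esub> x" for u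
  proof -
    note u = A.coset_memD[OF I x that]
    then have "h u \<ominus>\<^bsub>B\<^esub> h x \<in> J"
      using IJ alg_hom_minus[OF A B h u(1) x] by auto
    then show ?thesis using B.coset_eq_iff[OF J] alg_homD(1)[OF h] u(1) x by simp
  qed
  moreover have "x \<in> I +>\<^bsub>A\<^esub> x"
    using A.mem_coset_iff[OF I x] x by simp
  ultimately show ?thesis
    unfolding quot_map_def by (intro UN_eq_const[where z=x])
qed


section \<open>The lower central series\<close>

context lie_algebra
begin

lemma lie_anticomm:
  assumes x: "x \<in> carrier L" and y: "y \<in> carrier L"
  shows "y \<otimes> x = (- 1) \<odot> (x \<otimes> y)"
proof -
  have "\<zero> = (x \<oplus> y) \<otimes> (x \<oplus> y)"
    using x y by (simp add: lie_alternating)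
  also have "\<dots> = (x \<otimes> x \<oplus> y \<otimes> x) \<oplus> (x \<otimes> y \<oplus> y \<otimes> y)"
    using x y by (simp only: mult_add_left mult_add_right M.add.m_closed)
  also have "\<dots> = y \<otimes> x \<oplus> x \<otimes> y"
    using x y by (simp add: lie_alternating M.a_comm)
  finally have eq: "\<dots> = \<zero>" ..
  then have "\<ominus> (x \<otimes> y) = y \<otimes> x"
    using x y by (intro M.minus_equality) simp_all
  then show ?thesis using x y by (simp add: minus_eq_scale)
qed

lemma lower_central_submodule: "submodule (lower_central L i) ring_of_type_algebra L"
proof (induction i rule: less_induct)
  case (less i)
  show ?case
  proof (cases "i \<le> 1")
    case True
    then have "i = 0 \<or> i = Suc 0" by linarith
    then show ?thesis using carrier_is_submodule by auto
  next
    case False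
    define j where "j = i - 2"
    have i: "i = Suc (Suc j)" using False by (simp add: j_def)
    have "lower_central L (Suc j) \<subseteq> carrier L"
      using less.IH[of "Suc j"] submodule_closed(1) i by blast
    then show ?thesis
      unfolding i lower_central.simps by (intro span_submodule(1)) auto
  qed
qed

lemmas lower_central_closed = submodule_closed[OF lower_central_submodule]

lemma lower_central_bracket:
  assumes "x \<in> lower_central L i" "y \<in> carrier L"
  shows "x \<otimes> y \<in> lower_central L (Suc i)"
proof (cases i)
  case (Suc j)
  have "{x \<otimes> y | x y. x \<in> lower_central L (Suc j) \<and> y \<in> carrier L} \<subseteq> carrier L"
    using lower_central_closed(1) by blast
  from span_submodule(2)[OF this] show ?thesis
    using assms unfolding Suc lower_central.simps by blast
qed (use assms in simp)

text \<open>
  The lower central series is the smallest filtration of this kind. This bounds it from above in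
  the test algebra and along homomorphisms.
\<close>

lemma lower_central_least:
  assumes F1: "carrier L \<subseteq> F 1" and sub: "\<And>i. submodule (F i) ring_of_type_algebra L"
    and step: "\<And>i x y. i \<ge> 1 \<Longrightarrow> x \<in> F i \<Longrightarrow> y \<in> carrier L \<Longrightarrow> x \<otimes> y \<in> F (Suc i)"
    and "i \<ge> 1"
  shows "lower_central L i \<subseteq> F i"
  using \<open>i \<ge> 1\<close>
proof (induction i rule: nat_induct_at_least)
  case (Suc n)
  obtain m where m: "n = Suc m" using Suc.hyps by (cases n) auto
  show ?case
    using Suc.IH step[OF Suc.hyps] unfolding m lower_central.simps
    by (intro span_least sub) blast
qed (use F1 in simp)

lemma lower_central_Suc_subset: "lower_central L (Suc i) \<subseteq> lower_central L i"
proof (cases i)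
  case (Suc j)
  have "lower_central L (Suc (Suc i)) \<subseteq> lower_central L (Suc i)" for i
  proof (induction i)
    case (Suc i)
    show ?case
      unfolding lower_central.simps(3)[of L "Suc i"]
      using Suc.IH lower_central_bracket[of _ "Suc i"]
      by (intro span_least lower_central_submodule) blast
  qed (use lower_central_closed(1)[of "Suc (Suc 0)"] in simp)
  then show ?thesis by (simp add: Suc)
qed simp

lemma lower_central_antimono: "i \<le> j \<Longrightarrow> lower_central L j \<subseteq> lower_central L i"
  by (rule lift_Suc_antimono_le[of "lower_central L"]) (simp_all add: lower_central_Suc_subset)

lemma lower_central_bracket':
  assumes "x \<in> carrier L" "y \<in> lower_central L i"
  shows "x \<otimes> y \<in> lower_central L (Suc i)"
proof -
  have "y \<in> carrier L" using assms(2) lower_central_closed(1) by blast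
  then show ?thesis
    using lower_central_bracket[OF assms(2,1)] assms(1) lie_anticomm[of y x]
      lower_central_closed(4)[of _ "Suc i" "- 1"] by simp
qed

lemma lower_central_ideal: "alg_ideal (lower_central L i) L"
  using lower_central_submodule lower_central_bracket[of _ i] lower_central_bracket'[of _ _ i]
    lower_central_Suc_subset[of i]
  unfolding alg_ideal_def by blast

lemma engel_lower_central:
  "x \<in> lower_central L i \<Longrightarrow> y \<in> carrier L \<Longrightarrow> engel L x n y \<in> lower_central L (i + n)"
  by (induction n) (simp_all add: lower_central_bracket)

lemma lower_central_omega_ideal: "alg_ideal (lower_central_omega L) L"
proof -
  have "submodule (lower_central_omega L) ring_of_type_algebra L"
    using lower_central_closed unfolding submodule_iff lower_central_omega_def by fastforce
  then show ?thesis
    using lower_central_ideal unfolding alg_ideal_def lower_central_omega_def by auto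
qed

lemma lower_central_omega_subset: "i \<ge> 1 \<Longrightarrow> lower_central_omega L \<subseteq> lower_central L i"
  by (auto simp: lower_central_omega_def)

end

lemma hom_vimage_submodule:
  assumes "nonassoc_algebra A" "nonassoc_algebra B" "h \<in> alg_hom A B"
    "submodule H ring_of_type_algebra B"
  shows "submodule {x \<in> carrier A. h x \<in> H} ring_of_type_algebra A"
proof -
  interpret A: nonassoc_algebra A by fact
  interpret B: nonassoc_algebra B by fact
  show ?thesis
    using B.submodule_closed[OF assms(4)] alg_homD[OF assms(3)] alg_hom_zero[OF assms(1-3)]
    unfolding A.submodule_iff by auto
qed

lemma hom_lower_central:
  assumes "lie_algebra A" "lie_algebra B" "h \<in> alg_hom A B" "i \<ge> 1" "x \<in> lower_central A i"
  shows "h x \<in> lower_central B i"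
proof -
  interpret A: lie_algebra A by fact
  interpret B: lie_algebra B by fact
  have "lower_central A i \<subseteq> {x \<in> carrier A. h x \<in> lower_central B i}"
    using \<open>i \<ge> 1\<close>
    by (intro A.lower_central_least hom_vimage_submodule[OF A.nonassoc_algebra_axioms
          B.nonassoc_algebra_axioms assms(3)] B.lower_central_submodule)
      (auto simp: alg_homD[OF assms(3)] B.lower_central_bracket)
  then show ?thesis using assms(5) by blast
qed

lemma hom_image_submodule:
  assumes "nonassoc_algebra A" "nonassoc_algebra B" "h \<in> alg_hom A B"
    "submodule H ring_of_type_algebra A"
  shows "submodule (h ` H) ring_of_type_algebra B"
proof -
  interpret A: nonassoc_algebra A by fact
  interpret B: nonassoc_algebra B by fact
  note H = A.submodule_closed[OF assms(4)]
  have "h x \<oplus>\<^bsub>B\<^esub> h y \<in> h ` H" if "x \<in> H" "y \<in> H" for x y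
    using subsetD[OF H(1) that(1)] subsetD[OF H(1) that(2)] H(3)[OF that] alg_homD(2)[OF assms(3), of x y]
    by (metis imageI)
  moreover have "c \<odot>\<^bsub>B\<^esub> h x \<in> h ` H" if "x \<in> H" for c x
    using subsetD[OF H(1) that] H(4)[OF that, of c] alg_homD(4)[OF assms(3), of x c] by (metis imageI)
  moreover have "\<zero>\<^bsub>B\<^esub> \<in> h ` H"
    using H(2) alg_hom_zero[OF assms(1-3)] by force
  ultimately show ?thesis
    using H(1) alg_homD(1)[OF assms(3)] unfolding B.submodule_iff by auto
qed

text \<open>
  Besides \<open>hom_lower_central\<close> this uses that the image filtration is itself closed under brackets
  with all elements, since these lift.
\<close>

lemma surj_hom_lower_central:
  assumes "lie_algebra A" "lie_algebra B" "h \<in> alg_hom A B" "carrier B \<subseteq> h ` carrier A" "i \<ge> 1"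
  shows "lower_central B i = h ` lower_central A i"
proof
  interpret A: lie_algebra A by fact
  interpret B: lie_algebra B by fact
  show "h ` lower_central A i \<subseteq> lower_central B i"
    using hom_lower_central[OF assms(1-3,5)] by blast
  show "lower_central B i \<subseteq> h ` lower_central A i"
  proof (rule B.lower_central_least)
    fix i x y assume "i \<ge> 1" "x \<in> h ` lower_central A i" "y \<in> carrier B"
    then obtain u v where "u \<in> lower_central A i" "x = h u" "v \<in> carrier A" "y = h v"
      using assms(4) by blast
    then show "x \<otimes>\<^bsub>B\<^esub> y \<in> h ` lower_central A (Suc i)"
      using A.lower_central_bracket[of u i v] A.lower_central_closed(1)[of i] alg_homD(3)[OF assms(3), of u v]
      by (metis imageI subsetD)
  qed (use assms in \<open>auto intro: hom_image_submodule A.lower_central_submodule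
      A.nonassoc_algebra_axioms B.nonassoc_algebra_axioms\<close>)
qed


section \<open>Free Lie algebras and presentations\<close>

lemma finite_support_induct [consumes 2, case_names zero step]:
  fixes f :: "'t \<Rightarrow> 'k::comm_monoid_add"
  assumes "finite {t. f t \<noteq> 0}" "{t. f t \<noteq> 0} \<subseteq> T"
    and zero: "P (\<lambda>t. 0)"
    and step: "\<And>f c t. finite {t. f t \<noteq> 0} \<Longrightarrow> {t. f t \<noteq> 0} \<subseteq> T \<Longrightarrow> t \<in> T \<Longrightarrow> P f \<Longrightarrow>
      P (\<lambda>s. (if s = t then c else 0) + f s)"
  shows "P f"
  using assms(1,2)
proof (induction "{t. f t \<noteq> 0}" arbitrary: f rule: finite_induct)
  case empty
  then have "f = (\<lambda>t. 0)" by auto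
  then show ?case using zero by simp
next
  case (insert t F f)
  let ?g = "f(t := 0)"
  have F: "{s. ?g s \<noteq> 0} = F" using insert.hyps(2,4) by auto
  have T: "{s. ?g s \<noteq> 0} \<subseteq> T" using insert.prems by auto
  then have Pg: "P ?g"
    using F insert.hyps(1) insert.hyps(3)[of ?g] by metis
  have "P (\<lambda>s. (if s = t then f t else 0) + ?g s)"
  proof (intro step)
    show "finite {s. ?g s \<noteq> 0}" unfolding F by (rule insert.hyps(1))
    show "t \<in> T" using insert.hyps(4) insert.prems by blast
  qed (rule T Pg)+
  moreover have "(\<lambda>s. (if s = t then f t else 0) + ?g s) = f" by auto
  ultimately show ?case by simp
qed

lemma free_nonassoc_simps:
  "carrier (free_nonassoc S) = {f. finite {t. f t \<noteq> 0} \<and> {t. f t \<noteq> 0} \<subseteq> {t. set_magma t \<subseteq> S}}"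
  "f \<otimes>\<^bsub>free_nonassoc S\<^esub> g = (\<lambda>t. case t of Gen x \<Rightarrow> 0 | Prod u v \<Rightarrow> f u * g v)"
  "\<zero>\<^bsub>free_nonassoc S\<^esub> = (\<lambda>t. 0)"
  "f \<oplus>\<^bsub>free_nonassoc S\<^esub> g = (\<lambda>t. f t + g t)"
  "c \<odot>\<^bsub>free_nonassoc S\<^esub> f = (\<lambda>t. c * f t)"
  by (auto simp: free_nonassoc_def)

lemma free_nonassoc_add_closed:
  assumes "f \<in> carrier (free_nonassoc S)" "g \<in> carrier (free_nonassoc S)"
  shows "(\<lambda>t. f t + g t) \<in> carrier (free_nonassoc S)"
proof -
  have "{t. f t + g t \<noteq> 0} \<subseteq> {t. f t \<noteq> 0} \<union> {t. g t \<noteq> 0}" by auto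
  then show ?thesis
    using assms unfolding free_nonassoc_simps by (auto intro: finite_subset)
qed

lemma free_nonassoc_scale_closed:
  assumes "f \<in> carrier (free_nonassoc S)"
  shows "(\<lambda>t. c * f t) \<in> carrier (free_nonassoc S)"
proof -
  have "{t. c * f t \<noteq> 0} \<subseteq> {t. f t \<noteq> 0}" by auto
  then show ?thesis
    using assms unfolding free_nonassoc_simps by (auto intro: finite_subset)
qed

lemma free_nonassoc_mult_closed:
  assumes "f \<in> carrier (free_nonassoc S)" "g \<in> carrier (free_nonassoc S)"
  shows "(\<lambda>t. case t of Gen x \<Rightarrow> 0 | Prod u v \<Rightarrow> f u * g v) \<in> carrier (free_nonassoc S)"
proof -
  let ?h = "\<lambda>t. case t of Gen x \<Rightarrow> 0 | Prod u v \<Rightarrow> f u * g v"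
  have sub: "{t. ?h t \<noteq> 0} \<subseteq> (\<lambda>(u, v). Prod u v) ` ({t. f t \<noteq> 0} \<times> {t. g t \<noteq> 0})"
    by (force split: magma.splits)
  moreover have "finite ((\<lambda>(u, v). Prod u v) ` ({t. f t \<noteq> 0} \<times> {t. g t \<noteq> 0}))"
    using assms by (auto simp: free_nonassoc_simps)
  ultimately have "finite {t. ?h t \<noteq> 0}" by (rule finite_subset)
  moreover have "{t. ?h t \<noteq> 0} \<subseteq> {t. set_magma t \<subseteq> S}"
    using sub assms by (fastforce simp: free_nonassoc_simps)
  ultimately show ?thesis unfolding free_nonassoc_simps by blast
qed

lemma nonassoc_algebra_free_nonassoc: "nonassoc_algebra (free_nonassoc S)"
proof (rule nonassoc_algebraI)
  show "abelian_group (free_nonassoc S)"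
  proof (rule abelian_groupI)
    show "\<exists>g\<in>carrier (free_nonassoc S). g \<oplus>\<^bsub>free_nonassoc S\<^esub> f = \<zero>\<^bsub>free_nonassoc S\<^esub>"
      if "f \<in> carrier (free_nonassoc S)" for f
      using that free_nonassoc_scale_closed[of f S "- 1"]
      by (intro bexI[of _ "\<lambda>t. - 1 * f t"]) (simp_all add: free_nonassoc_simps(3,4))
    show "\<zero>\<^bsub>free_nonassoc S\<^esub> \<in> carrier (free_nonassoc S)"
      by (simp add: free_nonassoc_simps)
  qed (simp_all add: free_nonassoc_add_closed free_nonassoc_simps(3-5) algebra_simps)
qed (use free_nonassoc_scale_closed free_nonassoc_mult_closed in
    \<open>auto simp: free_nonassoc_simps(2-5) algebra_simps fun_eq_iff split: magma.splits\<close>)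

primrec magma_eval :: "('k, 'b) module \<Rightarrow> ('x \<Rightarrow> 'b) \<Rightarrow> 'x magma \<Rightarrow> 'b" where
  "magma_eval B \<phi> (Gen x) = \<phi> x"
| "magma_eval B \<phi> (Prod u v) = magma_eval B \<phi> u \<otimes>\<^bsub>B\<^esub> magma_eval B \<phi> v"

context nonassoc_algebra
begin

definition linear_ext :: "('t \<Rightarrow> 'a) \<Rightarrow> ('t \<Rightarrow> 'k) \<Rightarrow> 'a" where
  "linear_ext e f = (\<Oplus>t\<in>{t. f t \<noteq> 0}. f t \<odot> e t)"

context
  fixes T :: "'t set" and e :: "'t \<Rightarrow> 'a"
  assumes e: "\<And>t. t \<in> T \<Longrightarrow> e t \<in> carrier A"
begin

lemma linear_ext_superset:
  assumes "finite F" "{t. f t \<noteq> 0} \<subseteq> F" "F \<subseteq> T"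
  shows "linear_ext e f = (\<Oplus>t\<in>F. f t \<odot> e t)"
  unfolding linear_ext_def
  by (rule M.add.finprod_mono_neutral_cong_left) (use assms e in auto)

lemma linear_ext_closed:
  assumes "{t. f t \<noteq> 0} \<subseteq> T"
  shows "linear_ext e f \<in> carrier A"
  unfolding linear_ext_def by (rule M.finsum_closed) (use assms e in auto)

lemma linear_ext_add:
  assumes "finite {t. f t \<noteq> 0}" "{t. f t \<noteq> 0} \<subseteq> T" "finite {t. g t \<noteq> 0}" "{t. g t \<noteq> 0} \<subseteq> T"
  shows "linear_ext e (\<lambda>t. f t + g t) = linear_ext e f \<oplus> linear_ext e g"
proof -
  let ?F = "{t. f t \<noteq> 0} \<union> {t. g t \<noteq> 0}"
  have F: "finite ?F" "?F \<subseteq> T" using assms by auto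
  have "linear_ext e (\<lambda>t. f t + g t) = (\<Oplus>t\<in>?F. (f t + g t) \<odot> e t)"
    using F by (intro linear_ext_superset) auto
  also have "\<dots> = (\<Oplus>t\<in>?F. f t \<odot> e t \<oplus> g t \<odot> e t)"
    using F e by (intro M.finsum_cong) (auto simp: scale_add_left simp_implies_def)
  also have "\<dots> = (\<Oplus>t\<in>?F. f t \<odot> e t) \<oplus> (\<Oplus>t\<in>?F. g t \<odot> e t)"
    using F e by (intro M.finsum_addf) auto
  also have "(\<Oplus>t\<in>?F. f t \<odot> e t) = linear_ext e f"
    using F by (intro linear_ext_superset[symmetric]) auto
  also have "(\<Oplus>t\<in>?F. g t \<odot> e t) = linear_ext e g"
    using F by (intro linear_ext_superset[symmetric]) auto
  finally show ?thesis .
qed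

lemma linear_ext_single:
  assumes "t \<in> T"
  shows "linear_ext e (\<lambda>s. if s = t then c else 0) = c \<odot> e t"
proof -
  have "linear_ext e (\<lambda>s. if s = t then c else 0) = (\<Oplus>s\<in>{t}. (if s = t then c else 0) \<odot> e s)"
    using assms by (intro linear_ext_superset) auto
  also have "\<dots> = c \<odot> e t"
    using e[OF assms] by (subst M.finsum_insert) auto
  finally show ?thesis .
qed

lemma linear_ext_scale:
  assumes "finite {t. f t \<noteq> 0}" "{t. f t \<noteq> 0} \<subseteq> T"
  shows "linear_ext e (\<lambda>t. c * f t) = c \<odot> linear_ext e f"
proof -
  have "linear_ext e (\<lambda>t. c * f t) = (\<Oplus>t\<in>{t. f t \<noteq> 0}. (c * f t) \<odot> e t)"
    using assms by (intro linear_ext_superset) auto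
  also have "\<dots> = (\<Oplus>t\<in>{t. f t \<noteq> 0}. c \<odot> (f t \<odot> e t))"
    using assms e by (intro M.finsum_cong) (auto simp: scale_assoc simp_implies_def)
  also have "\<dots> = c \<odot> linear_ext e f"
    unfolding linear_ext_def using assms e by (subst finsum_smult_ldistr) auto
  finally show ?thesis .
qed

end

lemma free_nonassoc_universal:
  assumes \<phi>: "\<And>x. x \<in> S \<Longrightarrow> \<phi> x \<in> carrier A"
  shows "\<exists>h\<in>alg_hom (free_nonassoc S) A. \<forall>x\<in>S. h (\<lambda>t. if t = Gen x then 1 else 0) = \<phi> x"
proof -
  let ?T = "{t. set_magma t \<subseteq> S}"
  let ?e = "magma_eval A \<phi>"
  let ?h = "linear_ext ?e"
  let ?F = "free_nonassoc S :: ('k, _) module"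
  have e: "?e t \<in> carrier A" if "t \<in> ?T" for t
    using that by (induction t) (auto simp: \<phi>)
  note add = linear_ext_add[of ?T ?e, OF e] and single = linear_ext_single[of ?T ?e, OF e]
    and scale = linear_ext_scale[of ?T ?e, OF e] and closed = linear_ext_closed[of ?T ?e, OF e]
  interpret F: nonassoc_algebra ?F by (rule nonassoc_algebra_free_nonassoc)
  have sc: "(\<lambda>s. if s = t then c else 0) \<in> carrier ?F" if "t \<in> ?T" for t and c :: 'k
    using that by (auto simp: free_nonassoc_simps(1))
  have h_add: "?h (f \<oplus>\<^bsub>?F\<^esub> g) = ?h f \<oplus> ?h g" if "f \<in> carrier ?F" "g \<in> carrier ?F" for f g
    using that unfolding free_nonassoc_simps(1,4) by (intro add) auto
  have h_closed: "?h f \<in> carrier A" if "f \<in> carrier ?F" for f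
    using that unfolding free_nonassoc_simps(1) by (intro closed) auto
  have h_zero: "?h (\<lambda>t. 0) = \<zero>"
    by (simp add: linear_ext_def)
  have mult1: "?h ((\<lambda>s. if s = t then c else 0) \<otimes>\<^bsub>?F\<^esub> g) = (c \<odot> ?e t) \<otimes> ?h g"
    if t: "t \<in> ?T" and "g \<in> carrier ?F" for t c g
  proof -
    have "finite {t. g t \<noteq> 0}" "{t. g t \<noteq> 0} \<subseteq> ?T"
      using that(2) unfolding free_nonassoc_simps(1) by auto
    then show ?thesis
    proof (induction rule: finite_support_induct)
      case zero
      have "(\<lambda>s. if s = t then c else 0) \<otimes>\<^bsub>?F\<^esub> (\<lambda>t. 0) = (\<lambda>t. 0)"
        by (auto simp: free_nonassoc_simps split: magma.splits)
      then show ?case using e[OF t] by (simp add: h_zero)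
    next
      case (step g d u)
      let ?u = "\<lambda>s. if s = u then d else 0"
      have g: "g \<in> carrier ?F" using step by (auto simp: free_nonassoc_simps(1))
      have pr: "(\<lambda>s. if s = t then c else 0) \<otimes>\<^bsub>?F\<^esub> ?u = (\<lambda>s. if s = Prod t u then c * d else 0)"
        by (auto simp: free_nonassoc_simps fun_eq_iff split: magma.splits)
      let ?t = "\<lambda>s. if s = t then c else 0"
      have u: "?u \<in> carrier ?F" and tc: "?t \<in> carrier ?F" using t step(3) by (auto intro: sc)
      have hu: "?h ?u = d \<odot> ?e u" using step(3) by (intro single) auto
      have "?h (?t \<otimes>\<^bsub>?F\<^esub> ?u) = (c * d) \<odot> ?e (Prod t u)"
        unfolding pr using t step(3) by (intro single) auto
      then have 1: "?h (?t \<otimes>\<^bsub>?F\<^esub> ?u) = (c \<odot> ?e t) \<otimes> ?h ?u"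
        unfolding hu using e[OF t] e[of u] step(3)
        by (simp add: mult_smult_left mult_smult_right scale_assoc[symmetric] mult.commute)
      have 2: "?h (?t \<otimes>\<^bsub>?F\<^esub> (?u \<oplus>\<^bsub>?F\<^esub> g)) = ?h (?t \<otimes>\<^bsub>?F\<^esub> ?u) \<oplus> ?h (?t \<otimes>\<^bsub>?F\<^esub> g)"
        unfolding F.mult_add_right[OF tc u g] by (intro h_add F.mult_closed tc u g)
      have 3: "?h (?u \<oplus>\<^bsub>?F\<^esub> g) = ?h ?u \<oplus> ?h g" by (rule h_add[OF u g])
      have "?h (?t \<otimes>\<^bsub>?F\<^esub> (?u \<oplus>\<^bsub>?F\<^esub> g)) = (c \<odot> ?e t) \<otimes> ?h (?u \<oplus>\<^bsub>?F\<^esub> g)"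
        unfolding 1 2 3 step(4) using e[OF t] by (intro mult_add_right[symmetric] h_closed u g) simp
      then show ?case by (simp only: free_nonassoc_simps(4))
    qed
  qed
  have mult: "?h (f \<otimes>\<^bsub>?F\<^esub> g) = ?h f \<otimes> ?h g" if "f \<in> carrier ?F" and g: "g \<in> carrier ?F" for f g
  proof -
    have "finite {t. f t \<noteq> 0}" "{t. f t \<noteq> 0} \<subseteq> ?T"
      using that(1) unfolding free_nonassoc_simps(1) by auto
    then show ?thesis
    proof (induction rule: finite_support_induct)
      case zero
      have "(\<lambda>t. 0) \<otimes>\<^bsub>?F\<^esub> g = (\<lambda>t. 0)"
        by (auto simp: free_nonassoc_simps split: magma.splits)
      then show ?case using h_closed[OF g] by (simp add: h_zero)
    next
      case (step f c t)
      let ?t = "\<lambda>s. if s = t then c else 0"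
      have f: "f \<in> carrier ?F" using step by (auto simp: free_nonassoc_simps(1))
      have t: "?t \<in> carrier ?F" using step(3) by (auto intro: sc)
      have 1: "?h (?t \<otimes>\<^bsub>?F\<^esub> g) = ?h ?t \<otimes> ?h g"
        using mult1[OF step(3) g, of c] single[OF _ step(3), of c] by simp
      have 2: "?h ((?t \<oplus>\<^bsub>?F\<^esub> f) \<otimes>\<^bsub>?F\<^esub> g) = ?h (?t \<otimes>\<^bsub>?F\<^esub> g) \<oplus> ?h (f \<otimes>\<^bsub>?F\<^esub> g)"
        unfolding F.mult_add_left[OF t f g] by (intro h_add F.mult_closed t f g)
      have 3: "?h (?t \<oplus>\<^bsub>?F\<^esub> f) = ?h ?t \<oplus> ?h f" by (rule h_add[OF t f])
      have "?h ((?t \<oplus>\<^bsub>?F\<^esub> f) \<otimes>\<^bsub>?F\<^esub> g) = ?h (?t \<oplus>\<^bsub>?F\<^esub> f) \<otimes> ?h g"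
        unfolding 1 2 3 step(4) by (intro mult_add_left[symmetric] h_closed t f g)
      then show ?case by (simp only: free_nonassoc_simps(4))
    qed
  qed
  have "?h \<in> alg_hom ?F A"
  proof (rule alg_homI)
    fix c f assume "f \<in> carrier ?F"
    then show "?h (c \<odot>\<^bsub>?F\<^esub> f) = c \<odot> ?h f"
      unfolding free_nonassoc_simps(1,5) by (intro scale) auto
  qed (use h_closed h_add mult in auto)
  moreover have "?h (\<lambda>t. if t = Gen x then 1 else 0) = \<phi> x" if "x \<in> S" for x
    using that single[of "Gen x" 1] \<phi>[OF that] by simp
  ultimately show ?thesis by blast
qed

end

lemma lie_identities_subset: "lie_identities (free_nonassoc S) \<subseteq> carrier (free_nonassoc S)"
proof -
  interpret nonassoc_algebra "free_nonassoc S" by (rule nonassoc_algebra_free_nonassoc)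
  show ?thesis by (auto simp: lie_identities_def)
qed

lemma free_lie_ideal:
  "alg_ideal (alg_genideal (free_nonassoc S) (lie_identities (free_nonassoc S))) (free_nonassoc S)"
proof -
  interpret nonassoc_algebra "free_nonassoc S" by (rule nonassoc_algebra_free_nonassoc)
  show ?thesis by (intro genideal_ideal lie_identities_subset)
qed

lemma lie_algebra_free_lie: "lie_algebra (free_lie S)"
proof -
  let ?F = "free_nonassoc S"
  let ?J = "alg_genideal ?F (lie_identities ?F)"
  interpret F: nonassoc_algebra ?F by (rule nonassoc_algebra_free_nonassoc)
  note J = free_lie_ideal[of S]
  interpret Q: nonassoc_algebra "?F AQuot ?J" by (rule F.quot_nonassoc_algebra[OF J])
  have id: "?J +>\<^bsub>?F\<^esub> r = \<zero>\<^bsub>?F AQuot ?J\<^esub>" if "r \<in> lie_identities ?F" for r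
    using that F.genideal_ideal(2)[OF lie_identities_subset] lie_identities_subset[of S]
    by (subst F.quot_zero[OF J], subst F.coset_eq_self_iff[OF J]) auto
  have sq: "x \<otimes>\<^bsub>?F AQuot ?J\<^esub> x = \<zero>\<^bsub>?F AQuot ?J\<^esub>" if x: "x \<in> carrier (?F AQuot ?J)" for x
  proof -
    obtain f where f: "f \<in> carrier ?F" "x = ?J +>\<^bsub>?F\<^esub> f" using x by (auto simp: F.quot_carrier[OF J])
    have "f \<otimes>\<^bsub>?F\<^esub> f \<in> lie_identities ?F" using f unfolding lie_identities_def by blast
    from id[OF this] show ?thesis by (simp add: f F.quot_mult[OF J])
  qed
  have jac: "x \<otimes>\<^bsub>?F AQuot ?J\<^esub> (y \<otimes>\<^bsub>?F AQuot ?J\<^esub> z) \<oplus>\<^bsub>?F AQuot ?J\<^esub>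
      y \<otimes>\<^bsub>?F AQuot ?J\<^esub> (z \<otimes>\<^bsub>?F AQuot ?J\<^esub> x) \<oplus>\<^bsub>?F AQuot ?J\<^esub>
      z \<otimes>\<^bsub>?F AQuot ?J\<^esub> (x \<otimes>\<^bsub>?F AQuot ?J\<^esub> y) = \<zero>\<^bsub>?F AQuot ?J\<^esub>"
    if xyz: "x \<in> carrier (?F AQuot ?J)" "y \<in> carrier (?F AQuot ?J)" "z \<in> carrier (?F AQuot ?J)" for x y z
  proof -
    obtain f g h where f: "f \<in> carrier ?F" "x = ?J +>\<^bsub>?F\<^esub> f" and g: "g \<in> carrier ?F" "y = ?J +>\<^bsub>?F\<^esub> g"
      and h: "h \<in> carrier ?F" "z = ?J +>\<^bsub>?F\<^esub> h"
      using xyz by (auto simp: F.quot_carrier[OF J])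
    have "f \<otimes>\<^bsub>?F\<^esub> (g \<otimes>\<^bsub>?F\<^esub> h) \<oplus>\<^bsub>?F\<^esub> g \<otimes>\<^bsub>?F\<^esub> (h \<otimes>\<^bsub>?F\<^esub> f) \<oplus>\<^bsub>?F\<^esub> h \<otimes>\<^bsub>?F\<^esub> (f \<otimes>\<^bsub>?F\<^esub> g)
        \<in> lie_identities ?F"
      using f g h unfolding lie_identities_def by blast
    from id[OF this] show ?thesis
      by (simp add: f g h F.quot_mult[OF J] F.quot_add[OF J])
  qed
  show ?thesis
    unfolding free_lie_def
    by unfold_locales
      (use sq jac in \<open>simp_all add: Q.mult_add_left Q.mult_add_right Q.mult_smult_left Q.mult_smult_right\<close>)
qed

lemma free_nonassoc_gen: "x \<in> S \<Longrightarrow> (\<lambda>t. if t = Gen x then 1 else 0) \<in> carrier (free_nonassoc S)"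
  by (auto simp: free_nonassoc_simps(1))

lemma lie_gen_closed: "x \<in> S \<Longrightarrow> lie_gen S x \<in> carrier (free_lie S)"
proof -
  interpret F: nonassoc_algebra "free_nonassoc S" by (rule nonassoc_algebra_free_nonassoc)
  show "x \<in> S \<Longrightarrow> lie_gen S x \<in> carrier (free_lie S)"
    unfolding free_lie_def lie_gen_def F.quot_carrier[OF free_lie_ideal]
    by (intro imageI free_nonassoc_gen)
qed

lemma free_lie_universal:
  fixes B :: "('k::comm_ring_1, 'b) module" and \<phi> :: "'x \<Rightarrow> 'b"
  assumes "lie_algebra B" and \<phi>: "\<And>x. x \<in> S \<Longrightarrow> \<phi> x \<in> carrier B"
  shows "\<exists>h\<in>alg_hom (free_lie S) B. \<forall>x\<in>S. h (lie_gen S x) = \<phi> x"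
proof -
  let ?F = "free_nonassoc S :: ('k, 'x magma \<Rightarrow> 'k) module"
  interpret F: nonassoc_algebra ?F by (rule nonassoc_algebra_free_nonassoc)
  interpret B: lie_algebra B by fact
  obtain h where h: "h \<in> alg_hom ?F B" and hx: "\<And>x. x \<in> S \<Longrightarrow> h (\<lambda>t. if t = Gen x then 1 else 0) = \<phi> x"
    using B.free_nonassoc_universal[of S \<phi>] \<phi> by blast
  note hh = alg_homD[OF h]
  have "alg_ideal {f \<in> carrier ?F. h f = \<zero>\<^bsub>B\<^esub>} ?F"
    using hh alg_hom_zero[OF F.nonassoc_algebra_axioms B.nonassoc_algebra_axioms h]
    unfolding alg_ideal_def F.submodule_iff by auto
  moreover have "lie_identities ?F \<subseteq> {f \<in> carrier ?F. h f = \<zero>\<^bsub>B\<^esub>}"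
    by (auto simp: lie_identities_def hh B.lie_alternating B.lie_jacobi)
  ultimately have "alg_genideal ?F (lie_identities ?F) \<subseteq> {f \<in> carrier ?F. h f = \<zero>\<^bsub>B\<^esub>}"
    by (rule F.genideal_least)
  then obtain g where g: "g \<in> alg_hom (free_lie S) B"
    "\<And>f. f \<in> carrier ?F \<Longrightarrow> g (alg_genideal ?F (lie_identities ?F) +>\<^bsub>?F\<^esub> f) = h f"
    unfolding free_lie_def
    using quot_induced_hom[OF F.nonassoc_algebra_axioms free_lie_ideal B.nonassoc_algebra_axioms h]
    by blast
  show ?thesis
    by (rule bexI[OF _ g(1)]) (simp add: lie_gen_def g(2) free_nonassoc_gen hx)
qed

text \<open>
  An induction principle for free Lie algebras: magma words span, and each word is an iterated
  bracket of generators.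
\<close>

lemma free_lie_generated:
  fixes H :: "('x magma \<Rightarrow> 'k::comm_ring_1) set set"
  assumes H: "submodule H ring_of_type_algebra (free_lie S)"
    and mult: "\<And>x y. x \<in> H \<Longrightarrow> y \<in> H \<Longrightarrow> x \<otimes>\<^bsub>free_lie S\<^esub> y \<in> H"
    and gen: "\<And>x. x \<in> S \<Longrightarrow> lie_gen S x \<in> H"
  shows "carrier (free_lie S) \<subseteq> H"
proof
  let ?F = "free_nonassoc S :: ('k, 'x magma \<Rightarrow> 'k) module"
  let ?L = "free_lie S :: ('k, ('x magma \<Rightarrow> 'k) set) module"
  let ?J = "alg_genideal ?F (lie_identities ?F)"
  interpret F: nonassoc_algebra ?F by (rule nonassoc_algebra_free_nonassoc)
  interpret L: lie_algebra ?L by (rule lie_algebra_free_lie)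
  note J = free_lie_ideal[of S]
  note Hc = L.submodule_closed[OF H]
  fix x assume "x \<in> carrier ?L"
  then obtain f where f: "f \<in> carrier ?F" and x: "x = ?J +>\<^bsub>?F\<^esub> f"
    by (auto simp: free_lie_def F.quot_carrier[OF J])
  have sc: "(\<lambda>s. if s = t then c else 0) \<in> carrier ?F" if "set_magma t \<subseteq> S" for t c
    using that by (auto simp: free_nonassoc_simps(1))
  have basis: "?J +>\<^bsub>?F\<^esub> (\<lambda>s. if s = t then 1 else 0) \<in> H" if "set_magma t \<subseteq> S" for t
    using that
  proof (induction t)
    case (Gen x)
    then show ?case using gen[of x] by (simp add: lie_gen_def)
  next
    case (Prod u v)
    have "(\<lambda>s. if s = Prod u v then 1 else 0)
        = (\<lambda>s. if s = u then 1 else 0) \<otimes>\<^bsub>?F\<^esub> (\<lambda>s. if s = v then 1 else 0)"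
      by (auto simp: free_nonassoc_simps fun_eq_iff split: magma.splits)
    note eq = this
    have "?J +>\<^bsub>?F\<^esub> (\<lambda>s. if s = Prod u v then 1 else 0)
        = (?J +>\<^bsub>?F\<^esub> (\<lambda>s. if s = u then 1 else 0)) \<otimes>\<^bsub>?L\<^esub> (?J +>\<^bsub>?F\<^esub> (\<lambda>s. if s = v then 1 else 0))"
      unfolding eq free_lie_def using Prod.prems by (intro F.quot_mult[OF J, symmetric] sc) auto
    also have "\<dots> \<in> H" using Prod by (intro mult) auto
    finally show ?case .
  qed
  have "finite {t. f t \<noteq> 0}" "{t. f t \<noteq> 0} \<subseteq> {t. set_magma t \<subseteq> S}"
    using f by (auto simp: free_nonassoc_simps(1))
  then have "?J +>\<^bsub>?F\<^esub> f \<in> H"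
  proof (induction rule: finite_support_induct)
    case zero
    have "?J +>\<^bsub>?F\<^esub> \<zero>\<^bsub>?F\<^esub> = \<zero>\<^bsub>?L\<^esub>"
      unfolding free_lie_def F.quot_zero[OF J]
      using F.ideal_closed(2)[OF J] by (simp add: F.coset_eq_self_iff[OF J])
    then show ?case using Hc(2) by (simp add: free_nonassoc_simps(3))
  next
    case (step f c t)
    have f: "f \<in> carrier ?F" using step by (auto simp: free_nonassoc_simps(1))
    have t: "set_magma t \<subseteq> S" using step(3) by simp
    have eq: "(\<lambda>s. (if s = t then c else 0) + f s)
        = c \<odot>\<^bsub>?F\<^esub> (\<lambda>s. if s = t then 1 else 0) \<oplus>\<^bsub>?F\<^esub> f"
      by (auto simp: free_nonassoc_simps)
    have "?J +>\<^bsub>?F\<^esub> (c \<odot>\<^bsub>?F\<^esub> (\<lambda>s. if s = t then 1 else 0) \<oplus>\<^bsub>?F\<^esub> f)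
        = c \<odot>\<^bsub>?L\<^esub> (?J +>\<^bsub>?F\<^esub> (\<lambda>s. if s = t then 1 else 0)) \<oplus>\<^bsub>?L\<^esub> (?J +>\<^bsub>?F\<^esub> f)"
      unfolding free_lie_def using sc[OF t, of 1] f
      by (simp add: F.quot_add[OF J] F.quot_smult[OF J])
    also have "\<dots> \<in> H" using basis[OF t] step(4) by (intro Hc)
    finally show ?case unfolding eq .
  qed
  then show "x \<in> H" by (simp add: x)
qed

definition pres_gen ::
  "'x set \<Rightarrow> ('x magma \<Rightarrow> 'k::comm_ring_1) set set \<Rightarrow> 'x \<Rightarrow> ('x magma \<Rightarrow> 'k) set set" where
  "pres_gen S rels x = alg_genideal (free_lie S) rels +>\<^bsub>free_lie S\<^esub> lie_gen S x"

context
  fixes S :: "'x set" and rels :: "('x magma \<Rightarrow> 'k::comm_ring_1) set set"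
  assumes rels: "rels \<subseteq> carrier (free_lie S)"
begin

interpretation L: lie_algebra "free_lie S :: ('k, _) module"
  by (rule lie_algebra_free_lie)

lemmas presented_ideal = L.genideal_ideal[OF rels]

lemma lie_algebra_presented: "lie_algebra (lie_presented S rels)"
  unfolding lie_presented_def by (rule L.quot_lie_algebra[OF presented_ideal(1) L.lie_algebra_axioms])

lemma presented_proj_hom:
  "(\<lambda>x. alg_genideal (free_lie S) rels +>\<^bsub>free_lie S\<^esub> x) \<in> alg_hom (free_lie S) (lie_presented S rels)"
  unfolding lie_presented_def by (rule L.quot_proj_hom[OF presented_ideal(1)])

lemma presented_proj_surj:
  "carrier (lie_presented S rels) = (\<lambda>x. alg_genideal (free_lie S) rels +>\<^bsub>free_lie S\<^esub> x) ` carrier (free_lie S)"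
  unfolding lie_presented_def by (rule L.quot_carrier[OF presented_ideal(1)])

lemma pres_gen_closed: "x \<in> S \<Longrightarrow> pres_gen S rels x \<in> carrier (lie_presented S rels)"
  unfolding pres_gen_def by (intro alg_homD(1)[OF presented_proj_hom] lie_gen_closed)

lemma presented_relation:
  assumes "r \<in> rels"
  shows "alg_genideal (free_lie S) rels +>\<^bsub>free_lie S\<^esub> r = \<zero>\<^bsub>lie_presented S rels\<^esub>"
  unfolding lie_presented_def L.quot_zero[OF presented_ideal(1)]
  using assms rels presented_ideal(2) by (subst L.coset_eq_self_iff[OF presented_ideal(1)]) auto

lemma presented_universal:
  assumes B: "lie_algebra B" and \<phi>: "\<And>x. x \<in> S \<Longrightarrow> \<phi> x \<in> carrier B"
    and ker: "\<And>h r. h \<in> alg_hom (free_lie S) B \<Longrightarrow> (\<And>x. x \<in> S \<Longrightarrow> h (lie_gen S x) = \<phi> x) \<Longrightarrow>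
      r \<in> rels \<Longrightarrow> h r = \<zero>\<^bsub>B\<^esub>"
  shows "\<exists>g\<in>alg_hom (lie_presented S rels) B. \<forall>x\<in>S. g (pres_gen S rels x) = \<phi> x"
proof -
  interpret B: lie_algebra B by fact
  obtain h where h: "h \<in> alg_hom (free_lie S) B" and hx: "\<And>x. x \<in> S \<Longrightarrow> h (lie_gen S x) = \<phi> x"
    using free_lie_universal[OF B, of S \<phi>] \<phi> by blast
  note hh = alg_homD[OF h]
  have "alg_ideal {f \<in> carrier (free_lie S). h f = \<zero>\<^bsub>B\<^esub>} (free_lie S)"
    using hh alg_hom_zero[OF L.nonassoc_algebra_axioms B.nonassoc_algebra_axioms h]
    unfolding alg_ideal_def L.submodule_iff by auto
  moreover have "rels \<subseteq> {f \<in> carrier (free_lie S). h f = \<zero>\<^bsub>B\<^esub>}"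
    using ker[OF h hx] rels by auto
  ultimately have "alg_genideal (free_lie S) rels \<subseteq> {f \<in> carrier (free_lie S). h f = \<zero>\<^bsub>B\<^esub>}"
    by (rule L.genideal_least)
  then obtain g where g: "g \<in> alg_hom (lie_presented S rels) B"
    "\<And>f. f \<in> carrier (free_lie S) \<Longrightarrow> g (alg_genideal (free_lie S) rels +>\<^bsub>free_lie S\<^esub> f) = h f"
    unfolding lie_presented_def
    using quot_induced_hom[OF L.nonassoc_algebra_axioms presented_ideal(1) B.nonassoc_algebra_axioms h]
    by blast
  show ?thesis
    by (rule bexI[OF _ g(1)]) (simp add: pres_gen_def g(2) lie_gen_closed hx)
qed

lemma presented_generated:
  assumes H: "submodule H ring_of_type_algebra (lie_presented S rels)"
    and mult: "\<And>x y. x \<in> H \<Longrightarrow> y \<in> H \<Longrightarrow> x \<otimes>\<^bsub>lie_presented S rels\<^esub> y \<in> H"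
    and gen: "\<And>x. x \<in> S \<Longrightarrow> pres_gen S rels x \<in> H"
  shows "carrier (lie_presented S rels) \<subseteq> H"
proof -
  interpret P: lie_algebra "lie_presented S rels" by (rule lie_algebra_presented)
  let ?p = "\<lambda>x. alg_genideal (free_lie S) rels +>\<^bsub>free_lie S\<^esub> x"
  have "carrier (free_lie S) \<subseteq> {x \<in> carrier (free_lie S). ?p x \<in> H}"
    using mult gen
    by (intro free_lie_generated hom_vimage_submodule[OF L.nonassoc_algebra_axioms
          P.nonassoc_algebra_axioms presented_proj_hom H])
      (auto simp: alg_homD(3)[OF presented_proj_hom] pres_gen_def lie_gen_closed)
  then show ?thesis unfolding presented_proj_surj by blast
qed

end


section \<open>The Lie algebra \<open>\<bb>\<close>\<close>

lemma gens_simps [simp]: "GenA \<in> gens" "GenB \<in> gens" "GenX i \<in> gens \<longleftrightarrow> i \<ge> 1" "GenY i \<in> gens \<longleftrightarrow> i \<ge> 1"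
  by (auto simp: gens_def)

lemma gens_cases:
  assumes "g \<in> gens"
  obtains "g = GenA" | "g = GenB" | i where "g = GenX i" "i \<ge> 1" | i where "g = GenY i" "i \<ge> 1"
  using assms by (auto simp: gens_def)

lemma b_relations_subset: "b_relations \<subseteq> carrier (free_lie gens)"
proof -
  interpret L: lie_algebra "free_lie gens" by (rule lie_algebra_free_lie)
  note e = engel_closed[OF L.nonassoc_algebra_axioms]
  show ?thesis
    unfolding b_relations_def Let_def by (auto intro!: L.M.minus_closed L.M.a_closed L.mult_closed e lie_gen_closed)
qed

lemma lie_algebra_b: "lie_algebra lie_b"
  unfolding lie_b_def by (rule lie_algebra_presented[OF b_relations_subset])

definition bgen :: "gen \<Rightarrow> (gen magma \<Rightarrow> 'k::comm_ring_1) set set" where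
  "bgen = pres_gen gens b_relations"

lemma bgen_closed [simp]: "g \<in> gens \<Longrightarrow> bgen g \<in> carrier lie_b"
  unfolding lie_b_def bgen_def by (rule pres_gen_closed[OF b_relations_subset])

lemmas b_generated = presented_generated[OF b_relations_subset, folded lie_b_def bgen_def]

text \<open>
  The families that correspond to homomorphisms from \<open>\<bb>\<close> to \<open>B\<close>, as \<open>b_universal\<close> and
  \<open>b_family_bgen\<close> show.
\<close>

definition b_family :: "('k::comm_ring_1, 'a) module \<Rightarrow> (gen \<Rightarrow> 'a) \<Rightarrow> bool" where
  "b_family B \<phi> \<longleftrightarrow> (\<forall>g\<in>gens. \<phi> g \<in> carrier B) \<and> (\<forall>i\<ge>1.
     \<phi> (GenX i) = ((\<phi> GenA \<otimes>\<^bsub>B\<^esub> \<phi> GenB) \<otimes>\<^bsub>B\<^esub> \<phi> GenB) \<oplus>\<^bsub>B\<^esub> engel B (\<phi> (GenX (i + 1))) (2 ^ i) (\<phi> GenB) \<and>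
     \<phi> (GenY i) = ((\<phi> GenA \<otimes>\<^bsub>B\<^esub> \<phi> GenB) \<otimes>\<^bsub>B\<^esub> \<phi> GenA) \<oplus>\<^bsub>B\<^esub> engel B (\<phi> (GenY (i + 1))) (2 ^ i) (\<phi> GenB))"

lemma b_family_bgen: "b_family (lie_b :: ('k::comm_ring_1, _) module) bgen"
proof -
  let ?L = "free_lie gens :: ('k, _) module"
  let ?B = "lie_b :: ('k, _) module"
  interpret L: lie_algebra ?L by (rule lie_algebra_free_lie)
  interpret b: lie_algebra "lie_b :: ('k, _) module" by (rule lie_algebra_b)
  define p where "p = (\<lambda>x. alg_genideal ?L b_relations +>\<^bsub>?L\<^esub> x)"
  have p: "p \<in> alg_hom ?L ?B"
    unfolding p_def lie_b_def by (rule presented_proj_hom[OF b_relations_subset])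
  have pg: "p (lie_gen gens g) = bgen g" for g
    by (simp add: p_def bgen_def pres_gen_def)
  have rel: "p r = \<zero>\<^bsub>?B\<^esub>" if "r \<in> b_relations" for r
    using that unfolding p_def lie_b_def by (rule presented_relation[OF b_relations_subset])
  note hom = alg_homD[OF p] alg_hom_minus[OF L.nonassoc_algebra_axioms b.nonassoc_algebra_axioms p]
    alg_hom_engel[OF L.nonassoc_algebra_axioms p]
  note e = engel_closed[OF L.nonassoc_algebra_axioms] engel_closed[OF b.nonassoc_algebra_axioms]
  have eqI: "p u = p v" if "u \<ominus>\<^bsub>?L\<^esub> v \<in> b_relations" "u \<in> carrier ?L" "v \<in> carrier ?L" for u v
  proof (rule b.eq_of_minus_zero)
    show "p u \<ominus>\<^bsub>?B\<^esub> p v = \<zero>\<^bsub>?B\<^esub>"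
      unfolding hom(5)[OF that(2,3), symmetric] by (rule rel[OF that(1)])
  qed (use that(2,3) in \<open>auto intro: hom(1)\<close>)
  show ?thesis
    unfolding b_family_def
  proof (intro conjI ballI allI impI)
    fix i :: nat assume i: "i \<ge> 1"
    let ?a = "lie_gen gens GenA" and ?b = "lie_gen gens GenB"
    have c: "?a \<in> carrier ?L" "?b \<in> carrier ?L" "lie_gen gens (GenX i) \<in> carrier ?L" "lie_gen gens (GenX (i+1)) \<in> carrier ?L"
      "lie_gen gens (GenY i) \<in> carrier ?L" "lie_gen gens (GenY (i+1)) \<in> carrier ?L"
      using i by (simp_all add: lie_gen_closed)
    have "p (lie_gen gens (GenX i)) = p (((?a \<otimes>\<^bsub>?L\<^esub> ?b) \<otimes>\<^bsub>?L\<^esub> ?b) \<oplus>\<^bsub>?L\<^esub> engel ?L (lie_gen gens (GenX (i+1))) (2^i) ?b)"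
    proof (rule eqI)
      show "lie_gen gens (GenX i) \<ominus>\<^bsub>?L\<^esub> (((?a \<otimes>\<^bsub>?L\<^esub> ?b) \<otimes>\<^bsub>?L\<^esub> ?b) \<oplus>\<^bsub>?L\<^esub>
          engel ?L (lie_gen gens (GenX (i+1))) (2^i) ?b) \<in> b_relations"
        unfolding b_relations_def Let_def using i by blast
    qed (use c in \<open>simp_all add: e\<close>)
    then show "bgen (GenX i) = ((bgen GenA \<otimes>\<^bsub>?B\<^esub> bgen GenB) \<otimes>\<^bsub>?B\<^esub> bgen GenB) \<oplus>\<^bsub>?B\<^esub>
        engel ?B (bgen (GenX (i + 1))) (2 ^ i) (bgen GenB)"
      using c by (simp add: hom e pg)
    have "p (lie_gen gens (GenY i)) = p (((?a \<otimes>\<^bsub>?L\<^esub> ?b) \<otimes>\<^bsub>?L\<^esub> ?a) \<oplus>\<^bsub>?L\<^esub> engel ?L (lie_gen gens (GenY (i+1))) (2^i) ?b)"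
    proof (rule eqI)
      show "lie_gen gens (GenY i) \<ominus>\<^bsub>?L\<^esub> (((?a \<otimes>\<^bsub>?L\<^esub> ?b) \<otimes>\<^bsub>?L\<^esub> ?a) \<oplus>\<^bsub>?L\<^esub>
          engel ?L (lie_gen gens (GenY (i+1))) (2^i) ?b) \<in> b_relations"
        unfolding b_relations_def Let_def using i by blast
    qed (use c in \<open>simp_all add: e\<close>)
    then show "bgen (GenY i) = ((bgen GenA \<otimes>\<^bsub>?B\<^esub> bgen GenB) \<otimes>\<^bsub>?B\<^esub> bgen GenA) \<oplus>\<^bsub>?B\<^esub>
        engel ?B (bgen (GenY (i + 1))) (2 ^ i) (bgen GenB)"
      using c by (simp add: hom e pg)
  qed (simp add: bgen_closed)
qed

lemma b_universal:
  fixes B :: "('k::comm_ring_1, 'b) module"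
  assumes B: "lie_algebra B" and \<phi>: "b_family B \<phi>"
  shows "\<exists>g\<in>alg_hom lie_b B. \<forall>x\<in>gens. g (bgen x) = \<phi> x"
proof -
  let ?L = "free_lie gens :: ('k, _) module"
  interpret L: lie_algebra ?L by (rule lie_algebra_free_lie)
  interpret B: lie_algebra B by fact
  have "h r = \<zero>\<^bsub>B\<^esub>" if h: "h \<in> alg_hom ?L B" and hx: "\<And>x. x \<in> gens \<Longrightarrow> h (lie_gen gens x) = \<phi> x"
    and r: "r \<in> b_relations" for h r
  proof -
    note hom = alg_homD[OF h] alg_hom_minus[OF L.nonassoc_algebra_axioms B.nonassoc_algebra_axioms h]
      alg_hom_engel[OF L.nonassoc_algebra_axioms h]
    note e = engel_closed[OF L.nonassoc_algebra_axioms] engel_closed[OF B.nonassoc_algebra_axioms]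
    have \<phi>c: "\<phi> x \<in> carrier B" if "x \<in> gens" for x using \<phi> that by (auto simp: b_family_def)
    have z: "u \<ominus>\<^bsub>B\<^esub> u = \<zero>\<^bsub>B\<^esub>" if "u \<in> carrier B" for u
      using that by (simp add: a_minus_def B.M.r_neg)
    from r consider (X) i where "i \<ge> 1" "r = lie_gen gens (GenX i) \<ominus>\<^bsub>?L\<^esub>
        (((lie_gen gens GenA \<otimes>\<^bsub>?L\<^esub> lie_gen gens GenB) \<otimes>\<^bsub>?L\<^esub> lie_gen gens GenB) \<oplus>\<^bsub>?L\<^esub>
          engel ?L (lie_gen gens (GenX (i + 1))) (2 ^ i) (lie_gen gens GenB))"
      | (Y) i where "i \<ge> 1" "r = lie_gen gens (GenY i) \<ominus>\<^bsub>?L\<^esub>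
        (((lie_gen gens GenA \<otimes>\<^bsub>?L\<^esub> lie_gen gens GenB) \<otimes>\<^bsub>?L\<^esub> lie_gen gens GenA) \<oplus>\<^bsub>?L\<^esub>
          engel ?L (lie_gen gens (GenY (i + 1))) (2 ^ i) (lie_gen gens GenB))"
      unfolding b_relations_def Let_def by blast
    then show ?thesis
    proof cases
      case X
      then have "h r = \<phi> (GenX i) \<ominus>\<^bsub>B\<^esub> (((\<phi> GenA \<otimes>\<^bsub>B\<^esub> \<phi> GenB) \<otimes>\<^bsub>B\<^esub> \<phi> GenB) \<oplus>\<^bsub>B\<^esub>
          engel B (\<phi> (GenX (i + 1))) (2 ^ i) (\<phi> GenB))"
        by (simp add: hom e lie_gen_closed hx)
      moreover have "((\<phi> GenA \<otimes>\<^bsub>B\<^esub> \<phi> GenB) \<otimes>\<^bsub>B\<^esub> \<phi> GenB) \<oplus>\<^bsub>B\<^esub>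
          engel B (\<phi> (GenX (i + 1))) (2 ^ i) (\<phi> GenB) = \<phi> (GenX i)"
        using \<phi> X(1) unfolding b_family_def by metis
      ultimately show ?thesis using X(1) by (simp only: z \<phi>c gens_simps)
    next
      case Y
      then have "h r = \<phi> (GenY i) \<ominus>\<^bsub>B\<^esub> (((\<phi> GenA \<otimes>\<^bsub>B\<^esub> \<phi> GenB) \<otimes>\<^bsub>B\<^esub> \<phi> GenA) \<oplus>\<^bsub>B\<^esub>
          engel B (\<phi> (GenY (i + 1))) (2 ^ i) (\<phi> GenB))"
        by (simp add: hom e lie_gen_closed hx)
      moreover have "((\<phi> GenA \<otimes>\<^bsub>B\<^esub> \<phi> GenB) \<otimes>\<^bsub>B\<^esub> \<phi> GenA) \<oplus>\<^bsub>B\<^esub>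
          engel B (\<phi> (GenY (i + 1))) (2 ^ i) (\<phi> GenB) = \<phi> (GenY i)"
        using \<phi> Y(1) unfolding b_family_def by metis
      ultimately show ?thesis using Y(1) by (simp only: z \<phi>c gens_simps)
    qed
  qed
  then show ?thesis
    unfolding lie_b_def bgen_def
    using \<phi> by (intro presented_universal[OF b_relations_subset B]) (auto simp: b_family_def)
qed


section \<open>A graded test algebra\<close>

text \<open>
  The functions on indices stand for formal series: \<open>shift1\<close> is multiplication by \<open>t\<close> on power
  series in \<open>t\<close>, \<open>shift2\<close> is multiplication by \<open>\<sigma> + \<tau>\<close> on power series in \<open>\<sigma>, \<tau>\<close>, \<open>shiftz\<close> is
  multiplication by the degree-one generator on functions on the integers, and \<open>symprod f h\<close> is
  \<open>f(\<sigma>) h(\<tau>) + h(\<sigma>) f(\<tau>)\<close>.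
\<close>

definition shift1 :: "(nat \<Rightarrow> 'k::comm_ring_1) \<Rightarrow> nat \<Rightarrow> 'k" where
  "shift1 f n = (case n of 0 \<Rightarrow> 0 | Suc m \<Rightarrow> f m)"

definition shift2 :: "(nat \<Rightarrow> nat \<Rightarrow> 'k::comm_ring_1) \<Rightarrow> nat \<Rightarrow> nat \<Rightarrow> 'k" where
  "shift2 F n l = (case n of 0 \<Rightarrow> 0 | Suc m \<Rightarrow> F m l) + (case l of 0 \<Rightarrow> 0 | Suc m \<Rightarrow> F n m)"

definition shiftz :: "(int \<Rightarrow> 'k::comm_ring_1) \<Rightarrow> int \<Rightarrow> 'k" where
  "shiftz g m = g (m - 1)"

definition symprod :: "(nat \<Rightarrow> 'k::comm_ring_1) \<Rightarrow> (nat \<Rightarrow> 'k) \<Rightarrow> nat \<Rightarrow> nat \<Rightarrow> 'k" where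
  "symprod f h n l = f n * h l + h n * f l"

type_synonym 'k test = "'k \<times> (nat \<Rightarrow> 'k) \<times> (nat \<Rightarrow> nat \<Rightarrow> 'k) \<times> (int \<Rightarrow> 'k)"

text \<open>
  The unit vector \<open>(1, 0, 0, 0)\<close> is the image of \<open>b\<close>; bracketing with it is multiplication by \<open>t\<close>,
  \<open>\<sigma> + \<tau>\<close> and the generator in degree 1 on the three other components. The series \<open>f\<close> form a module
  whose brackets \<open>symprod\<close> land in the two-variable series; \<open>symprod f f = 2 f(\<sigma>) f(\<tau>)\<close> vanishes in
  characteristic 2, which makes the product alternating. The component \<open>g\<close> is the value of a
  derivation into the shift module.
\<close>

definition test_alg :: "('k::comm_ring_1, 'k test) module" where
  "test_alg =
    \<lparr>carrier = UNIV,
     monoid.mult = (\<lambda>(u, f, F, g) (v, h, H, k).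
       (0, (\<lambda>n. v * shift1 f n + u * shift1 h n),
        (\<lambda>n l. v * shift2 F n l + u * shift2 H n l + symprod f h n l),
        (\<lambda>m. v * shiftz g m + u * shiftz k m))),
     monoid.one = (0, (\<lambda>n. 0), (\<lambda>n l. 0), (\<lambda>m. 0)),
     ring.zero = (0, (\<lambda>n. 0), (\<lambda>n l. 0), (\<lambda>m. 0)),
     add = (\<lambda>(u, f, F, g) (v, h, H, k).
       (u + v, (\<lambda>n. f n + h n), (\<lambda>n l. F n l + H n l), (\<lambda>m. g m + k m))),
     module.smult = (\<lambda>c (u, f, F, g). (c * u, (\<lambda>n. c * f n), (\<lambda>n l. c * F n l), (\<lambda>m. c * g m)))\<rparr>"

lemma test_alg_simps [simp]:
  "carrier test_alg = UNIV"
  "(u, f, F, g) \<otimes>\<^bsub>test_alg\<^esub> (v, h, H, k) =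
     (0, (\<lambda>n. v * shift1 f n + u * shift1 h n),
      (\<lambda>n l. v * shift2 F n l + u * shift2 H n l + symprod f h n l),
      (\<lambda>m. v * shiftz g m + u * shiftz k m))"
  "\<zero>\<^bsub>test_alg\<^esub> = (0, (\<lambda>n. 0), (\<lambda>n l. 0), (\<lambda>m. 0))"
  "(u, f, F, g) \<oplus>\<^bsub>test_alg\<^esub> (v, h, H, k) =
     (u + v, (\<lambda>n. f n + h n), (\<lambda>n l. F n l + H n l), (\<lambda>m. g m + k m))"
  "c \<odot>\<^bsub>test_alg\<^esub> (u, f, F, g) = (c * u, (\<lambda>n. c * f n), (\<lambda>n l. c * F n l), (\<lambda>m. c * g m))"
  by (simp_all add: test_alg_def)

lemma shift1_linear:
  "shift1 (\<lambda>n. f n + h n) n = shift1 f n + shift1 h n"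
  "shift1 (\<lambda>n. c * f n) n = c * shift1 f n"
  "shift1 (\<lambda>n. 0) n = 0"
  by (simp_all add: shift1_def split: nat.split)

lemma shift2_linear:
  "shift2 (\<lambda>n l. F n l + H n l) n l = shift2 F n l + shift2 H n l"
  "shift2 (\<lambda>n l. c * F n l) n l = c * shift2 F n l"
  "shift2 (\<lambda>n l. 0) n l = 0"
  by (simp_all add: shift2_def algebra_simps split: nat.split)

lemma shiftz_linear:
  "shiftz (\<lambda>n. f n + h n) n = shiftz f n + shiftz h n"
  "shiftz (\<lambda>n. c * f n) n = c * shiftz f n"
  "shiftz (\<lambda>n. 0) n = 0"
  by (simp_all add: shiftz_def)

lemma symprod_linear:
  "symprod (\<lambda>n. f n + f' n) h n l = symprod f h n l + symprod f' h n l"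
  "symprod f (\<lambda>n. h n + h' n) n l = symprod f h n l + symprod f h' n l"
  "symprod (\<lambda>n. c * f n) h n l = c * symprod f h n l"
  "symprod f (\<lambda>n. c * h n) n l = c * symprod f h n l"
  "symprod (\<lambda>n. 0) h n l = 0"
  "symprod f (\<lambda>n. 0) n l = 0"
  by (simp_all add: symprod_def algebra_simps)

lemma symprod_commute: "symprod f h n l = symprod h f n l"
  by (simp add: symprod_def)

lemma shift2_symprod:
  "shift2 (symprod f h) n l = symprod (shift1 f) h n l + symprod f (shift1 h) n l"
  by (cases n; cases l) (simp_all add: shift2_def shift1_def symprod_def algebra_simps)

lemmas test_linear = shift1_linear shift2_linear shiftz_linear symprod_linear

text \<open>
  These are the solutions of the defining relations of \<open>\<bb>\<close> for \<open>a = t\<^sup>0\<close>: unfolding the relations gives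
  for \<open>x\<^sub>i\<close> the sum of all \<open>t\<close> to the power \<open>2\<^sup>j - 2\<^sup>i + 2\<close>, and for \<open>y\<^sub>i\<close> the sum of all \<open>\<sigma> + \<tau>\<close> to the
  power \<open>2\<^sup>j - 2\<^sup>i + 1\<close>, over \<open>j \<ge> i\<close>. The last component of \<open>y\<^sub>i\<close> solves the homogeneous relation: the
  shift by \<open>2\<^sup>i\<close> takes degree \<open>2 - 2\<^sup>i\<^sup>+\<^sup>1\<close> to degree \<open>2 - 2\<^sup>i\<close>.
\<close>

fun test_family :: "gen \<Rightarrow> 'k::field test" where
  "test_family GenA = (0, (\<lambda>n. if n = 0 then 1 else 0), (\<lambda>n l. 0), (\<lambda>m. 0))"
| "test_family GenB = (1, (\<lambda>n. 0), (\<lambda>n l. 0), (\<lambda>m. 0))"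
| "test_family (GenX i) = (0, (\<lambda>n. if \<exists>j\<ge>i. n + 2 ^ i = 2 ^ j + 2 then 1 else 0), (\<lambda>n l. 0), (\<lambda>m. 0))"
| "test_family (GenY i) = (0, (\<lambda>n. 0),
     (\<lambda>n l. of_nat ((n + l) choose l) * (if \<exists>j\<ge>i. n + l + 2 ^ i = 2 ^ j + 1 then 1 else 0)),
     (\<lambda>m. if m = 2 - 2 ^ i then 1 else 0))"

definition near :: "nat \<Rightarrow> nat \<Rightarrow> bool" where
  "near d n \<longleftrightarrow> (\<exists>j. 2 ^ j \<le> n + d \<and> n \<le> 2 ^ j + d)"

lemma near_mono: "near d n \<Longrightarrow> d \<le> d' \<Longrightarrow> near d' n"
  unfolding near_def by (meson add_left_mono le_trans)

lemma near_Suc: "near d n \<Longrightarrow> near (Suc d) (Suc n)"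
  unfolding near_def by auto (metis Suc_le_mono add_Suc le_SucI)

lemma near_zero: "near (Suc d) 0"
  unfolding near_def by (rule exI[of _ 0]) simp

text \<open>
  The invariant of the image of \<open>\<bb>\<close>. Away from small distance of \<open>n\<close> to powers of 2, the terms of
  \<open>F\<close> in total degree \<open>2\<^sup>J + m - 1\<close> are, for all large \<open>J\<close>, those of \<open>g m\<close> times a power of
  \<open>\<sigma> + \<tau>\<close>. The products \<open>symprod f h\<close> do not disturb this, because \<open>f\<close> and \<open>h\<close> only have terms with
  exponent near powers of 2.
\<close>

definition asymptotic :: "nat \<Rightarrow> 'k::field test \<Rightarrow> bool" where
  "asymptotic d = (\<lambda>(u, f, F, g). (\<forall>n. f n \<noteq> 0 \<longrightarrow> near d n) \<and>
     (\<forall>m. \<exists>J0. \<forall>J\<ge>J0. \<forall>n l. \<not> near d n \<longrightarrow> int (n + l + 1) = 2 ^ J + m \<longrightarrow>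
        F n l = of_nat ((n + l) choose l) * g m))"

text \<open>
  The weight of \<open>t\<^sup>n\<close> is \<open>n + 1\<close>, and that of \<open>\<sigma>\<^sup>n \<tau>\<^sup>l\<close> is \<open>n + l + 2\<close>. The component \<open>g\<close> is unfiltered,
  so it may survive on \<open>N\<close>.
\<close>

definition test_filtration :: "nat \<Rightarrow> 'k::field test set" where
  "test_filtration i = {(u, f, F, g). (i \<ge> 2 \<longrightarrow> u = 0) \<and> (\<forall>n. n + 1 < i \<longrightarrow> f n = 0) \<and>
     (\<forall>n l. n + l + 2 < i \<longrightarrow> F n l = 0)}"

context
  assumes two: "(1 + 1 :: 'k::field) = 0"
begin

lemma add_self: "x + x = (0 :: 'k)"
proof -
  have "x + x = (1 + 1) * x" by (simp add: distrib_right)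
  then show ?thesis by (simp only: two mult_zero_left)
qed

lemma add_self': "x + (x + y) = (y :: 'k)"
  by (simp add: add.assoc[symmetric] add_self)

lemma lie_algebra_test: "lie_algebra (test_alg :: ('k, _) module)"
proof -
  let ?E = "test_alg :: ('k, 'k test) module"
  have "nonassoc_algebra ?E"
  proof (rule nonassoc_algebraI)
    show "abelian_group ?E"
    proof (rule abelian_groupI)
      show "\<exists>y\<in>carrier ?E. y \<oplus>\<^bsub>?E\<^esub> x = \<zero>\<^bsub>?E\<^esub>" for x
        by (cases x) (rule bexI[of _ x], simp_all add: add_self)
    qed (auto simp: algebra_simps split_paired_all)
  qed (auto simp: algebra_simps test_linear split_paired_all)
  then interpret nonassoc_algebra ?E .
  show ?thesis
  proof unfold_locales
    show "x \<otimes>\<^bsub>?E\<^esub> x = \<zero>\<^bsub>?E\<^esub>" for x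
      by (cases x) (simp add: symprod_def add_self mult.commute)
    show "x \<otimes>\<^bsub>?E\<^esub> (y \<otimes>\<^bsub>?E\<^esub> z) \<oplus>\<^bsub>?E\<^esub> y \<otimes>\<^bsub>?E\<^esub> (z \<otimes>\<^bsub>?E\<^esub> x) \<oplus>\<^bsub>?E\<^esub> z \<otimes>\<^bsub>?E\<^esub> (x \<otimes>\<^bsub>?E\<^esub> y) = \<zero>\<^bsub>?E\<^esub>"
      for x y z
    proof -
      obtain u f F g where x: "x = (u, f, F, g)" by (cases x)
      obtain v h H k where y: "y = (v, h, H, k)" by (cases y)
      obtain w p P q where z: "z = (w, p, P, q)" by (cases z)
      show ?thesis
        unfolding x y z
        by (simp add: test_linear shift2_symprod fun_eq_iff, intro conjI allI)
          (simp_all add: symprod_commute[of h "shift1 f"] symprod_commute[of p "shift1 f"]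
            symprod_commute[of p "shift1 h"] symprod_commute[of f "shift1 h"]
            symprod_commute[of f "shift1 p"] symprod_commute[of h "shift1 p"]
            algebra_simps add_self add_self')
    qed
  qed (simp_all add: mult_add_left mult_add_right mult_smult_left mult_smult_right)
qed

text \<open>
  The coefficients of \<open>(1 + T)\<^sup>a\<close> times \<open>1 + T\<close> to the power \<open>2\<^sup>e\<close>, where the second factor has only
  two terms in characteristic 2.
\<close>

lemma choose_add_two_power:
  "(of_nat ((a + 2 ^ e) choose (k + 2 ^ e)) :: 'k) = of_nat (a choose (k + 2 ^ e)) + of_nat (a choose k)"
proof (induction e arbitrary: a k)
  case (Suc e)
  have "(of_nat ((a + 2 ^ Suc e) choose (k + 2 ^ Suc e)) :: 'k)
      = of_nat ((a + 2 ^ e) choose (k + 2 ^ e + 2 ^ e)) + of_nat ((a + 2 ^ e) choose (k + 2 ^ e))"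
    using Suc.IH[of "a + 2 ^ e" "k + 2 ^ e"] by (simp add: add.assoc mult_2)
  also have "\<dots> = of_nat (a choose (k + 2 ^ e + 2 ^ e)) + of_nat (a choose (k + 2 ^ e))
      + (of_nat (a choose (k + 2 ^ e)) + of_nat (a choose k))"
    using Suc.IH[of a "k + 2 ^ e"] Suc.IH[of a k] by simp
  also have "\<dots> = of_nat (a choose (k + 2 ^ Suc e)) + of_nat (a choose k)"
    by (simp add: add.assoc add_self' mult_2)
  finally show ?case .
qed (simp add: add.commute)

text \<open>
  A case of the theorem of Lucas: since \<open>r < 2\<^sup>e\<close>, the binary digit of \<open>2\<^sup>J - 1 - r\<close> at position \<open>e\<close>
  is 1. Peeling off blocks of length \<open>2\<^sup>e\<close> with \<open>choose_add_two_power\<close> counts them; there are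
  \<open>2\<^sup>J\<^sup>-\<^sup>e - 1\<close> of them.
\<close>

lemma choose_two_power_nonzero:
  assumes "r < 2 ^ e" "e < J"
  shows "(of_nat ((2 ^ J - 1 - r) choose (2 ^ e)) :: 'k) \<noteq> 0"
proof -
  have mult: "(of_nat ((M * 2 ^ e + s) choose (2 ^ e)) :: 'k) = of_nat M" if "s < 2 ^ e" for M s
  proof (induction M)
    case 0
    show ?case using that by (simp add: binomial_eq_0)
  next
    case (Suc M)
    have "(of_nat ((Suc M * 2 ^ e + s) choose (2 ^ e)) :: 'k) = of_nat ((M * 2 ^ e + s + 2 ^ e) choose (0 + 2 ^ e))"
      by (simp add: algebra_simps)
    also have "\<dots> = of_nat ((M * 2 ^ e + s) choose (0 + 2 ^ e)) + of_nat ((M * 2 ^ e + s) choose 0)"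
      by (rule choose_add_two_power)
    finally show ?case using Suc.IH by simp
  qed
  define M :: nat where "M = 2 ^ (J - e) - 1"
  have M: "M + 1 = 2 ^ (J - e)" by (simp add: M_def)
  have "M * 2 ^ e + 2 ^ e = (M + 1) * 2 ^ e" by simp
  also have "\<dots> = 2 ^ J" unfolding M using assms(2) by (simp add: power_add[symmetric])
  finally have "2 ^ J - 1 - r = M * 2 ^ e + (2 ^ e - 1 - r)" using assms(1) by simp
  moreover have "2 ^ e - 1 - r < (2::nat) ^ e" by (simp add: diff_less)
  ultimately have "(of_nat ((2 ^ J - 1 - r) choose (2 ^ e)) :: 'k) = of_nat M"
    using mult by simp
  moreover have "(of_nat M :: 'k) + 1 = 0"
  proof -
    have "(of_nat M :: 'k) + 1 = of_nat (M + 1)" by simp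
    also have "\<dots> = (1 + 1) ^ (J - e)" unfolding M by simp
    also have "\<dots> = 0" using assms(2) unfolding two by simp
    finally show ?thesis .
  qed
  ultimately show ?thesis by auto
qed

end

text \<open>
  Multiplication by \<open>\<sigma> + \<tau>\<close> on series in the single quantity \<open>\<sigma> + \<tau>\<close>, where Pascal's rule reduces it to
  \<open>shift1\<close>.
\<close>

lemma shift2_binomial:
  "shift2 (\<lambda>n l. of_nat ((n + l) choose l) * p (n + l)) n l
    = of_nat ((n + l) choose l) * (shift1 p (n + l) :: 'k::field)"
  by (cases n; cases l) (simp_all add: shift2_def shift1_def algebra_simps)

lemma engel_test1:
  "engel test_alg (0, f, \<lambda>n l. 0, \<lambda>m. 0 :: 'k::field) k (test_family GenB) =
    (0, \<lambda>n. if k \<le> n then f (n - k) else 0, \<lambda>n l. 0, \<lambda>m. 0)"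
proof (induction k)
  case (Suc k)
  have "shift1 (\<lambda>n. if k \<le> n then f (n - k) else 0) = (\<lambda>n. if Suc k \<le> n then f (n - Suc k) else 0)"
    by (auto simp: shift1_def fun_eq_iff split: nat.split)
  then show ?case unfolding engel.simps Suc by (simp add: test_linear)
qed simp

lemma engel_test2:
  "engel test_alg (0, \<lambda>n. 0, \<lambda>n l. of_nat ((n + l) choose l) * p (n + l), g :: int \<Rightarrow> 'k::field) k (test_family GenB) =
    (0, \<lambda>n. 0, \<lambda>n l. of_nat ((n + l) choose l) * (if k \<le> n + l then p (n + l - k) else 0), \<lambda>m. g (m - int k))"
proof (induction k)
  case (Suc k)
  have "shift1 (\<lambda>n. if k \<le> n then p (n - k) else 0) = (\<lambda>n. if Suc k \<le> n then p (n - Suc k) else 0)"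
    by (auto simp: shift1_def fun_eq_iff split: nat.split)
  then have "shift2 (\<lambda>n l. of_nat ((n + l) choose l) * (if k \<le> n + l then p (n + l - k) else 0))
      = (\<lambda>n l. of_nat ((n + l) choose l) * (if Suc k \<le> n + l then p (n + l - Suc k) else 0))"
    by (simp add: fun_eq_iff shift2_binomial[of "\<lambda>n. if k \<le> n then p (n - k) else 0"])
  moreover have "shiftz (\<lambda>m. g (m - int k)) = (\<lambda>m. g (m - int (Suc k)))"
    by (simp add: shiftz_def fun_eq_iff algebra_simps)
  ultimately show ?case unfolding engel.simps Suc by (simp add: test_linear)
qed simp

text \<open>
  The exponents \<open>2\<^sup>j - 2\<^sup>i + c\<close> with \<open>j \<ge> i\<close> are \<open>c\<close> and, disjointly, those for \<open>i + 1\<close> shifted by \<open>2\<^sup>i\<close>.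
  This is the relation between \<open>x\<^sub>i\<close> and \<open>x\<^sub>i\<^sub>+\<^sub>1\<close> (with \<open>c = 2\<close>), and between \<open>y\<^sub>i\<close> and \<open>y\<^sub>i\<^sub>+\<^sub>1\<close> (with
  \<open>c = 1\<close>), in the test algebra.
\<close>

lemma two_power_step:
  fixes c :: nat
  assumes "i \<ge> 1"
  shows "(\<exists>j\<ge>i. n + 2 ^ i = 2 ^ j + c) \<longleftrightarrow>
      n = c \<or> (2 ^ i \<le> n \<and> (\<exists>j\<ge>Suc i. n - 2 ^ i + 2 ^ Suc i = 2 ^ j + c))" (is "?l \<longleftrightarrow> ?r")
    and "n = c \<Longrightarrow> \<not> (2 ^ i \<le> n \<and> (\<exists>j\<ge>Suc i. n - 2 ^ i + 2 ^ Suc i = 2 ^ j + c))"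
proof -
  have ge: "(2::nat) ^ Suc i \<le> 2 ^ j" if "Suc i \<le> j" for j
    using that by (intro power_increasing) auto
  show "?l \<longleftrightarrow> ?r"
  proof
    assume ?l
    then obtain j where j: "j \<ge> i" "n + 2 ^ i = 2 ^ j + c" by blast
    show ?r
    proof (cases "j = i")
      case False
      then have "Suc i \<le> j" using j(1) by simp
      then show ?thesis using ge[of j] j(2) by (intro disjI2 conjI exI[of _ j]) auto
    qed (use j in simp)
  next
    assume ?r
    then show ?l
    proof
      assume "2 ^ i \<le> n \<and> (\<exists>j\<ge>Suc i. n - 2 ^ i + 2 ^ Suc i = 2 ^ j + c)"
      then obtain j where "2 ^ i \<le> n" "j \<ge> Suc i" "n - 2 ^ i + 2 ^ Suc i = 2 ^ j + c" by blast
      then show ?l by (intro exI[of _ j]) auto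
    qed auto
  qed
  show "\<not> (2 ^ i \<le> n \<and> (\<exists>j\<ge>Suc i. n - 2 ^ i + 2 ^ Suc i = 2 ^ j + c))" if "n = c"
  proof
    assume "2 ^ i \<le> n \<and> (\<exists>j\<ge>Suc i. n - 2 ^ i + 2 ^ Suc i = 2 ^ j + c)"
    then obtain j where "2 ^ i \<le> n" "j \<ge> Suc i" "n - 2 ^ i + 2 ^ Suc i = 2 ^ j + c" by blast
    then show False using ge[of j] that by auto
  qed
qed

lemma b_family_test: "b_family (test_alg :: ('k::field, _) module) test_family"
  unfolding b_family_def
proof (intro conjI allI impI ballI)
  fix i :: nat assume i: "i \<ge> 1"
  let ?E = "test_alg :: ('k, 'k test) module"
  have ab: "test_family GenA \<otimes>\<^bsub>?E\<^esub> test_family GenB = (0, (\<lambda>n. if n = 1 then 1 else 0), (\<lambda>n l. 0), (\<lambda>m. 0))"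
    by (auto simp: test_linear shift1_def fun_eq_iff split: nat.split)
  have abb: "(test_family GenA \<otimes>\<^bsub>?E\<^esub> test_family GenB) \<otimes>\<^bsub>?E\<^esub> test_family GenB = (0, (\<lambda>n. if n = 2 then 1 else 0), (\<lambda>n l. 0), (\<lambda>m. 0))"
    unfolding ab by (auto simp: test_linear shift1_def fun_eq_iff split: nat.split)
  have aba: "(test_family GenA \<otimes>\<^bsub>?E\<^esub> test_family GenB) \<otimes>\<^bsub>?E\<^esub> test_family GenA
      = (0, (\<lambda>n. 0), (\<lambda>n l. of_nat ((n + l) choose l) * (if n + l = 1 then 1 else 0)), (\<lambda>m. 0))"
  proof -
    have "n + l = 1 \<longleftrightarrow> n = 1 \<and> l = 0 \<or> n = 0 \<and> l = 1" for n l :: nat by linarith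
    then show ?thesis unfolding ab by (auto simp: test_linear symprod_def fun_eq_iff)
  qed
  show "test_family (GenX i) = ((test_family GenA \<otimes>\<^bsub>?E\<^esub> test_family GenB) \<otimes>\<^bsub>?E\<^esub> test_family GenB)
      \<oplus>\<^bsub>?E\<^esub> engel ?E (test_family (GenX (i + 1))) (2 ^ i) (test_family GenB)"
    unfolding abb test_family.simps(3) engel_test1
    using two_power_step(1)[OF i, of _ 2] two_power_step(2)[OF i, of _ 2] by (auto simp: fun_eq_iff)
  show "test_family (GenY i) = ((test_family GenA \<otimes>\<^bsub>?E\<^esub> test_family GenB) \<otimes>\<^bsub>?E\<^esub> test_family GenA)
      \<oplus>\<^bsub>?E\<^esub> engel ?E (test_family (GenY (i + 1))) (2 ^ i) (test_family GenB)"
    unfolding aba test_family.simps(4)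
      engel_test2[of "\<lambda>N. if \<exists>j\<ge>i + 1. N + 2 ^ (i + 1) = 2 ^ j + 1 then 1 else 0"]
    using two_power_step(1)[OF i, of _ 1] two_power_step(2)[OF i, of _ 1]
    by (auto simp: fun_eq_iff)
qed simp

lemma asymptotic_mono: "asymptotic d x \<Longrightarrow> d \<le> d' \<Longrightarrow> asymptotic d' x"
  unfolding asymptotic_def by (auto 0 3 dest: near_mono) (meson near_mono)

lemma asymptotic_add:
  assumes "asymptotic d x" "asymptotic d y"
  shows "asymptotic d (x \<oplus>\<^bsub>test_alg\<^esub> y)"
proof -
  obtain u f F g where x: "x = (u, f, F, g)" by (cases x)
  obtain v h H k where y: "y = (v, h, H, k)" by (cases y)
  have "\<exists>J0. \<forall>J\<ge>J0. \<forall>n l. \<not> near d n \<longrightarrow> int (n + l + 1) = 2 ^ J + m \<longrightarrow>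
      F n l + H n l = of_nat ((n + l) choose l) * (g m + k m)" for m
  proof -
    obtain J0 where J0: "\<And>J n l. J \<ge> J0 \<Longrightarrow> \<not> near d n \<Longrightarrow> int (n + l + 1) = 2 ^ J + m \<Longrightarrow>
        F n l = of_nat ((n + l) choose l) * g m"
      using assms(1) unfolding asymptotic_def x split by blast
    obtain J1 where J1: "\<And>J n l. J \<ge> J1 \<Longrightarrow> \<not> near d n \<Longrightarrow> int (n + l + 1) = 2 ^ J + m \<Longrightarrow>
        H n l = of_nat ((n + l) choose l) * k m"
      using assms(2) unfolding asymptotic_def y split by blast
    show ?thesis
    proof (intro exI[of _ "max J0 J1"] allI impI)
      fix J n l assume J: "max J0 J1 \<le> J" and n: "\<not> near d n" "int (n + l + 1) = 2 ^ J + m"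
      have "F n l = of_nat ((n + l) choose l) * g m" "H n l = of_nat ((n + l) choose l) * k m"
        using J by (auto intro: J0[OF _ n] J1[OF _ n])
      then show "F n l + H n l = of_nat ((n + l) choose l) * (g m + k m)"
        by (simp add: distrib_left)
    qed
  qed
  moreover have "near d n" if "f n + h n \<noteq> 0" for n
    using that assms unfolding asymptotic_def x y split by (cases "f n = 0") auto
  ultimately show ?thesis unfolding asymptotic_def x y by simp
qed

lemma asymptotic_scale: "asymptotic d x \<Longrightarrow> asymptotic d (c \<odot>\<^bsub>test_alg\<^esub> x)"
  unfolding asymptotic_def
  by (cases x) (simp add: mult.left_commute[of _ c], blast)

lemma asymptotic_zero: "asymptotic d \<zero>\<^bsub>test_alg\<^esub>"
  by (simp add: asymptotic_def)

text \<open>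
  Bracketing with \<open>b\<close>: Pascal's rule carries the binomial coefficients along, and the exceptional
  exponents move by one.
\<close>

lemma asymptotic_shift:
  assumes "asymptotic d (u, f, F, g)"
  shows "asymptotic (Suc d) (0, shift1 f, shift2 F, shiftz g)"
proof -
  have "near (Suc d) n" if "shift1 f n \<noteq> 0" for n
    using that assms near_Suc unfolding asymptotic_def split
    by (cases n) (auto simp: shift1_def)
  moreover have "\<exists>J0. \<forall>J\<ge>J0. \<forall>n l. \<not> near (Suc d) n \<longrightarrow> int (n + l + 1) = 2 ^ J + m \<longrightarrow>
      shift2 F n l = of_nat ((n + l) choose l) * shiftz g m" for m
  proof -
    obtain J0 where J0: "\<And>J n l. J \<ge> J0 \<Longrightarrow> \<not> near d n \<Longrightarrow> int (n + l + 1) = 2 ^ J + (m - 1) \<Longrightarrow>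
        F n l = of_nat ((n + l) choose l) * g (m - 1)"
      using assms unfolding asymptotic_def split by blast
    show ?thesis
    proof (intro exI[of _ J0] allI impI)
      fix J n l assume J: "J0 \<le> J" and n: "\<not> near (Suc d) n" and eq: "int (n + l + 1) = 2 ^ J + m"
      obtain n' where n': "n = Suc n'" using n near_zero by (cases n) auto
      have nd: "\<not> near d n'" "\<not> near d n"
        using n near_Suc n' near_mono[of d n "Suc d"] by auto
      have 1: "F n' l = of_nat ((n' + l) choose l) * g (m - 1)"
        using J nd(1) eq by (intro J0[of J]) (auto simp: n')
      show "shift2 F n l = of_nat ((n + l) choose l) * shiftz g m"
      proof (cases l)
        case 0
        then show ?thesis using 1 by (simp add: shift2_def n' shiftz_def)
      next
        case (Suc l')
        have "F n l' = of_nat ((n + l') choose l') * g (m - 1)"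
          using J nd(2) eq by (intro J0[of J]) (auto simp: Suc)
        then show ?thesis using 1 by (simp add: shift2_def n' Suc shiftz_def distrib_left distrib_right add.commute)
      qed
    qed
  qed
  ultimately show ?thesis by (simp add: asymptotic_def)
qed

lemma asymptotic_mult:
  assumes "asymptotic d x" "asymptotic d y"
  shows "asymptotic (Suc d) (x \<otimes>\<^bsub>test_alg\<^esub> y)"
proof -
  obtain u f F g where x: "x = (u, f, F, g)" by (cases x)
  obtain v h H k where y: "y = (v, h, H, k)" by (cases y)
  have "symprod f h n l = 0" if "\<not> near (Suc d) n" for n l
  proof -
    have "\<not> near d n" using that near_mono[of d n "Suc d"] by auto
    then have "f n = 0" "h n = 0" using assms unfolding asymptotic_def x y split by blast+
    then show ?thesis by (simp add: symprod_def)
  qed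
  then have "asymptotic (Suc d) (0, (\<lambda>n. 0), symprod f h, (\<lambda>m. 0))"
    by (auto simp: asymptotic_def)
  moreover have "asymptotic (Suc d) (v \<odot>\<^bsub>test_alg\<^esub> (0, shift1 f, shift2 F, shiftz g))"
    "asymptotic (Suc d) (u \<odot>\<^bsub>test_alg\<^esub> (0, shift1 h, shift2 H, shiftz k))"
    using assms unfolding x y by (intro asymptotic_scale asymptotic_shift; simp)+
  ultimately have "asymptotic (Suc d) ((v \<odot>\<^bsub>test_alg\<^esub> (0, shift1 f, shift2 F, shiftz g) \<oplus>\<^bsub>test_alg\<^esub>
      u \<odot>\<^bsub>test_alg\<^esub> (0, shift1 h, shift2 H, shiftz k)) \<oplus>\<^bsub>test_alg\<^esub> (0, (\<lambda>n. 0), symprod f h, (\<lambda>m. 0)))"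
    by (intro asymptotic_add)
  then show ?thesis by (simp add: x y)
qed

lemma asymptotic_family:
  assumes "g \<in> gens"
  shows "\<exists>d. asymptotic d (test_family g :: 'k::field test)"
  using assms
proof (cases rule: gens_cases)
  case 1
  have "near 1 0" using near_zero[of 0] by simp
  then have "asymptotic 1 (test_family GenA)" by (auto simp: asymptotic_def)
  then show ?thesis using 1 by blast
next
  case 2
  have "asymptotic 1 (test_family GenB)" by (auto simp: asymptotic_def)
  then show ?thesis using 2 by blast
next
  case (3 i)
  have "near (2 ^ i + 2) n" if "n + 2 ^ i = 2 ^ j + 2" for n j
    unfolding near_def using that by (intro exI[of _ j]) auto
  then have "asymptotic (2 ^ i + 2) (test_family (GenX i))" by (auto simp: asymptotic_def)
  then show ?thesis using 3 by blast
next
  case (4 i)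
  \<comment> \<open>A degree \<open>2\<^sup>j - 2\<^sup>i + 1\<close> at bounded distance from a large \<open>2\<^sup>J\<close> must have \<open>j = J\<close>, because distinct
    powers of 2 beyond a bound are far apart.\<close>
  have "\<exists>J0. \<forall>J\<ge>J0. \<forall>N. int (N + 1) = 2 ^ J + m \<longrightarrow> ((\<exists>j\<ge>i. N + 2 ^ i = 2 ^ j + 1) \<longleftrightarrow> m = 2 - 2 ^ i)" for m :: int
  proof (rule exI[of _ "i + nat \<bar>2 - 2 ^ i - m\<bar> + 1"], intro allI impI iffI)
    fix J N assume J: "i + nat \<bar>2 - 2 ^ i - m\<bar> + 1 \<le> J" and N: "int (N + 1) = 2 ^ J + m"
    show "m = 2 - 2 ^ i" if "\<exists>j\<ge>i. N + 2 ^ i = 2 ^ j + 1"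
    proof -
      from that obtain j where "N + 2 ^ i = 2 ^ j + 1" by blast
      then have "int (N + 2 ^ i) = int (2 ^ j + 1)" by (simp only:)
      then have eq: "(2::int) ^ J - 2 ^ j = 2 - 2 ^ i - m" using N by simp
      show ?thesis
      proof (rule ccontr)
        assume "m \<noteq> 2 - 2 ^ i"
        with eq have "J \<noteq> j" by auto
        then have "(2::int) ^ (J - 1) \<le> \<bar>2 ^ J - 2 ^ j\<bar>"
        proof (cases "j < J")
          case True
          then have "(2::int) ^ j \<le> 2 ^ (J - 1)" by (intro power_increasing) auto
          moreover have "(2::int) ^ J = 2 * 2 ^ (J - 1)" using J by (cases J) auto
          ultimately show ?thesis by linarith
        next
          case False
          then have "(2::int) ^ Suc J \<le> 2 ^ j" using \<open>J \<noteq> j\<close> by (intro power_increasing) auto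
          then have "2 * (2::int) ^ J \<le> 2 ^ j" by simp
          moreover have "(2::int) ^ (J - 1) \<le> 2 ^ J" by (intro power_increasing) auto
          moreover have "(0::int) \<le> 2 ^ J" by simp
          ultimately show ?thesis by linarith
        qed
        then have "(2::int) ^ (J - 1) \<le> \<bar>2 - 2 ^ i - m\<bar>" unfolding eq .
        moreover have "\<bar>2 - 2 ^ i - m\<bar> \<le> int (J - 1)" using J by simp
        moreover have "int (J - 1) < 2 ^ (J - 1)" by (rule of_nat_less_two_power)
        ultimately show False by linarith
      qed
    qed
    show "\<exists>j\<ge>i. N + 2 ^ i = 2 ^ j + 1" if "m = 2 - 2 ^ i"
    proof -
      from that have "int (N + 2 ^ i) = int (2 ^ J + 1)" using N by simp
      then have "N + 2 ^ i = 2 ^ J + 1" by (simp only: of_nat_eq_iff)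
      then show ?thesis using J by (intro exI[of _ J]) simp
    qed
  qed
  note sparse = this
  have "\<exists>J0. \<forall>J\<ge>J0. \<forall>n l. \<not> near 0 n \<longrightarrow> int (n + l + 1) = 2 ^ J + m \<longrightarrow>
      of_nat ((n + l) choose l) * (if \<exists>j\<ge>i. n + l + 2 ^ i = 2 ^ j + 1 then 1 else 0 :: 'k) =
      of_nat ((n + l) choose l) * (if m = 2 - 2 ^ i then 1 else 0)" for m :: int
  proof -
    obtain J0 where J0: "\<forall>J\<ge>J0. \<forall>N. int (N + 1) = 2 ^ J + m \<longrightarrow>
        ((\<exists>j\<ge>i. N + 2 ^ i = 2 ^ j + 1) \<longleftrightarrow> m = 2 - 2 ^ i)"
      using sparse[of m] by (rule exE)
    show ?thesis
    proof (rule exI[of _ J0], intro allI impI)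
      fix J n l assume "J0 \<le> J" "int (n + l + 1) = 2 ^ J + m"
      then have "(\<exists>j\<ge>i. n + l + 2 ^ i = 2 ^ j + 1) \<longleftrightarrow> m = 2 - 2 ^ i"
        using J0[THEN spec[of _ J], THEN mp, THEN spec[of _ "n + l"]] by fast
      then show "of_nat ((n + l) choose l) * (if \<exists>j\<ge>i. n + l + 2 ^ i = 2 ^ j + 1 then 1 else 0 :: 'k) =
          of_nat ((n + l) choose l) * (if m = 2 - 2 ^ i then 1 else 0)"
        by (simp only:)
    qed
  qed
  note asym = this
  have "asymptotic 0 (test_family (GenY i) :: 'k test)"
    unfolding asymptotic_def test_family.simps split by (intro conjI asym allI) simp
  then show ?thesis using 4 by blast
qed

text \<open>
  The invariant with \<open>F = 0\<close> says that all binomial coefficients in total degree \<open>2\<^sup>J + m - 1\<close>, away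
  from the exceptional \<open>n\<close>, annihilate \<open>g m\<close>. For \<open>m \<le> 0\<close> one of them is odd; for \<open>m = 1\<close> the
  inner ones are all even, which leaves room for the element \<open>z\<close>.
\<close>

lemma asymptotic_vanish:
  fixes g :: "int \<Rightarrow> 'k::field"
  assumes two: "(1 + 1 :: 'k) = 0" and asym: "asymptotic d (u, f, (\<lambda>n l. 0), g)" and "m \<le> 0"
  shows "g m = 0"
proof -
  define r where "r = nat (- m)"
  have m: "m = - int r" using \<open>m \<le> 0\<close> by (simp add: r_def)
  obtain J0 where J0: "\<And>J n l. J \<ge> J0 \<Longrightarrow> \<not> near d n \<Longrightarrow> int (n + l + 1) = 2 ^ J + m \<Longrightarrow>
      0 = of_nat ((n + l) choose l) * g m"
    using asym unfolding asymptotic_def split by blast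
  \<comment> \<open>With \<open>l = 2\<^sup>e\<close> the binomial coefficient is odd as soon as \<open>2\<^sup>e > r\<close>, and \<open>2\<^sup>e > r + d\<close> puts
    \<open>n = 2\<^sup>J - 1 - r - l\<close> further than \<open>d\<close> away from all powers of 2.\<close>
  define e where "e = r + d"
  define J where "J = max J0 (e + 3)"
  define n where "n = 2 ^ J - 1 - r - 2 ^ e"
  have e: "r + d < 2 ^ e" unfolding e_def by (rule less_exp)
  obtain c where c: "J = Suc (c + 2 + e)"
    using le_Suc_ex[of "e + 3" J] by (auto simp: J_def)
  have pJ: "(2::nat) ^ J = 2 * 2 ^ (J - 1)" by (simp add: c)
  have "(2::nat) ^ e * 1 \<le> 2 ^ e * 2 ^ c" by (intro mult_left_mono) auto
  then have big: "4 * 2 ^ e \<le> (2::nat) ^ (J - 1)" by (simp add: c power_add)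
  have n: "n + 2 ^ e + r + 1 = 2 ^ J" using e big pJ unfolding n_def by linarith
  have "\<not> near d n"
  proof
    assume "near d n"
    then obtain j where j: "2 ^ j \<le> n + d" "n \<le> 2 ^ j + d" unfolding near_def by blast
    show False
    proof (cases "j < J")
      case True
      then have "(2::nat) ^ j \<le> 2 ^ (J - 1)" by (intro power_increasing) auto
      then show False using j(2) n big e pJ by linarith
    next
      case False
      then have "(2::nat) ^ J \<le> 2 ^ j" by (intro power_increasing) auto
      then show False using j(1) n e by linarith
    qed
  qed
  moreover have "int (n + 2 ^ e + 1) = 2 ^ J + m"
  proof -
    have "int (n + 2 ^ e + r + 1) = int (2 ^ J)" using n by (simp only:)
    then show ?thesis unfolding m by simp
  qed
  ultimately have "0 = of_nat ((n + 2 ^ e) choose (2 ^ e)) * g m"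
    by (intro J0[of J]) (simp_all add: J_def)
  moreover have "n + 2 ^ e = 2 ^ J - 1 - r" using n by linarith
  moreover have "(of_nat ((2 ^ J - 1 - r) choose (2 ^ e)) :: 'k) \<noteq> 0"
    using e by (intro choose_two_power_nonzero[OF two]) (auto simp: c)
  ultimately show ?thesis by simp
qed

lemma lower_central_test:
  assumes two: "(1 + 1 :: 'k::field) = 0"
  shows "i \<ge> 1 \<Longrightarrow> lower_central (test_alg :: ('k, _) module) i \<subseteq> test_filtration i"
proof (rule lie_algebra.lower_central_least[OF lie_algebra_test[OF two]])
  interpret lie_algebra "test_alg :: ('k, _) module" by (rule lie_algebra_test[OF two])
  show "submodule (test_filtration i) ring_of_type_algebra (test_alg :: ('k, _) module)" for i
    unfolding submodule_iff by (auto simp: test_filtration_def)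
  show "x \<otimes>\<^bsub>test_alg\<^esub> y \<in> test_filtration (Suc i)" if "i \<ge> 1" "x \<in> test_filtration i" for i x y
  proof -
    obtain u f F g where x: "x = (u, f, F, g)" by (cases x)
    obtain v h H k where y: "y = (v, h, H, k)" by (cases y)
    show ?thesis
      using that unfolding x y test_filtration_def
      by (cases "i = 1") (auto simp: shift1_def shift2_def symprod_def split: nat.split)
  qed
qed (auto simp: test_filtration_def)

text \<open>
  The filtration kills the first three components; the invariant holds on all of \<open>\<bb>\<close>, since it holds
  for the generators and is stable under the operations, and then bounds the last component.
\<close>

lemma test_hom_omega:
  fixes \<eta> :: "_ \<Rightarrow> ('k::field) test"
  assumes two: "(1 + 1 :: 'k) = 0"
    and \<eta>: "\<eta> \<in> alg_hom lie_b test_alg" "\<And>g. g \<in> gens \<Longrightarrow> \<eta> (bgen g) = test_family g"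
    and u: "u \<in> lower_central_omega lie_b"
  obtains g where "\<eta> u = (0, (\<lambda>n. 0), (\<lambda>n l. 0), g)" "\<And>m. m \<le> 0 \<Longrightarrow> g m = 0"
proof -
  interpret b: lie_algebra "lie_b :: ('k, _) module" by (rule lie_algebra_b)
  interpret E: lie_algebra "test_alg :: ('k, 'k test) module" by (rule lie_algebra_test[OF two])
  have uc: "u \<in> carrier lie_b"
    using u b.lower_central_omega_subset[of 1] b.lower_central_closed(1)[of 1] by auto
  obtain v f F g where \<eta>u: "\<eta> u = (v, f, F, g)" by (cases "\<eta> u")
  have fil: "(v, f, F, g) \<in> test_filtration i" if "i \<ge> 1" for i
  proof -
    have "u \<in> lower_central lie_b i" using u that by (auto simp: lower_central_omega_def)
    from hom_lower_central[OF b.lie_algebra_axioms E.lie_algebra_axioms \<eta>(1) that this]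
    show ?thesis
      using lower_central_test[OF two that] \<eta>u by auto
  qed
  have v: "v = 0" using fil[of 2] by (simp add: test_filtration_def)
  have f: "f = (\<lambda>n. 0)"
  proof
    show "f n = 0" for n using fil[of "n + 2"] by (simp add: test_filtration_def)
  qed
  have F: "F = (\<lambda>n l. 0)"
  proof (intro ext)
    show "F n l = 0" for n l using fil[of "n + l + 3"] by (simp add: test_filtration_def)
  qed
  have "carrier lie_b \<subseteq> {x \<in> carrier lie_b. \<exists>d. asymptotic d (\<eta> x)}" (is "_ \<subseteq> ?H")
  proof (rule b_generated)
    have mono: "asymptotic (max d d') (\<eta> x)" "asymptotic (max d d') (\<eta> y)"
      if "asymptotic d (\<eta> x)" "asymptotic d' (\<eta> y)" for d d' x y
      using that asymptotic_mono by (meson max.cobounded1 max.cobounded2)+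
    note hom = alg_homD[OF \<eta>(1)]
    show "submodule ?H ring_of_type_algebra lie_b"
      unfolding b.submodule_iff
    proof (intro conjI ballI allI)
      show "\<zero>\<^bsub>lie_b\<^esub> \<in> ?H"
        using alg_hom_zero[OF b.nonassoc_algebra_axioms E.nonassoc_algebra_axioms \<eta>(1)]
          asymptotic_zero by auto
      show "x \<oplus>\<^bsub>lie_b\<^esub> y \<in> ?H" if xy: "x \<in> ?H" "y \<in> ?H" for x y
      proof -
        obtain d d' where "asymptotic d (\<eta> x)" "asymptotic d' (\<eta> y)" using xy by blast
        from asymptotic_add[OF mono[OF this]] show ?thesis using xy by (auto simp: hom)
      qed
      show "c \<odot>\<^bsub>lie_b\<^esub> x \<in> ?H" if "x \<in> ?H" for c x
        using that by (auto simp: hom intro: asymptotic_scale)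
    qed auto
    show "x \<otimes>\<^bsub>lie_b\<^esub> y \<in> ?H" if xy: "x \<in> ?H" "y \<in> ?H" for x y
    proof -
      obtain d d' where "asymptotic d (\<eta> x)" "asymptotic d' (\<eta> y)" using xy by blast
      from asymptotic_mult[OF mono[OF this]] show ?thesis using xy by (auto simp: hom)
    qed
    show "bgen g \<in> ?H" if "g \<in> gens" for g
      using asymptotic_family[OF that] \<eta>(2)[OF that] that by simp
  qed
  then obtain d where "asymptotic d (\<eta> u)" using uc by blast
  then have "g m = 0" if "m \<le> 0" for m
    using asymptotic_vanish[OF two _ that, of d v f g] unfolding \<eta>u F by simp
  then show ?thesis using that \<eta>u v f F by simp
qed


section \<open>Parafreeness\<close>

lemma quot_map_iso:
  assumes A: "nonassoc_algebra A" and B: "nonassoc_algebra B"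
    and I: "alg_ideal I A" and J: "alg_ideal J B" and h: "h \<in> alg_hom A B"
    and inj: "\<And>v. v \<in> carrier A \<Longrightarrow> h v \<in> J \<longleftrightarrow> v \<in> I"
    and surj: "\<And>u. u \<in> carrier B \<Longrightarrow> \<exists>v\<in>carrier A. u \<ominus>\<^bsub>B\<^esub> h v \<in> J"
  shows "quot_map B J h \<in> alg_iso (A AQuot I) (B AQuot J)"
proof -
  interpret A: nonassoc_algebra A by fact
  interpret B: nonassoc_algebra B by fact
  have "h ` I \<subseteq> J" using inj A.ideal_carrier[OF I] by auto
  note q = quot_map_coset[OF A I B J h this]
  note Aq = A.quot_carrier[OF I] A.quot_add[OF I] A.quot_mult[OF I] A.quot_smult[OF I]
  note Bq = B.quot_carrier[OF J] B.quot_add[OF J] B.quot_mult[OF J] B.quot_smult[OF J]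
  have "quot_map B J h \<in> alg_hom (A AQuot I) (B AQuot J)"
    by (rule alg_homI) (auto simp: Aq Bq q alg_homD[OF h])
  moreover have "bij_betw (quot_map B J h) (carrier (A AQuot I)) (carrier (B AQuot J))"
  proof (rule bij_betw_imageI)
    show "inj_on (quot_map B J h) (carrier (A AQuot I))"
    proof (rule inj_onI)
      fix x y assume "x \<in> carrier (A AQuot I)" "y \<in> carrier (A AQuot I)"
        and eq: "quot_map B J h x = quot_map B J h y"
      then obtain u v where u: "u \<in> carrier A" "x = I +>\<^bsub>A\<^esub> u" and v: "v \<in> carrier A" "y = I +>\<^bsub>A\<^esub> v"
        unfolding Aq(1) by blast
      have "J +>\<^bsub>B\<^esub> h u = J +>\<^bsub>B\<^esub> h v" using eq u v q by simp
      then have "h u \<ominus>\<^bsub>B\<^esub> h v \<in> J"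
        using B.coset_eq_iff[OF J alg_homD(1)[OF h u(1)] alg_homD(1)[OF h v(1)]] by simp
      then have "h (u \<ominus>\<^bsub>A\<^esub> v) \<in> J" using alg_hom_minus[OF A B h u(1) v(1)] by simp
      then have "u \<ominus>\<^bsub>A\<^esub> v \<in> I" using inj[of "u \<ominus>\<^bsub>A\<^esub> v"] u v by simp
      then show "x = y" using A.coset_eq_iff[OF I u(1) v(1)] u v by simp
    qed
    show "quot_map B J h ` carrier (A AQuot I) = carrier (B AQuot J)"
    proof
      show "quot_map B J h ` carrier (A AQuot I) \<subseteq> carrier (B AQuot J)"
        by (auto simp: Aq Bq q alg_homD(1)[OF h])
      show "carrier (B AQuot J) \<subseteq> quot_map B J h ` carrier (A AQuot I)"
      proof
        fix y assume "y \<in> carrier (B AQuot J)"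
        then obtain u where u: "u \<in> carrier B" "y = J +>\<^bsub>B\<^esub> u" unfolding Bq(1) by blast
        obtain v where v: "v \<in> carrier A" "u \<ominus>\<^bsub>B\<^esub> h v \<in> J" using surj[OF u(1)] by blast
        then have "y = quot_map B J h (I +>\<^bsub>A\<^esub> v)"
          using B.coset_eq_iff[OF J u(1) alg_homD(1)[OF h v(1)]] u q by simp
        then show "y \<in> quot_map B J h ` carrier (A AQuot I)" using v(1) unfolding Aq(1) by blast
      qed
    qed
  qed
  ultimately show ?thesis by (simp add: alg_iso_def)
qed

context lie_algebra
begin

lemma engel_diff:
  assumes "x \<in> carrier L" "y \<in> carrier L" "z \<in> carrier L"
  shows "engel L (x \<ominus> y) n z = engel L x n z \<ominus> engel L y n z"
proof (induction n)
  case (Suc n)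
  have "engel L x n z \<in> carrier L" "engel L y n z \<in> carrier L"
    using engel_closed[OF nonassoc_algebra_axioms] assms by auto
  then show ?case
    using assms unfolding engel.simps Suc by (simp add: a_minus_def mult_add_left mult_minus_left)
qed simp

lemma minus_add_cancel:
  assumes "c \<in> carrier L" "x \<in> carrier L" "y \<in> carrier L"
  shows "(c \<oplus> x) \<ominus> (c \<oplus> y) = x \<ominus> y"
proof -
  have "(c \<oplus> x) \<ominus> (c \<oplus> y) = (c \<oplus> \<ominus> c) \<oplus> (x \<oplus> \<ominus> y)"
    using assms by (simp add: a_minus_def M.minus_add M.a_ac)
  then show ?thesis using assms by (simp add: M.r_neg a_minus_def)
qed

text \<open>
  The \<open>d\<close>-fold unfolding of the recursion \<open>x\<^sub>j = c + [x\<^sub>j\<^sub>+\<^sub>1, z, \<dots>, z]\<close>, with \<open>2\<^sup>j\<close> brackets, cut off at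
  zero.
\<close>

primrec truncation :: "'a \<Rightarrow> 'a \<Rightarrow> nat \<Rightarrow> nat \<Rightarrow> 'a" where
  "truncation c z 0 j = \<zero>"
| "truncation c z (Suc d) j = c \<oplus> engel L (truncation c z d (j + 1)) (2 ^ j) z"

lemma truncation_closed: "c \<in> carrier L \<Longrightarrow> z \<in> carrier L \<Longrightarrow> truncation c z d j \<in> carrier L"
  by (induction d arbitrary: j) (auto intro: engel_closed[OF nonassoc_algebra_axioms])

text \<open>Each unfolding puts the error under at least one further bracket.\<close>

lemma truncation_stable:
  assumes "c \<in> carrier L" "z \<in> carrier L"
  shows "truncation c z (Suc d) j \<ominus> truncation c z d j \<in> lower_central L (Suc d)"
proof (induction d arbitrary: j)
  case 0
  then show ?case using truncation_closed[OF assms, of "Suc 0"] assms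
    by (simp add: engel_closed[OF nonassoc_algebra_axioms])
next
  case (Suc d)
  note T = truncation_closed[OF assms] and e = engel_closed[OF nonassoc_algebra_axioms]
  let ?s = "truncation c z (Suc d) (j + 1)" and ?t = "truncation c z d (j + 1)"
  have "truncation c z (Suc (Suc d)) j \<ominus> truncation c z (Suc d) j
      = (c \<oplus> engel L ?s (2 ^ j) z) \<ominus> (c \<oplus> engel L ?t (2 ^ j) z)"
    by (simp only: truncation.simps)
  also have "\<dots> = engel L (?s \<ominus> ?t) (2 ^ j) z"
    using assms T by (subst minus_add_cancel) (simp_all only: e engel_diff)
  also have "\<dots> \<in> lower_central L (Suc d + 2 ^ j)"
    by (intro engel_lower_central Suc.IH assms(2))
  also have "\<dots> \<subseteq> lower_central L (Suc (Suc d))"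
    by (intro lower_central_antimono) simp
  finally show ?case .
qed

text \<open>Once the unfolding has become stationary, it solves the recursion.\<close>

lemma nilpotent_b_family:
  assumes nil: "lower_central L i = {\<zero>}" and ab: "a \<in> carrier L" "b \<in> carrier L"
  shows "\<exists>\<phi>. b_family L \<phi> \<and> \<phi> GenA = a \<and> \<phi> GenB = b"
proof -
  let ?c = "(a \<otimes> b) \<otimes> b" and ?d = "(a \<otimes> b) \<otimes> a"
  define \<phi> where "\<phi> g = (case g of GenA \<Rightarrow> a | GenB \<Rightarrow> b | GenX j \<Rightarrow> truncation ?c b i j
    | GenY j \<Rightarrow> truncation ?d b i j)" for g
  have stable: "truncation c b i j = c \<oplus> engel L (truncation c b i (j + 1)) (2 ^ j) b"
    if c: "c \<in> carrier L" for c j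
  proof -
    have "truncation c b (Suc i) j \<ominus> truncation c b i j = \<zero>"
      using truncation_stable[OF c ab(2), of i j] lower_central_Suc_subset[of i] nil by blast
    then have "truncation c b (Suc i) j = truncation c b i j"
      by (rule eq_of_minus_zero[OF truncation_closed[OF c ab(2)] truncation_closed[OF c ab(2)]])
    then show ?thesis by simp
  qed
  have "b_family L \<phi>"
    unfolding b_family_def
  proof (intro conjI allI impI ballI)
    show "\<phi> g \<in> carrier L" for g
      using ab truncation_closed[of ?c b] truncation_closed[of ?d b] by (simp add: \<phi>_def split: gen.split)
    show "\<phi> (GenX j) = ((\<phi> GenA \<otimes> \<phi> GenB) \<otimes> \<phi> GenB) \<oplus> engel L (\<phi> (GenX (j + 1))) (2 ^ j) (\<phi> GenB)" for j
      unfolding \<phi>_def gen.case using ab by (intro stable) simp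
    show "\<phi> (GenY j) = ((\<phi> GenA \<otimes> \<phi> GenB) \<otimes> \<phi> GenA) \<oplus> engel L (\<phi> (GenY (j + 1))) (2 ^ j) (\<phi> GenB)" for j
      unfolding \<phi>_def gen.case using ab by (intro stable) simp
  qed
  then show ?thesis by (intro exI[of _ \<phi>]) (simp add: \<phi>_def)
qed

text \<open>
  The same unfolding, read in a Lie algebra where the recursion already has a solution: the solution
  is approximated by elements of any subalgebra that contains \<open>c\<close> and \<open>b\<close>.
\<close>

lemma engel_tower_approx:
  assumes G: "submodule G ring_of_type_algebra L" and mult: "\<And>x y. x \<in> G \<Longrightarrow> y \<in> G \<Longrightarrow> x \<otimes> y \<in> G"
    and c: "c \<in> G" and b: "b \<in> G" and x: "\<And>j. j \<ge> 1 \<Longrightarrow> x j \<in> carrier L"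
    and rel: "\<And>j. j \<ge> 1 \<Longrightarrow> x j = c \<oplus> engel L (x (j + 1)) (2 ^ j) b"
    and "i \<ge> 1" "j \<ge> 1"
  shows "\<exists>v\<in>G. x j \<ominus> v \<in> lower_central L i"
  using \<open>i \<ge> 1\<close> \<open>j \<ge> 1\<close>
proof (induction i arbitrary: j rule: nat_induct_at_least)
  case base
  then show ?case
    using x[of j] submodule_closed(2)[OF G] by (intro bexI[of _ "\<zero>"]) simp_all
next
  case (Suc i)
  note Gc = submodule_closed[OF G]
  have GL: "c \<in> carrier L" "b \<in> carrier L" using Gc(1) c b by auto
  note e = engel_closed[OF nonassoc_algebra_axioms]
  obtain v where v: "v \<in> G" "x (j + 1) \<ominus> v \<in> lower_central L i" using Suc.IH[of "j + 1"] by auto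
  have vL: "v \<in> carrier L" using Gc(1) v by auto
  have eG: "engel L v n b \<in> G" for n by (induction n) (auto intro: mult v(1) b)
  have xj: "x (j + 1) \<in> carrier L" by (rule x) simp
  have "x j \<ominus> (c \<oplus> engel L v (2 ^ j) b) = engel L (x (j + 1) \<ominus> v) (2 ^ j) b"
    unfolding rel[OF \<open>j \<ge> 1\<close>] using GL vL xj by (subst minus_add_cancel) (simp_all only: e engel_diff)
  also have "\<dots> \<in> lower_central L (i + 2 ^ j)"
    by (intro engel_lower_central v(2) GL)
  also have "\<dots> \<subseteq> lower_central L (Suc i)"
    by (intro lower_central_antimono) simp
  finally show ?case using Gc(3)[OF c eG] by blast
qed

end

lemma b_approx:
  fixes G :: "(gen magma \<Rightarrow> 'k::comm_ring_1) set set set"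
  assumes G: "submodule G ring_of_type_algebra lie_b"
    and mult: "\<And>x y. x \<in> G \<Longrightarrow> y \<in> G \<Longrightarrow> x \<otimes>\<^bsub>lie_b\<^esub> y \<in> G"
    and ab: "bgen GenA \<in> G" "bgen GenB \<in> G" and i: "i \<ge> 1"
    and u: "u \<in> carrier lie_b"
  shows "\<exists>v\<in>G. u \<ominus>\<^bsub>lie_b\<^esub> v \<in> lower_central lie_b i"
proof -
  interpret b: lie_algebra "lie_b :: ('k, _) module" by (rule lie_algebra_b)
  note Gc = b.submodule_closed[OF G]
  note lc = b.lower_central_closed and id = b.ideal_mult[OF b.lower_central_ideal]
  let ?H = "{u \<in> carrier lie_b. \<exists>v\<in>G. u \<ominus>\<^bsub>lie_b\<^esub> v \<in> lower_central lie_b i}"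
  have "carrier lie_b \<subseteq> ?H"
  proof (rule b_generated)
    show "submodule ?H ring_of_type_algebra lie_b"
      unfolding b.submodule_iff
    proof (intro conjI ballI allI)
      show "\<zero>\<^bsub>lie_b\<^esub> \<in> ?H" using Gc(2) lc(2)[of i] b.minus_self[OF b.M.zero_closed] by (auto intro!: bexI[of _ "\<zero>\<^bsub>lie_b\<^esub>"])
      show "x \<oplus>\<^bsub>lie_b\<^esub> y \<in> ?H" if xy: "x \<in> ?H" "y \<in> ?H" for x y
      proof -
        obtain v w where v: "v \<in> G" "x \<ominus>\<^bsub>lie_b\<^esub> v \<in> lower_central lie_b i"
          and w: "w \<in> G" "y \<ominus>\<^bsub>lie_b\<^esub> w \<in> lower_central lie_b i" using xy by blast
        have c: "x \<in> carrier lie_b" "y \<in> carrier lie_b" "v \<in> carrier lie_b" "w \<in> carrier lie_b"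
          using xy v w Gc(1) by auto
        have "(x \<oplus>\<^bsub>lie_b\<^esub> y) \<ominus>\<^bsub>lie_b\<^esub> (v \<oplus>\<^bsub>lie_b\<^esub> w) = (x \<ominus>\<^bsub>lie_b\<^esub> v) \<oplus>\<^bsub>lie_b\<^esub> (y \<ominus>\<^bsub>lie_b\<^esub> w)"
          using c by (simp add: a_minus_def b.M.minus_add b.M.a_ac)
        then show ?thesis
          using lc(3)[OF v(2) w(2)] Gc(3)[OF v(1) w(1)] c
          by (auto intro!: bexI[of _ "v \<oplus>\<^bsub>lie_b\<^esub> w"])
      qed
      show "c \<odot>\<^bsub>lie_b\<^esub> x \<in> ?H" if x: "x \<in> ?H" for c x
      proof -
        obtain v where v: "v \<in> G" "x \<ominus>\<^bsub>lie_b\<^esub> v \<in> lower_central lie_b i" using x by blast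
        have cr: "x \<in> carrier lie_b" "v \<in> carrier lie_b" using x v Gc(1) by auto
        have "c \<odot>\<^bsub>lie_b\<^esub> x \<ominus>\<^bsub>lie_b\<^esub> c \<odot>\<^bsub>lie_b\<^esub> v = c \<odot>\<^bsub>lie_b\<^esub> (x \<ominus>\<^bsub>lie_b\<^esub> v)"
          using cr by (simp add: a_minus_def b.scale_add_right b.minus_eq_scale b.scale_assoc[symmetric])
        then show ?thesis
          using lc(4)[OF v(2)] Gc(4)[OF v(1)] cr by (auto intro!: bexI[of _ "c \<odot>\<^bsub>lie_b\<^esub> v"])
      qed
    qed auto
    show "x \<otimes>\<^bsub>lie_b\<^esub> y \<in> ?H" if xy: "x \<in> ?H" "y \<in> ?H" for x y
    proof -
      obtain v w where v: "v \<in> G" "x \<ominus>\<^bsub>lie_b\<^esub> v \<in> lower_central lie_b i"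
        and w: "w \<in> G" "y \<ominus>\<^bsub>lie_b\<^esub> w \<in> lower_central lie_b i" using xy by blast
      have c: "x \<in> carrier lie_b" "y \<in> carrier lie_b" "v \<in> carrier lie_b" "w \<in> carrier lie_b"
        using xy v w Gc(1) by auto
      have "x \<otimes>\<^bsub>lie_b\<^esub> y \<ominus>\<^bsub>lie_b\<^esub> v \<otimes>\<^bsub>lie_b\<^esub> w
          = (x \<ominus>\<^bsub>lie_b\<^esub> v) \<otimes>\<^bsub>lie_b\<^esub> y \<oplus>\<^bsub>lie_b\<^esub> v \<otimes>\<^bsub>lie_b\<^esub> (y \<ominus>\<^bsub>lie_b\<^esub> w)"
        using c by (rule b.mult_diff)
      moreover have "\<dots> \<in> lower_central lie_b i"
        using c v w by (intro lc(3) id)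
      ultimately show ?thesis
        using mult[OF v(1) w(1)] c by (auto intro!: bexI[of _ "v \<otimes>\<^bsub>lie_b\<^esub> w"])
    qed
    show "bgen g \<in> ?H" if "g \<in> gens" for g
      using that
    proof (cases rule: gens_cases)
      case 1
      then show ?thesis using ab(1) lc(2)[of i] Gc(1) by (auto intro!: bexI[of _ "bgen GenA"] simp: b.minus_self)
    next
      case 2
      then show ?thesis using ab(2) lc(2)[of i] Gc(1) by (auto intro!: bexI[of _ "bgen GenB"] simp: b.minus_self)
    next
      case (3 j)
      have rel: "bgen (GenX j) = ((bgen GenA \<otimes>\<^bsub>lie_b\<^esub> bgen GenB) \<otimes>\<^bsub>lie_b\<^esub> bgen GenB) \<oplus>\<^bsub>lie_b\<^esub>
          engel (lie_b :: ('k, _) module) (bgen (GenX (j + 1))) (2 ^ j) (bgen GenB)" if "j \<ge> 1" for j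
        using b_family_bgen[where 'k='k] that unfolding b_family_def by blast
      have "\<exists>v\<in>G. bgen (GenX j) \<ominus>\<^bsub>lie_b\<^esub> v \<in> lower_central lie_b i"
        by (rule b.engel_tower_approx[OF G mult mult[OF mult[OF ab] ab(2)] ab(2) _ rel i \<open>j \<ge> 1\<close>])
          simp_all
      then show ?thesis using 3 by simp
    next
      case (4 j)
      have rel: "bgen (GenY j) = ((bgen GenA \<otimes>\<^bsub>lie_b\<^esub> bgen GenB) \<otimes>\<^bsub>lie_b\<^esub> bgen GenA) \<oplus>\<^bsub>lie_b\<^esub>
          engel (lie_b :: ('k, _) module) (bgen (GenY (j + 1))) (2 ^ j) (bgen GenB)" if "j \<ge> 1" for j
        using b_family_bgen[where 'k='k] that unfolding b_family_def by blast
      have "\<exists>v\<in>G. bgen (GenY j) \<ominus>\<^bsub>lie_b\<^esub> v \<in> lower_central lie_b i"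
        by (rule b.engel_tower_approx[OF G mult mult[OF mult[OF ab] ab(1)] ab(2) _ rel i \<open>j \<ge> 1\<close>])
          simp_all
      then show ?thesis using 4 by simp
    qed
  qed
  then show ?thesis using u by blast
qed

abbreviation omega_b :: "(gen magma \<Rightarrow> 'k::comm_ring_1) set set set" where
  "omega_b \<equiv> lower_central_omega lie_b"

definition b_to_a :: "(gen magma \<Rightarrow> 'k::comm_ring_1) set set \<Rightarrow> (gen magma \<Rightarrow> 'k) set set set" where
  "b_to_a x = omega_b +>\<^bsub>lie_b\<^esub> x"

lemma omega_b_ideal: "alg_ideal omega_b lie_b"
  by (rule lie_algebra.lower_central_omega_ideal[OF lie_algebra_b])

lemma lie_algebra_a: "lie_algebra (lie_a :: ('k::comm_ring_1, _) module)"
proof -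
  interpret b: lie_algebra "lie_b :: ('k, _) module" by (rule lie_algebra_b)
  show ?thesis
    unfolding lie_a_def by (rule b.quot_lie_algebra[OF omega_b_ideal b.lie_algebra_axioms])
qed

lemma b_to_a_hom: "b_to_a \<in> alg_hom lie_b (lie_a :: ('k::comm_ring_1, _) module)"
proof -
  interpret b: lie_algebra "lie_b :: ('k, _) module" by (rule lie_algebra_b)
  show ?thesis
    unfolding lie_a_def b_to_a_def by (rule b.quot_proj_hom[OF omega_b_ideal])
qed

lemma carrier_a: "carrier (lie_a :: ('k::comm_ring_1, _) module) = b_to_a ` carrier lie_b"
proof -
  interpret b: lie_algebra "lie_b :: ('k, _) module" by (rule lie_algebra_b)
  show ?thesis
    unfolding lie_a_def b_to_a_def by (rule b.quot_carrier[OF omega_b_ideal])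
qed

lemma b_to_a_eq_iff:
  fixes x y :: "(gen magma \<Rightarrow> 'k::comm_ring_1) set set"
  assumes "x \<in> carrier lie_b" "y \<in> carrier lie_b"
  shows "b_to_a x = b_to_a y \<longleftrightarrow> x \<ominus>\<^bsub>lie_b\<^esub> y \<in> omega_b"
proof -
  interpret b: lie_algebra "lie_b :: ('k, _) module" by (rule lie_algebra_b)
  show ?thesis
    unfolding b_to_a_def by (rule b.coset_eq_iff[OF omega_b_ideal assms])
qed

lemma b_to_a_zero_iff:
  fixes x :: "(gen magma \<Rightarrow> 'k::comm_ring_1) set set"
  assumes "x \<in> carrier lie_b"
  shows "b_to_a x = \<zero>\<^bsub>lie_a\<^esub> \<longleftrightarrow> x \<in> omega_b"
proof -
  interpret b: lie_algebra "lie_b :: ('k, _) module" by (rule lie_algebra_b)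
  show ?thesis
    unfolding b_to_a_def lie_a_def b.quot_zero[OF omega_b_ideal]
    by (rule b.coset_eq_self_iff[OF omega_b_ideal assms])
qed

lemma lower_central_a:
  "i \<ge> 1 \<Longrightarrow> lower_central (lie_a :: ('k::comm_ring_1, _) module) i = b_to_a ` lower_central lie_b i"
  by (rule surj_hom_lower_central[OF lie_algebra_b lie_algebra_a b_to_a_hom]) (simp_all add: carrier_a)

text \<open>Since \<open>\<gamma>\<^sub>\<omega>(\<bb>) \<subseteq> \<gamma>\<^sub>i(\<bb>)\<close>, the preimage of \<open>\<gamma>\<^sub>i(\<aa>)\<close> in \<open>\<bb>\<close> is \<open>\<gamma>\<^sub>i(\<bb>)\<close> itself.\<close>

lemma lower_central_omega_a: "lower_central_omega (lie_a :: ('k::comm_ring_1, _) module) = {\<zero>\<^bsub>lie_a\<^esub>}"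
proof -
  interpret b: lie_algebra "lie_b :: ('k, _) module" by (rule lie_algebra_b)
  interpret a: lie_algebra "lie_a :: ('k, _) module" by (rule lie_algebra_a)
  have "u = \<zero>\<^bsub>lie_a\<^esub>" if u: "u \<in> lower_central_omega lie_a" for u :: "(gen magma \<Rightarrow> 'k) set set set"
  proof -
    have "u \<in> carrier lie_a"
      using u a.lower_central_omega_subset[of 1] by auto
    then obtain x where x: "x \<in> carrier lie_b" "u = b_to_a x" unfolding carrier_a by blast
    have "x \<in> lower_central lie_b i" if i: "i \<ge> 1" for i
    proof -
      have "b_to_a x \<in> b_to_a ` lower_central lie_b i"
        using u i x(2) lower_central_a[OF i] by (auto simp: lower_central_omega_def)
      then obtain y where y: "y \<in> lower_central lie_b i" "b_to_a x = b_to_a y" by blast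
      have yc: "y \<in> carrier lie_b" using y(1) b.lower_central_closed(1) by blast
      then have "x \<ominus>\<^bsub>lie_b\<^esub> y \<in> lower_central lie_b i"
        using y(2) b_to_a_eq_iff[OF x(1) yc] b.lower_central_omega_subset[OF i] by blast
      then have "(x \<ominus>\<^bsub>lie_b\<^esub> y) \<oplus>\<^bsub>lie_b\<^esub> y \<in> lower_central lie_b i"
        using y(1) by (intro b.lower_central_closed(3))
      then show ?thesis using x(1) yc by (simp add: a_minus_def b.M.a_assoc b.M.l_neg)
    qed
    then have "x \<in> omega_b" by (auto simp: lower_central_omega_def)
    then show ?thesis using b_to_a_zero_iff x by blast
  qed
  moreover have "\<zero>\<^bsub>lie_a\<^esub> \<in> lower_central_omega (lie_a :: ('k, _) module)"
    using a.ideal_closed(2)[OF a.lower_central_omega_ideal] .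
  ultimately show ?thesis by blast
qed

text \<open>
  The free Lie algebra \<open>F\<close> is taken on the images of \<open>a, b\<close>. Its image in \<open>\<aa>\<close> is everything modulo
  \<open>\<gamma>\<^sub>i\<close> by \<open>b_approx\<close>. Conversely the nilpotent quotient \<open>F/\<gamma>\<^sub>i(F)\<close> receives a homomorphism from \<open>\<aa>\<close>
  that returns the free generators, so nothing outside \<open>\<gamma>\<^sub>i(F)\<close> is lost in \<open>\<aa>/\<gamma>\<^sub>i(\<aa>)\<close>.
\<close>

theorem parafree_a: "parafree (lie_a :: ('k::comm_ring_1, _) module)"
proof -
  interpret b: lie_algebra "lie_b :: ('k, _) module" by (rule lie_algebra_b)
  interpret a: lie_algebra "lie_a :: ('k, _) module" by (rule lie_algebra_a)
  define s t :: "(gen magma \<Rightarrow> 'k) set set set" where "s = b_to_a (bgen GenA)" and "t = b_to_a (bgen GenB)"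
  define S where "S = {s, t}"
  let ?F = "free_lie S :: ('k, _) module"
  interpret F: lie_algebra ?F by (rule lie_algebra_free_lie)
  have st: "s \<in> carrier lie_a" "t \<in> carrier lie_a"
    by (auto simp: s_def t_def carrier_a)
  obtain h where h: "h \<in> alg_hom ?F lie_a" and hx: "\<forall>x\<in>S. h (lie_gen S x) = x"
    using free_lie_universal[OF lie_algebra_a, of S "\<lambda>x. x"] st unfolding S_def by blast
  have surj: "\<exists>v\<in>carrier ?F. u \<ominus>\<^bsub>lie_a\<^esub> h v \<in> lower_central lie_a i"
    if i: "i \<ge> 1" and u: "u \<in> carrier lie_a" for u i
  proof -
    obtain x where x: "x \<in> carrier lie_b" "u = b_to_a x" using u unfolding carrier_a by blast
    let ?G = "{y \<in> carrier lie_b. b_to_a y \<in> h ` carrier ?F}"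
    have "\<exists>y\<in>?G. x \<ominus>\<^bsub>lie_b\<^esub> y \<in> lower_central lie_b i"
    proof (rule b_approx[OF _ _ _ _ i x(1)])
      show "submodule ?G ring_of_type_algebra lie_b"
        by (intro hom_vimage_submodule[OF b.nonassoc_algebra_axioms a.nonassoc_algebra_axioms b_to_a_hom]
            hom_image_submodule[OF F.nonassoc_algebra_axioms a.nonassoc_algebra_axioms h] F.carrier_is_submodule)
      show "y \<otimes>\<^bsub>lie_b\<^esub> z \<in> ?G" if yz: "y \<in> ?G" "z \<in> ?G" for y z
      proof -
        obtain v w where "v \<in> carrier ?F" "w \<in> carrier ?F" "b_to_a y = h v" "b_to_a z = h w"
          "y \<in> carrier lie_b" "z \<in> carrier lie_b" using yz by blast
        then have "b_to_a (y \<otimes>\<^bsub>lie_b\<^esub> z) = h (v \<otimes>\<^bsub>?F\<^esub> w)"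
          by (simp add: alg_homD[OF h] alg_homD[OF b_to_a_hom])
        then show ?thesis using \<open>v \<in> _\<close> \<open>w \<in> _\<close> \<open>y \<in> carrier _\<close> \<open>z \<in> carrier _\<close> by auto
      qed
      have "s \<in> h ` carrier ?F" "t \<in> h ` carrier ?F"
        using hx lie_gen_closed[of s S] lie_gen_closed[of t S] unfolding S_def by (metis imageI insertI1 insertI2)+
      then show "bgen GenA \<in> ?G" "bgen GenB \<in> ?G" by (simp_all add: s_def t_def)
    qed
    then obtain y v where y: "y \<in> carrier lie_b" "x \<ominus>\<^bsub>lie_b\<^esub> y \<in> lower_central lie_b i"
      and v: "v \<in> carrier ?F" "b_to_a y = h v" by blast
    have "u \<ominus>\<^bsub>lie_a\<^esub> h v = b_to_a (x \<ominus>\<^bsub>lie_b\<^esub> y)"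
      using alg_hom_minus[OF b.nonassoc_algebra_axioms a.nonassoc_algebra_axioms b_to_a_hom x(1) y(1)]
      by (simp add: x(2) v(2))
    also have "\<dots> \<in> lower_central lie_a i" using y(2) lower_central_a[OF i] by blast
    finally show ?thesis using v(1) by blast
  qed
  have inj: "v \<in> lower_central ?F i"
    if i: "i \<ge> 1" and v: "v \<in> carrier ?F" "h v \<in> lower_central lie_a i" for v i
  proof -
    note id = F.lower_central_ideal[of i]
    let ?Q = "?F AQuot lower_central ?F i"
    define q where "q x = lower_central ?F i +>\<^bsub>?F\<^esub> x" for x
    interpret Q: lie_algebra ?Q by (rule F.quot_lie_algebra[OF id F.lie_algebra_axioms])
    have q: "q \<in> alg_hom ?F ?Q" unfolding q_def by (rule F.quot_proj_hom[OF id])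
    have q0: "q x = \<zero>\<^bsub>?Q\<^esub> \<longleftrightarrow> x \<in> lower_central ?F i" if "x \<in> carrier ?F" for x
      unfolding q_def F.quot_zero[OF id] by (rule F.coset_eq_self_iff[OF id that])
    have "lower_central ?Q i = q ` lower_central ?F i"
      unfolding q_def by (rule surj_hom_lower_central[OF F.lie_algebra_axioms Q.lie_algebra_axioms
            F.quot_proj_hom[OF id] _ i]) (simp add: F.quot_carrier[OF id])
    also have "\<dots> = {\<zero>\<^bsub>?Q\<^esub>}"
      using q0 F.lower_central_closed(1,2)[of i] by (auto simp: image_iff subset_iff)
    finally have nil: "lower_central ?Q i = {\<zero>\<^bsub>?Q\<^esub>}" .
    have gc: "lie_gen S s \<in> carrier ?F" "lie_gen S t \<in> carrier ?F"
      by (simp_all add: S_def lie_gen_closed)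
    obtain \<phi> where \<phi>: "b_family ?Q \<phi>" "\<phi> GenA = q (lie_gen S s)" "\<phi> GenB = q (lie_gen S t)"
      using Q.nilpotent_b_family[OF nil alg_homD(1)[OF q gc(1)] alg_homD(1)[OF q gc(2)]] by blast
    obtain g where g: "g \<in> alg_hom lie_b ?Q" "\<forall>x\<in>gens. g (bgen x) = \<phi> x"
      using b_universal[OF Q.lie_algebra_axioms \<phi>(1)] by blast
    have "g x = \<zero>\<^bsub>?Q\<^esub>" if "x \<in> omega_b" for x
      using hom_lower_central[OF b.lie_algebra_axioms Q.lie_algebra_axioms g(1) i, of x] nil
        b.lower_central_omega_subset[OF i] that by blast
    then obtain g' where g': "g' \<in> alg_hom lie_a ?Q" "\<And>x. x \<in> carrier lie_b \<Longrightarrow> g' (b_to_a x) = g x"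
      unfolding lie_a_def b_to_a_def
      using quot_induced_hom[OF b.nonassoc_algebra_axioms omega_b_ideal Q.nonassoc_algebra_axioms g(1)]
      by blast
    have "carrier ?F \<subseteq> {x \<in> carrier ?F. g' (h x) = q x}" (is "_ \<subseteq> ?H")
    proof (rule free_lie_generated)
      note hom = alg_homD[OF h] alg_homD[OF g'(1)] alg_homD[OF q]
      show "submodule ?H ring_of_type_algebra ?F"
        unfolding F.submodule_iff
        using alg_hom_zero[OF F.nonassoc_algebra_axioms a.nonassoc_algebra_axioms h]
          alg_hom_zero[OF a.nonassoc_algebra_axioms Q.nonassoc_algebra_axioms g'(1)]
          alg_hom_zero[OF F.nonassoc_algebra_axioms Q.nonassoc_algebra_axioms q]
        by (auto simp: hom)
      show "x \<otimes>\<^bsub>?F\<^esub> y \<in> ?H" if "x \<in> ?H" "y \<in> ?H" for x y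
        using that by (auto simp: hom)
      have "g' s = q (lie_gen S s)" "g' t = q (lie_gen S t)"
        unfolding s_def[symmetric] t_def[symmetric]
        using g'(2)[of "bgen GenA"] g'(2)[of "bgen GenB"] g(2) \<phi>(2,3) by (auto simp: s_def t_def)
      then show "lie_gen S x \<in> ?H" if "x \<in> S" for x
        using that hx gc unfolding S_def by auto
    qed
    then have "q v = g' (h v)" using v(1) by force
    also have "\<dots> \<in> lower_central ?Q i"
      by (rule hom_lower_central[OF a.lie_algebra_axioms Q.lie_algebra_axioms g'(1) i v(2)])
    finally have "q v = \<zero>\<^bsub>?Q\<^esub>" using nil by blast
    then show ?thesis using q0[OF v(1)] by blast
  qed
  have "quot_map lie_a (lower_central lie_a i) h \<in>
      alg_iso (?F AQuot lower_central ?F i) (lie_a AQuot lower_central lie_a i)" if i: "i \<ge> 1" for i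
  proof (rule quot_map_iso[OF F.nonassoc_algebra_axioms a.nonassoc_algebra_axioms
        F.lower_central_ideal a.lower_central_ideal h])
    show "h v \<in> lower_central lie_a i \<longleftrightarrow> v \<in> lower_central ?F i" if "v \<in> carrier ?F" for v
      using inj[OF i that] hom_lower_central[OF F.lie_algebra_axioms a.lie_algebra_axioms h i] by blast
  qed (rule surj[OF i])
  then show ?thesis
    unfolding parafree_def using lie_algebra_a lower_central_omega_a h by blast
qed


section \<open>A criterion for the second Tor group to be nonzero\<close>

text \<open>
  The additive extension of \<open>\<phi>\<close> to the free abelian group. If it kills the tensor relations, it is a
  functional on the tensor product.
\<close>

definition frag_eval :: "('a \<Rightarrow> 'k::comm_ring_1) \<Rightarrow> ('a \<Rightarrow>\<^sub>0 int) \<Rightarrow> 'k" where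
  "frag_eval \<phi> z = (\<Sum>p\<in>Poly_Mapping.keys z. of_int (poly_mapping.lookup z p) * \<phi> p)"

lemma frag_eval_of [simp]: "frag_eval \<phi> (frag_of p) = \<phi> p"
  by (simp add: frag_eval_def)

lemma frag_eval_zero [simp]: "frag_eval \<phi> 0 = 0"
  by (simp add: frag_eval_def)

lemma frag_eval_superset:
  assumes "finite F" "Poly_Mapping.keys z \<subseteq> F"
  shows "frag_eval \<phi> z = (\<Sum>p\<in>F. of_int (poly_mapping.lookup z p) * \<phi> p)"
  unfolding frag_eval_def
  by (rule sum.mono_neutral_left) (use assms in \<open>auto simp: in_keys_iff\<close>)

lemma frag_eval_diff: "frag_eval \<phi> (x - y) = frag_eval \<phi> x - frag_eval \<phi> y"
proof -
  let ?F = "Poly_Mapping.keys x \<union> Poly_Mapping.keys y"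
  have "frag_eval \<phi> (x - y) = (\<Sum>p\<in>?F. of_int (poly_mapping.lookup (x - y) p) * \<phi> p)"
    by (rule frag_eval_superset) (use keys_diff[of x y] in auto)
  also have "\<dots> = (\<Sum>p\<in>?F. of_int (poly_mapping.lookup x p) * \<phi> p) - (\<Sum>p\<in>?F. of_int (poly_mapping.lookup y p) * \<phi> p)"
    by (simp add: lookup_minus algebra_simps sum_subtractf)
  also have "\<dots> = frag_eval \<phi> x - frag_eval \<phi> y"
    by (subst (1 2) frag_eval_superset[of ?F]) auto
  finally show ?thesis .
qed

lemma frag_eval_uminus: "frag_eval \<phi> (- x) = - frag_eval \<phi> x"
  using frag_eval_diff[of \<phi> 0 x] by simp

lemma frag_eval_add: "frag_eval \<phi> (x + y) = frag_eval \<phi> x + frag_eval \<phi> y"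
  using frag_eval_diff[of \<phi> x "- y"] by (simp add: frag_eval_uminus)

lemma frag_eval_extend_zero:
  assumes "Poly_Mapping.keys z \<subseteq> S" "\<And>p. p \<in> S \<Longrightarrow> frag_eval \<phi> (b p) = 0"
  shows "frag_eval \<phi> (frag_extend b z) = 0"
  using assms(1)
  by (induction z rule: frag_induction) (use assms(2) in \<open>auto simp: frag_extend_diff frag_eval_diff\<close>)

context
  fixes R :: "('r, 'x) ring_scheme" and M :: "('r, 'm) module" and N :: "('r, 'n) module"
  assumes relations: "tensor_relations R M N \<subseteq> carrier (free_Abelian_group (carrier M \<times> carrier N))"
begin

lemma tensor_null_induct:
  assumes "z \<in> tensor_null R M N"
    and "P 0" "\<And>r. r \<in> tensor_relations R M N \<Longrightarrow> P r" "\<And>x. P x \<Longrightarrow> P (- x)"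
    "\<And>x y. P x \<Longrightarrow> P y \<Longrightarrow> P (x + y)"
  shows "P z"
  using assms(1) unfolding tensor_null_def
proof (induction rule: generate.induct)
  case (inv h)
  then have "h \<in> carrier (free_Abelian_group (carrier M \<times> carrier N))" using relations by blast
  then have "Poly_Mapping.keys h \<subseteq> carrier M \<times> carrier N" by simp
  then show ?case using assms(3,4) inv by simp
qed (use assms in auto)

lemma tensor_null_closed:
  "0 \<in> tensor_null R M N" "r \<in> tensor_relations R M N \<Longrightarrow> r \<in> tensor_null R M N"
  "x \<in> tensor_null R M N \<Longrightarrow> y \<in> tensor_null R M N \<Longrightarrow> x + y \<in> tensor_null R M N"
  "x \<in> tensor_null R M N \<Longrightarrow> - x \<in> tensor_null R M N"
proof -
  let ?G = "free_Abelian_group (carrier M \<times> carrier N)"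
  show "0 \<in> tensor_null R M N"
    unfolding tensor_null_def using generate.one[of ?G] by simp
  show "r \<in> tensor_relations R M N \<Longrightarrow> r \<in> tensor_null R M N"
    unfolding tensor_null_def by (rule generate.incl)
  show "x \<in> tensor_null R M N \<Longrightarrow> y \<in> tensor_null R M N \<Longrightarrow> x + y \<in> tensor_null R M N"
    unfolding tensor_null_def using generate.eng[of x ?G _ y] by simp
  show "- x \<in> tensor_null R M N" if "x \<in> tensor_null R M N"
  proof -
    have sub: "subgroup (tensor_null R M N) ?G"
      unfolding tensor_null_def by (rule group.generate_is_subgroup[OF group_free_Abelian_group relations])
    have "x \<in> carrier ?G" using subgroup.subset[OF sub] that by blast
    then have "Poly_Mapping.keys x \<subseteq> carrier M \<times> carrier N" by simp
    then show ?thesis using subgroup.m_inv_closed[OF sub that] by simp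
  qed
qed

lemma tensor_null_keys: "x \<in> tensor_null R M N \<Longrightarrow> Poly_Mapping.keys x \<subseteq> carrier M \<times> carrier N"
proof -
  have "subgroup (tensor_null R M N) (free_Abelian_group (carrier M \<times> carrier N))"
    unfolding tensor_null_def by (rule group.generate_is_subgroup[OF group_free_Abelian_group relations])
  then show "x \<in> tensor_null R M N \<Longrightarrow> Poly_Mapping.keys x \<subseteq> carrier M \<times> carrier N"
    using subgroup.subset by fastforce
qed

lemma tensor_null_eval:
  assumes "z \<in> tensor_null R M N" "\<And>r. r \<in> tensor_relations R M N \<Longrightarrow> frag_eval \<phi> r = 0"
  shows "frag_eval \<phi> z = 0"
  by (rule tensor_null_induct[OF assms(1)]) (auto simp: assms(2) frag_eval_add frag_eval_uminus)

lemma mem_null_coset: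
  "y \<in> tensor_null R M N #>\<^bsub>free_Abelian_group (carrier M \<times> carrier N)\<^esub> z \<longleftrightarrow> y - z \<in> tensor_null R M N"
  unfolding r_coset_def by (auto intro!: bexI[of _ "y - z"])

lemma null_coset_self:
  assumes "z \<in> tensor_null R M N"
  shows "tensor_null R M N #>\<^bsub>free_Abelian_group (carrier M \<times> carrier N)\<^esub> z = tensor_null R M N"
proof -
  have "y \<in> tensor_null R M N" if "y - z \<in> tensor_null R M N" for y
    using tensor_null_closed(3)[OF that assms] by simp
  moreover have "y - z \<in> tensor_null R M N" if "y \<in> tensor_null R M N" for y
    using tensor_null_closed(3)[OF that tensor_null_closed(4)[OF assms]] by simp
  ultimately show ?thesis using mem_null_coset by blast
qed

end

lemma tensor_carrier:
  "carrier (tensor R M N) =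
    (\<lambda>z. tensor_null R M N #>\<^bsub>free_Abelian_group (carrier M \<times> carrier N)\<^esub> z) `
      {z. Poly_Mapping.keys z \<subseteq> carrier M \<times> carrier N}"
proof -
  have "carrier (free_Abelian_group (carrier M \<times> carrier N)) = {z. Poly_Mapping.keys z \<subseteq> carrier M \<times> carrier N}"
    by auto
  then show ?thesis
    unfolding tensor_def FactGroup_def RCOSETS_def by (simp add: UNION_singleton_eq_range)
qed

lemma tensor_mult:
  "C \<otimes>\<^bsub>tensor R M N\<^esub> D = {x + y | x y. x \<in> C \<and> y \<in> D}"
  unfolding tensor_def FactGroup_def set_mult_def by auto

lemma tensor_one: "\<one>\<^bsub>tensor R M N\<^esub> = tensor_null R M N"
  unfolding tensor_def FactGroup_def by simp

text \<open>
  If \<open>\<theta>\<close> is balanced and biadditive on \<open>F\<^sub>2 \<times> N\<close> and kills the boundaries of \<open>F\<^sub>3\<close>, it detects the class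
  of any cycle \<open>c \<otimes> n\<close> on which it does not vanish. The hypotheses \<open>rel\<close> and \<open>map\<close> express that the tensor
  products and the map induced by the boundary make sense on representatives.
\<close>

lemma Tor_2_nontrivial:
  fixes R :: "('r, 'x) ring_scheme" and M :: "('r, 'm) module" and N :: "('r, 'n) module"
    and \<theta> :: "(('m, 'r) cell \<Rightarrow> 'r) \<times> 'n \<Rightarrow> 'k::comm_ring_1"
  defines "F \<equiv> res_module R M"
  assumes rel: "\<And>n. tensor_relations R (F n) N \<subseteq> carrier (free_Abelian_group (carrier (F n) \<times> carrier N))"
    and eval: "\<And>r. r \<in> tensor_relations R (F 2) N \<Longrightarrow> frag_eval \<theta> r = 0"
    and bnd: "\<And>m n. m \<in> carrier (F 3) \<Longrightarrow> n \<in> carrier N \<Longrightarrow> \<theta> (res_boundary R m, n) = 0"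
    and map: "\<And>r. r \<in> tensor_relations R (F 2) N \<Longrightarrow>
      frag_extend (\<lambda>(m, n). frag_of (res_boundary R m, n)) r \<in> tensor_null R (F 1) N"
    and c: "c \<in> carrier (F 2)" "n \<in> carrier N" "frag_of (res_boundary R c, n) \<in> tensor_null R (F 1) N"
      "\<theta> (c, n) \<noteq> 0"
  shows "carrier (Tor 2 R M N) \<noteq> {\<one>\<^bsub>Tor 2 R M N\<^esub>}"
proof
  define b where "b = (\<lambda>(m :: ('m, 'r) cell \<Rightarrow> 'r, n :: 'n). frag_of (res_boundary R m, n))"
  define T where "T k = tensor R (F k) N" for k
  define d where "d k = tensor_map R (F k) N (res_boundary R)" for k
  define Z where "Z = kernel (T 2) (T 1) (d 1)"
  define H where "H = d 2 ` carrier (T 3)"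
  let ?null = "\<lambda>k. tensor_null R (F k) N"
  let ?coset = "\<lambda>k z. ?null k #>\<^bsub>free_Abelian_group (carrier (F k) \<times> carrier N)\<^esub> z"
  have Tor: "Tor 2 R M N = (T 2)\<lparr>carrier := Z\<rparr> Mod H"
    by (simp add: Tor_def Let_def T_def d_def Z_def H_def F_def numeral_3_eq_3)
  define \<zeta> where "\<zeta> = ?coset 2 (frag_of (c, n))"
  have b_null: "frag_extend b z \<in> ?null 1" if "z \<in> ?null 2" for z
  proof (rule tensor_null_induct[OF rel that])
    show "frag_extend b 0 \<in> ?null 1" using tensor_null_closed(1)[OF rel] by simp
    show "frag_extend b r \<in> ?null 1" if "r \<in> tensor_relations R (F 2) N" for r
      using map[OF that] by (simp add: b_def)
    show "frag_extend b (- x) \<in> ?null 1" if "frag_extend b x \<in> ?null 1" for x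
      using tensor_null_closed(4)[OF rel that] by (simp add: frag_extend_minus)
    show "frag_extend b (x + y) \<in> ?null 1" if "frag_extend b x \<in> ?null 1" "frag_extend b y \<in> ?null 1" for x y
      using tensor_null_closed(3)[OF rel that] by (simp add: frag_extend_add)
  qed
  have \<zeta>T: "\<zeta> \<in> carrier (T 2)"
    unfolding T_def tensor_carrier \<zeta>_def using c(1,2) by (intro imageI) simp
  have "?coset 1 (frag_extend b z) = ?null 1" if "z \<in> \<zeta>" for z
  proof -
    have z: "z - frag_of (c, n) \<in> ?null 2"
      using that unfolding \<zeta>_def by (simp only: mem_null_coset[OF rel])
    have "frag_extend b (z - frag_of (c, n)) + frag_extend b (frag_of (c, n)) \<in> ?null 1"
      using tensor_null_closed(3)[OF rel b_null[OF z], of "frag_extend b (frag_of (c, n))"] c(3)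
      by (simp add: b_def)
    then have "frag_extend b z \<in> ?null 1" by (simp add: frag_extend_diff)
    then show ?thesis by (rule null_coset_self[OF rel])
  qed
  moreover have "frag_of (c, n) \<in> \<zeta>"
    unfolding \<zeta>_def mem_null_coset[OF rel] using tensor_null_closed(1)[OF rel] by simp
  ultimately have "d 1 \<zeta> = \<one>\<^bsub>T 1\<^esub>"
    unfolding d_def tensor_map_def T_def tensor_one b_def[symmetric]
    by (intro UN_eq_const[where z = "frag_of (c, n)"])
  then have "\<zeta> \<in> Z" using \<zeta>T by (simp add: Z_def kernel_def)
  then have mem: "H #>\<^bsub>(T 2)\<lparr>carrier := Z\<rparr>\<^esub> \<zeta> \<in> carrier (Tor 2 R M N)"
    unfolding Tor FactGroup_def RCOSETS_def by auto
  have H_eval: "frag_eval \<theta> y = 0" if "C \<in> H" "y \<in> C" for C y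
  proof -
    obtain D where D: "D \<in> carrier (T 3)" "C = d 2 D" using \<open>C \<in> H\<close> by (auto simp: H_def)
    obtain w where w: "Poly_Mapping.keys w \<subseteq> carrier (F 3) \<times> carrier N" "D = ?coset 3 w"
      using D(1) unfolding T_def tensor_carrier by blast
    obtain z where z: "z \<in> D" "y \<in> ?coset 2 (frag_extend b z)"
      using \<open>y \<in> C\<close> unfolding D(2) d_def tensor_map_def b_def by blast
    have "z - w \<in> ?null 3"
      using z(1) unfolding w(2) by (simp only: mem_null_coset[OF rel])
    then have "Poly_Mapping.keys (z - w) \<subseteq> carrier (F 3) \<times> carrier N"
      by (rule tensor_null_keys[OF rel])
    then have "Poly_Mapping.keys ((z - w) + w) \<subseteq> carrier (F 3) \<times> carrier N"
      using w(1) keys_add[of "z - w" w] by blast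
    then have "Poly_Mapping.keys z \<subseteq> carrier (F 3) \<times> carrier N" by simp
    then have 1: "frag_eval \<theta> (frag_extend b z) = 0"
      by (rule frag_eval_extend_zero) (auto simp: b_def bnd)
    have "y - frag_extend b z \<in> ?null 2"
      using z(2) by (simp only: mem_null_coset[OF rel])
    then have "frag_eval \<theta> (y - frag_extend b z) = 0"
      by (rule tensor_null_eval[OF rel]) (rule eval)
    then show ?thesis using 1 by (simp add: frag_eval_diff)
  qed
  have "?null 3 \<in> carrier (T 3)"
    unfolding T_def tensor_carrier using null_coset_self[OF rel tensor_null_closed(1)[OF rel], of 3]
    by (intro image_eqI[of _ _ 0]) auto
  moreover have "0 \<in> d 2 (?null 3)"
  proof -
    have "0 \<in> ?coset 2 (frag_extend b 0)"
      unfolding mem_null_coset[OF rel] using tensor_null_closed(1)[OF rel] by simp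
    then show ?thesis
      unfolding d_def tensor_map_def b_def[symmetric] using tensor_null_closed(1)[OF rel, of 3] by blast
  qed
  ultimately obtain C where C: "C \<in> H" "0 \<in> C" by (auto simp: H_def)
  have "C \<otimes>\<^bsub>T 2\<^esub> \<zeta> \<in> H #>\<^bsub>(T 2)\<lparr>carrier := Z\<rparr>\<^esub> \<zeta>"
    using C(1) by (auto simp: r_coset_def)
  moreover have "frag_of (c, n) \<in> C \<otimes>\<^bsub>T 2\<^esub> \<zeta>"
    unfolding T_def tensor_mult using C(2) \<open>frag_of (c, n) \<in> \<zeta>\<close> by force
  ultimately have "H #>\<^bsub>(T 2)\<lparr>carrier := Z\<rparr>\<^esub> \<zeta> \<noteq> H"
    using H_eval[of "C \<otimes>\<^bsub>T 2\<^esub> \<zeta>" "frag_of (c, n)"] c(4) by auto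
  moreover assume "carrier (Tor 2 R M N) = {\<one>\<^bsub>Tor 2 R M N\<^esub>}"
  ultimately show False using mem unfolding Tor FactGroup_def by auto
qed


section \<open>The second Tor group of a trivial module\<close>

definition single_chain :: "('r, 'x) ring_scheme \<Rightarrow> 's \<Rightarrow> 'r \<Rightarrow> 's \<Rightarrow> 'r" where
  "single_chain R s r = (\<lambda>c. if c = s then r else \<zero>\<^bsub>R\<^esub>)"

text \<open>
  The homomorphism of right modules from the free module to \<open>R\<close> that sends the basis element \<open>s\<close> to
  \<open>e s\<close>.
\<close>

definition linear_comb :: "('r, 'x) ring_scheme \<Rightarrow> ('s \<Rightarrow> 'r) \<Rightarrow> ('s \<Rightarrow> 'r) \<Rightarrow> 'r" where
  "linear_comb R e f = (\<Oplus>\<^bsub>R\<^esub>s\<in>{s. f s \<noteq> \<zero>\<^bsub>R\<^esub>}. e s \<otimes>\<^bsub>R\<^esub> f s)"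

lemma free_rmodule_simps:
  "f \<oplus>\<^bsub>free_rmodule R S\<^esub> g = (\<lambda>s. f s \<oplus>\<^bsub>R\<^esub> g s)"
  "r \<odot>\<^bsub>free_rmodule R S\<^esub> f = (\<lambda>s. f s \<otimes>\<^bsub>R\<^esub> r)"
  "f \<in> carrier (free_rmodule R S) \<longleftrightarrow>
    (\<forall>s. f s \<in> carrier R) \<and> finite {s. f s \<noteq> \<zero>\<^bsub>R\<^esub>} \<and> {s. f s \<noteq> \<zero>\<^bsub>R\<^esub>} \<subseteq> S"
  by (auto simp: free_rmodule_def)

context ring
begin

abbreviation FR :: "'s set \<Rightarrow> ('s \<Rightarrow> 'a) set" where
  "FR S \<equiv> carrier (free_rmodule R S)"

lemma FR_zero: "(\<lambda>s. \<zero>) \<in> FR S"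
  by (simp add: free_rmodule_simps)

lemma FR_add:
  assumes "f \<in> FR S" "g \<in> FR S"
  shows "(\<lambda>s. f s \<oplus> g s) \<in> FR S"
proof -
  have "{s. f s \<oplus> g s \<noteq> \<zero>} \<subseteq> {s. f s \<noteq> \<zero>} \<union> {s. g s \<noteq> \<zero>}" by auto
  then show ?thesis using assms unfolding free_rmodule_simps by (auto intro: finite_subset)
qed

lemma FR_smult:
  assumes "f \<in> FR S" "r \<in> carrier R"
  shows "(\<lambda>s. f s \<otimes> r) \<in> FR S"
proof -
  have "{s. f s \<otimes> r \<noteq> \<zero>} \<subseteq> {s. f s \<noteq> \<zero>}" using assms(2) by auto
  then show ?thesis using assms unfolding free_rmodule_simps by (auto intro: finite_subset)
qed

lemma FR_single: "s \<in> S \<Longrightarrow> r \<in> carrier R \<Longrightarrow> single_chain R s r \<in> FR S"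
  by (auto simp: free_rmodule_simps single_chain_def)

declare res_basis.simps [simp del]

lemma FR_induct [consumes 1, case_names zero step]:
  assumes "f \<in> FR S" and zero: "P (\<lambda>s. \<zero>)"
    and step: "\<And>f s r. f \<in> FR S \<Longrightarrow> s \<in> S \<Longrightarrow> r \<in> carrier R \<Longrightarrow> P f \<Longrightarrow>
      P (\<lambda>c. single_chain R s r c \<oplus> f c)"
  shows "P f"
proof -
  have "finite {s. f s \<noteq> \<zero>}" using assms(1) by (simp add: free_rmodule_simps)
  then show ?thesis using assms(1)
  proof (induction "{s. f s \<noteq> \<zero>}" arbitrary: f rule: finite_induct)
    case empty
    then have "f = (\<lambda>s. \<zero>)" by auto
    then show ?case using zero by simp
  next
    case (insert t F f)
    let ?g = "f(t := \<zero>)"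
    have F: "{s. ?g s \<noteq> \<zero>} = F" using insert.hyps(2,4) by auto
    have "{s. ?g s \<noteq> \<zero>} \<subseteq> {s. f s \<noteq> \<zero>}" by auto
    then have g: "?g \<in> FR S"
      using insert.prems F insert.hyps(1) unfolding free_rmodule_simps by auto
    have "P ?g" by (rule insert.hyps(3)[OF F[symmetric] g])
    moreover have "t \<in> S" "f t \<in> carrier R"
      using insert.prems insert.hyps(4) unfolding free_rmodule_simps by blast+
    ultimately have "P (\<lambda>c. single_chain R t (f t) c \<oplus> ?g c)"
      using g by (intro step)
    moreover have "(\<lambda>c. single_chain R t (f t) c \<oplus> ?g c) = f"
      using insert.prems unfolding free_rmodule_simps by (auto simp: single_chain_def)
    ultimately show ?case by simp
  qed
qed

context
  fixes S :: "'s set" and e :: "'s \<Rightarrow> 'a"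
  assumes e: "\<And>s. s \<in> S \<Longrightarrow> e s \<in> carrier R"
begin

lemma linear_comb_superset:
  assumes "f \<in> FR S" "finite F" "{s. f s \<noteq> \<zero>} \<subseteq> F" "F \<subseteq> S"
  shows "linear_comb R e f = (\<Oplus>s\<in>F. e s \<otimes> f s)"
  unfolding linear_comb_def
  by (rule add.finprod_mono_neutral_cong_left) (use assms e in \<open>auto simp: free_rmodule_simps\<close>)

lemma linear_comb_closed: "f \<in> FR S \<Longrightarrow> linear_comb R e f \<in> carrier R"
  unfolding linear_comb_def by (rule finsum_closed) (use e in \<open>auto simp: free_rmodule_simps\<close>)

lemma linear_comb_add:
  assumes "f \<in> FR S" "g \<in> FR S"
  shows "linear_comb R e (\<lambda>s. f s \<oplus> g s) = linear_comb R e f \<oplus> linear_comb R e g"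
proof -
  let ?F = "{s. f s \<noteq> \<zero>} \<union> {s. g s \<noteq> \<zero>}"
  have F: "finite ?F" "?F \<subseteq> S" and c: "\<And>s. f s \<in> carrier R" "\<And>s. g s \<in> carrier R"
    using assms by (auto simp: free_rmodule_simps)
  have "linear_comb R e (\<lambda>s. f s \<oplus> g s) = (\<Oplus>s\<in>?F. e s \<otimes> (f s \<oplus> g s))"
    using F by (intro linear_comb_superset FR_add assms) auto
  also have "\<dots> = (\<Oplus>s\<in>?F. e s \<otimes> f s \<oplus> e s \<otimes> g s)"
    using F e c by (intro finsum_cong) (auto simp: r_distr simp_implies_def)
  also have "\<dots> = (\<Oplus>s\<in>?F. e s \<otimes> f s) \<oplus> (\<Oplus>s\<in>?F. e s \<otimes> g s)"
    using F e c by (intro finsum_addf) auto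
  also have "(\<Oplus>s\<in>?F. e s \<otimes> f s) = linear_comb R e f"
    using F by (intro linear_comb_superset[symmetric] assms) auto
  also have "(\<Oplus>s\<in>?F. e s \<otimes> g s) = linear_comb R e g"
    using F by (intro linear_comb_superset[symmetric] assms) auto
  finally show ?thesis .
qed

lemma linear_comb_smult:
  assumes "f \<in> FR S" "r \<in> carrier R"
  shows "linear_comb R e (\<lambda>s. f s \<otimes> r) = linear_comb R e f \<otimes> r"
proof -
  let ?F = "{s. f s \<noteq> \<zero>}"
  have F: "finite ?F" "?F \<subseteq> S" and c: "\<And>s. f s \<in> carrier R"
    using assms by (auto simp: free_rmodule_simps)
  have "linear_comb R e (\<lambda>s. f s \<otimes> r) = (\<Oplus>s\<in>?F. e s \<otimes> (f s \<otimes> r))"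
    using F assms(2) by (intro linear_comb_superset FR_smult assms) auto
  also have "\<dots> = (\<Oplus>s\<in>?F. (e s \<otimes> f s) \<otimes> r)"
    using F e c assms(2) by (intro finsum_cong) (auto simp: m_assoc simp_implies_def)
  also have "\<dots> = linear_comb R e f \<otimes> r"
    unfolding linear_comb_def using F e c assms(2) by (intro finsum_ldistr[symmetric]) auto
  finally show ?thesis .
qed

lemma linear_comb_single:
  assumes "s \<in> S" "r \<in> carrier R"
  shows "linear_comb R e (single_chain R s r) = e s \<otimes> r"
proof -
  have "linear_comb R e (single_chain R s r) = (\<Oplus>t\<in>{s}. e t \<otimes> single_chain R s r t)"
    using assms by (intro linear_comb_superset FR_single) (auto simp: single_chain_def)
  also have "\<dots> = e s \<otimes> r"
    using e[OF assms(1)] assms(2) by (subst finsum_insert) (auto simp: single_chain_def)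
  finally show ?thesis .
qed

end

lemma linear_comb_zero: "linear_comb R e (\<lambda>s. \<zero>) = \<zero>"
  by (simp add: linear_comb_def)

lemma chain_Cons: "chain R ((s, r) # ps) = (\<lambda>c. if c = s then r \<oplus> chain R ps c else chain R ps c)"
  by (auto simp: chain_def)

lemma chain_FR: "set ps \<subseteq> S \<times> carrier R \<Longrightarrow> chain R ps \<in> FR S"
proof (induction ps)
  case Nil
  show ?case by (simp add: chain_def FR_zero)
next
  case (Cons p ps)
  then obtain s r where p: "p = (s, r)" "s \<in> S" "r \<in> carrier R" "chain R ps \<in> FR S" by auto
  have "(\<lambda>c. single_chain R s r c \<oplus> chain R ps c) \<in> FR S"
    by (intro FR_add FR_single p)
  moreover have "chain R (p # ps) = (\<lambda>c. single_chain R s r c \<oplus> chain R ps c)"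
    using p(4) unfolding p(1) chain_Cons by (auto simp: single_chain_def free_rmodule_simps)
  ultimately show ?case by simp
qed

lemma chain_Cons_add:
  assumes "set ps \<subseteq> S \<times> carrier R"
  shows "chain R ((s, r) # ps) = (\<lambda>c. single_chain R s r c \<oplus> chain R ps c)"
  using chain_FR[OF assms] unfolding chain_Cons by (auto simp: single_chain_def free_rmodule_simps)

end

text \<open>
  The ring \<open>R\<close> is augmented by \<open>eps\<close>, with section \<open>sc\<close>, and \<open>N\<close> is the trivial module. The ambient
  type \<open>V\<close> of \<open>W\<close> is a right \<open>R\<close>-module by \<open>act\<close>, and \<open>W\<close> is a submodule on which \<open>\<chi>\<close> factors through the
  coinvariants. On the augmentation ideal \<open>I\<close> the map \<open>\<Phi>\<close> is, modulo \<open>W\<close>, a homomorphism of right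
  modules \<open>I \<rightarrow> V/W\<close>. The extensions of \<open>N\<close> by \<open>I\<close> and of \<open>V/W\<close> by \<open>W\<close> shift its degree by two, so that
  \<open>\<chi>\<close> gives a functional on \<open>Tor\<^sub>2(N, N)\<close>.
\<close>

locale trivial_Tor =
  ring R for R :: "('r, 'x) ring_scheme" (structure) +
  fixes N :: "('r, 'k::comm_ring_1) module" and eps :: "'r \<Rightarrow> 'k" and sc :: "'k \<Rightarrow> 'r"
    and act :: "'v::ab_group_add \<Rightarrow> 'r \<Rightarrow> 'v" and \<Phi> :: "'r \<Rightarrow> 'v" and W :: "'v set" and \<chi> :: "'v \<Rightarrow> 'k"
  assumes N: "carrier N = UNIV" "\<And>x y. x \<oplus>\<^bsub>N\<^esub> y = x + y" "\<zero>\<^bsub>N\<^esub> = 0" "\<And>r c. r \<odot>\<^bsub>N\<^esub> c = eps r * c"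
    and eps: "eps \<one> = 1" "\<And>r s. r \<in> carrier R \<Longrightarrow> s \<in> carrier R \<Longrightarrow> eps (r \<oplus> s) = eps r + eps s"
      "\<And>r s. r \<in> carrier R \<Longrightarrow> s \<in> carrier R \<Longrightarrow> eps (r \<otimes> s) = eps r * eps s"
    and sc: "\<And>c. sc c \<in> carrier R" "\<And>c. eps (sc c) = c" "sc 1 = \<one>"
    and act: "\<And>v w r. act (v + w) r = act v r + act w r"
      "\<And>v r s. r \<in> carrier R \<Longrightarrow> s \<in> carrier R \<Longrightarrow> act v (r \<oplus> s) = act v r + act v s"
      "\<And>v r s. r \<in> carrier R \<Longrightarrow> s \<in> carrier R \<Longrightarrow> act v (r \<otimes> s) = act (act v r) s"
      "\<And>v. act v \<one> = v"
    and W: "0 \<in> W" "\<And>v w. v \<in> W \<Longrightarrow> w \<in> W \<Longrightarrow> v - w \<in> W"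
      "\<And>w r. w \<in> W \<Longrightarrow> r \<in> carrier R \<Longrightarrow> act w r \<in> W"
    and \<chi>: "\<And>v w. \<chi> (v + w) = \<chi> v + \<chi> w"
      "\<And>w r. w \<in> W \<Longrightarrow> r \<in> carrier R \<Longrightarrow> \<chi> (act w r) = \<chi> w * eps r"
    and \<Phi>: "\<And>r s. r \<in> carrier R \<Longrightarrow> s \<in> carrier R \<Longrightarrow> \<Phi> (r \<oplus> s) - (\<Phi> r + \<Phi> s) \<in> W"
      "\<And>r s. r \<in> carrier R \<Longrightarrow> s \<in> carrier R \<Longrightarrow> eps r = 0 \<Longrightarrow> \<Phi> (r \<otimes> s) - act (\<Phi> r) s \<in> W"
begin

abbreviation basis :: "nat \<Rightarrow> ('k, 'r) cell set" where
  "basis \<equiv> res_basis R N"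

lemma act_zero_left: "act 0 r = 0"
  using act(1)[of 0 0 r] by simp

lemma act_zero_right: "act v \<zero> = 0"
  using act(2)[of \<zero> \<zero> v] by simp

lemma W_add: "v \<in> W \<Longrightarrow> w \<in> W \<Longrightarrow> v + w \<in> W"
  using W(2)[of v "0 - w"] W(2)[OF W(1), of w] by simp

lemma eps_zero: "eps \<zero> = 0"
  using eps(2)[of \<zero> \<zero>] by simp

lemma \<chi>_zero: "\<chi> 0 = 0"
  using \<chi>(1)[of 0 0] by simp

lemma \<Phi>_zero: "\<Phi> \<zero> \<in> W"
proof -
  have "\<Phi> (\<zero> \<oplus> \<zero>) - (\<Phi> \<zero> + \<Phi> \<zero>) \<in> W" by (rule \<Phi>(1)) simp_all
  then have "0 - \<Phi> \<zero> \<in> W" by simp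
  from W(2)[OF W(1) this] show ?thesis by simp
qed

text \<open>A lift \<open>F\<^sub>0 \<rightarrow> R\<close> of the identity of \<open>N\<close>: by \<open>res_aug_eq\<close> it commutes with the augmentations.\<close>

definition proj0 :: "(('k, 'r) cell \<Rightarrow> 'r) \<Rightarrow> 'r" where
  "proj0 = linear_comb R (\<lambda>s. case s of Base m \<Rightarrow> sc m | Syz ps \<Rightarrow> \<zero>)"

lemma proj0_gen: "(case s of Base m \<Rightarrow> sc m | Syz ps \<Rightarrow> \<zero>) \<in> carrier R"
  by (cases s) (simp_all add: sc)

lemma proj0_closed: "f \<in> FR S \<Longrightarrow> proj0 f \<in> carrier R"
  unfolding proj0_def by (rule linear_comb_closed[OF proj0_gen])

lemma proj0_add: "f \<in> FR S \<Longrightarrow> g \<in> FR S \<Longrightarrow> proj0 (\<lambda>s. f s \<oplus> g s) = proj0 f \<oplus> proj0 g"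
  unfolding proj0_def by (rule linear_comb_add[OF proj0_gen])

lemma proj0_smult: "f \<in> FR S \<Longrightarrow> r \<in> carrier R \<Longrightarrow> proj0 (\<lambda>s. f s \<otimes> r) = proj0 f \<otimes> r"
  unfolding proj0_def by (rule linear_comb_smult[OF proj0_gen])

lemma proj0_single_Base: "r \<in> carrier R \<Longrightarrow> proj0 (single_chain R (Base m) r) = sc m \<otimes> r"
  using linear_comb_single[of UNIV "\<lambda>s. case s of Base m \<Rightarrow> sc m | Syz ps \<Rightarrow> \<zero>", OF proj0_gen, of "Base m" r]
  by (simp add: proj0_def)

lemma res_aug_eq:
  assumes "f \<in> FR S"
  shows "res_aug R N f = eps (proj0 f)"
proof -
  interpret Nm: abelian_monoid N
    by unfold_locales (auto simp: N algebra_simps)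
  have f: "\<And>s. f s \<in> carrier R" using assms by (simp add: free_rmodule_simps)
  have "(\<Oplus>\<^bsub>N\<^esub>s\<in>F. case s of Base m \<Rightarrow> f s \<odot>\<^bsub>N\<^esub> m | Syz ps \<Rightarrow> \<zero>\<^bsub>N\<^esub>) =
      eps (\<Oplus>s\<in>F. (case s of Base m \<Rightarrow> sc m | Syz ps \<Rightarrow> \<zero>) \<otimes> f s)" if "finite F" for F
    using that
  proof (induction F)
    case empty
    show ?case by (simp add: N eps_zero)
  next
    case (insert s F)
    have "eps (\<Oplus>s\<in>insert s F. (case s of Base m \<Rightarrow> sc m | Syz ps \<Rightarrow> \<zero>) \<otimes> f s)
        = eps ((case s of Base m \<Rightarrow> sc m | Syz ps \<Rightarrow> \<zero>) \<otimes> f s \<oplus>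
          (\<Oplus>s\<in>F. (case s of Base m \<Rightarrow> sc m | Syz ps \<Rightarrow> \<zero>) \<otimes> f s))"
      using insert.hyps f proj0_gen by (subst finsum_insert) auto
    also have "\<dots> = eps ((case s of Base m \<Rightarrow> sc m | Syz ps \<Rightarrow> \<zero>) \<otimes> f s) +
        eps (\<Oplus>s\<in>F. (case s of Base m \<Rightarrow> sc m | Syz ps \<Rightarrow> \<zero>) \<otimes> f s)"
      using f proj0_gen by (intro eps(2) m_closed finsum_closed) auto
    also have "eps ((case s of Base m \<Rightarrow> sc m | Syz ps \<Rightarrow> \<zero>) \<otimes> f s) =
        (case s of Base m \<Rightarrow> f s \<odot>\<^bsub>N\<^esub> m | Syz ps \<Rightarrow> \<zero>\<^bsub>N\<^esub>)"
      using f by (cases s) (simp_all add: eps sc N eps_zero mult.commute)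
    finally show ?case
      using insert by (subst Nm.finsum_insert) (auto simp: N)
  qed
  then show ?thesis
    using assms by (simp add: res_aug_def proj0_def linear_comb_def free_rmodule_simps)
qed

lemma basis_Suc_cases:
  assumes "s \<in> basis (Suc n)"
  obtains ps where "s = Syz ps" "set ps \<subseteq> basis n \<times> carrier R"
    "n = 0 \<Longrightarrow> res_aug R N (chain R ps) = 0" "n > 0 \<Longrightarrow> res_boundary R (chain R ps) = (\<lambda>c. \<zero>)"
  using assms by (cases "n = 0") (auto simp: N res_basis.simps)

lemma cell_boundary_FR: "s \<in> basis (Suc n) \<Longrightarrow> cell_boundary R s \<in> FR (basis n)"
  by (erule basis_Suc_cases) (simp add: chain_FR)

lemma res_boundary_eq: "res_boundary R f c = linear_comb R (\<lambda>s. cell_boundary R s c) f"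
  by (simp add: res_boundary_def linear_comb_def)

lemma cell_boundary_closed: "s \<in> basis (Suc n) \<Longrightarrow> cell_boundary R s c \<in> carrier R"
  using cell_boundary_FR by (auto simp: free_rmodule_simps)

lemma boundary_zero: "res_boundary R (\<lambda>s. \<zero>) = (\<lambda>c. \<zero>)"
  by (simp add: res_boundary_eq linear_comb_zero fun_eq_iff)

lemma boundary_add:
  assumes "f \<in> FR (basis (Suc n))" "g \<in> FR (basis (Suc n))"
  shows "res_boundary R (\<lambda>s. f s \<oplus> g s) = (\<lambda>c. res_boundary R f c \<oplus> res_boundary R g c)"
  unfolding res_boundary_eq fun_eq_iff
  by (intro allI linear_comb_add[where S = "basis (Suc n)"] assms cell_boundary_closed)

lemma boundary_smult:
  assumes "f \<in> FR (basis (Suc n))" "r \<in> carrier R"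
  shows "res_boundary R (\<lambda>s. f s \<otimes> r) = (\<lambda>c. res_boundary R f c \<otimes> r)"
  unfolding res_boundary_eq fun_eq_iff
  by (intro allI linear_comb_smult[where S = "basis (Suc n)"] assms cell_boundary_closed)

lemma boundary_single:
  assumes "s \<in> basis (Suc n)" "r \<in> carrier R"
  shows "res_boundary R (single_chain R s r) = (\<lambda>c. cell_boundary R s c \<otimes> r)"
  unfolding res_boundary_eq fun_eq_iff
  by (intro allI linear_comb_single[where S = "basis (Suc n)"] assms cell_boundary_closed)

lemma boundary_FR:
  assumes "f \<in> FR (basis (Suc n))"
  shows "res_boundary R f \<in> FR (basis n)"
  using assms
proof (induction rule: FR_induct)
  case zero
  show ?case by (simp add: boundary_zero FR_zero)
next
  case (step f s r)
  then show ?case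
    by (simp add: boundary_add[OF FR_single[OF step(2,3)] step(1)] boundary_single FR_add FR_smult cell_boundary_FR)
qed

lemma boundary_boundary:
  assumes "f \<in> FR (basis (Suc (Suc n)))"
  shows "res_boundary R (res_boundary R f) = (\<lambda>c. \<zero>)"
  using assms
proof (induction rule: FR_induct)
  case zero
  show ?case by (simp add: boundary_zero)
next
  case (step f s r)
  have s: "cell_boundary R s \<in> FR (basis (Suc n))" by (rule cell_boundary_FR[OF step(2)])
  have "res_boundary R (cell_boundary R s) = (\<lambda>c. \<zero>)"
    using step(2) by (rule basis_Suc_cases) simp
  then have "res_boundary R (\<lambda>c. cell_boundary R s c \<otimes> r) = (\<lambda>c. \<zero>)"
    using step(3) by (simp add: boundary_smult[OF s])
  then show ?case
    unfolding boundary_add[OF FR_single[OF step(2,3)] step(1)] boundary_single[OF step(2,3)]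
    using step(4) by (subst boundary_add[OF FR_smult[OF s step(3)] boundary_FR[OF step(1)]]) simp
qed

lemma proj0_boundary_add: "f \<in> FR (basis 1) \<Longrightarrow> g \<in> FR (basis 1) \<Longrightarrow>
    proj0 (res_boundary R (\<lambda>s. f s \<oplus> g s)) = proj0 (res_boundary R f) \<oplus> proj0 (res_boundary R g)"
  using boundary_add[of f 0 g] boundary_FR[of f 0] boundary_FR[of g 0] proj0_add by simp

lemma eps_proj0_cell:
  assumes "s \<in> basis 1"
  shows "eps (proj0 (cell_boundary R s)) = 0"
proof -
  obtain ps where "s = Syz ps" "set ps \<subseteq> basis 0 \<times> carrier R" "res_aug R N (chain R ps) = 0"
    using assms basis_Suc_cases[of s 0] by auto
  then show ?thesis using res_aug_eq[OF chain_FR, of ps "basis 0"] by simp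
qed

text \<open>
  A lift \<open>F\<^sub>1 \<rightarrow> V\<close> of the map \<open>F\<^sub>1 \<rightarrow> V/W\<close> induced by \<open>\<Phi>\<close> on \<open>proj0\<close> of boundaries. Such a lift exists
  because \<open>F\<^sub>1\<close> is free: values in \<open>V\<close> are chosen on the basis and extended linearly.
\<close>

definition lam :: "(('k, 'r) cell \<Rightarrow> 'r) \<Rightarrow> 'v" where
  "lam f = (\<Sum>s\<in>{s. f s \<noteq> \<zero>}. act (\<Phi> (proj0 (cell_boundary R s))) (f s))"

lemma lam_superset:
  assumes "finite F" "{s. f s \<noteq> \<zero>} \<subseteq> F"
  shows "lam f = (\<Sum>s\<in>F. act (\<Phi> (proj0 (cell_boundary R s))) (f s))"
  unfolding lam_def by (rule sum.mono_neutral_left) (use assms in \<open>auto simp: act_zero_right\<close>)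

lemma lam_add:
  assumes "f \<in> FR S" "g \<in> FR S"
  shows "lam (\<lambda>s. f s \<oplus> g s) = lam f + lam g"
proof -
  let ?F = "{s. f s \<noteq> \<zero>} \<union> {s. g s \<noteq> \<zero>}"
  have F: "finite ?F" and c: "\<And>s. f s \<in> carrier R" "\<And>s. g s \<in> carrier R"
    using assms by (auto simp: free_rmodule_simps)
  have "lam (\<lambda>s. f s \<oplus> g s) = (\<Sum>s\<in>?F. act (\<Phi> (proj0 (cell_boundary R s))) (f s \<oplus> g s))"
    using F by (intro lam_superset) auto
  also have "\<dots> = lam f + lam g"
    using lam_superset[OF F, of f] lam_superset[OF F, of g] by (simp add: act(2) c sum.distrib)
  finally show ?thesis .
qed

lemma lam_smult:
  assumes "f \<in> FR S" "r \<in> carrier R"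
  shows "lam (\<lambda>s. f s \<otimes> r) = act (lam f) r"
proof -
  let ?F = "{s. f s \<noteq> \<zero>}"
  have F: "finite ?F" and c: "\<And>s. f s \<in> carrier R"
    using assms by (auto simp: free_rmodule_simps)
  have act_sum: "act (sum h A) r = (\<Sum>s\<in>A. act (h s) r)" if "finite A" for h and A :: "('k, 'r) cell set"
    using that by induction (simp_all add: act(1) act_zero_left)
  have "lam (\<lambda>s. f s \<otimes> r) = (\<Sum>s\<in>?F. act (\<Phi> (proj0 (cell_boundary R s))) (f s \<otimes> r))"
    using F assms(2) by (intro lam_superset) auto
  also have "\<dots> = act (lam f) r"
    using F assms(2) c by (simp add: lam_def act_sum act(3))
  finally show ?thesis .
qed

lemma lam_single: "r \<in> carrier R \<Longrightarrow> lam (single_chain R s r) = act (\<Phi> (proj0 (cell_boundary R s))) r"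
proof -
  have "{t. single_chain R s r t \<noteq> \<zero>} \<subseteq> {s}" by (auto simp: single_chain_def)
  from lam_superset[OF _ this] show ?thesis by (simp add: single_chain_def)
qed

lemma lam_zero: "lam (\<lambda>s. \<zero>) = 0"
  by (simp add: lam_def)

text \<open>
  Modulo \<open>W\<close> both sides are homomorphisms of right modules, since \<open>proj0\<close> maps boundaries into the
  augmentation ideal, and they agree on the basis.
\<close>

lemma lam_boundary:
  assumes "f \<in> FR (basis 1)"
  shows "\<Phi> (proj0 (res_boundary R f)) - lam f \<in> W"
  using assms
proof (induction rule: FR_induct)
  case zero
  show ?case by (simp add: boundary_zero lam_zero proj0_def linear_comb_zero \<Phi>_zero)
next
  case (step f s r)
  have s: "s \<in> basis (Suc 0)" using step(2) by simp
  define i where "i = proj0 (cell_boundary R s)"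
  define j where "j = proj0 (res_boundary R f)"
  have ij: "i \<in> carrier R" "j \<in> carrier R"
    unfolding i_def j_def using cell_boundary_FR[OF s] boundary_FR[of f 0] step(1) proj0_closed by auto
  have "proj0 (res_boundary R (single_chain R s r)) = i \<otimes> r"
    unfolding boundary_single[OF s step(3)] i_def using cell_boundary_FR[OF s] step(3) by (rule proj0_smult)
  then have eq: "proj0 (res_boundary R (\<lambda>c. single_chain R s r c \<oplus> f c)) = i \<otimes> r \<oplus> j"
    unfolding j_def using proj0_boundary_add[OF FR_single[OF step(2,3)] step(1)] by simp
  have "\<Phi> (i \<otimes> r \<oplus> j) - (\<Phi> (i \<otimes> r) + \<Phi> j) \<in> W"
    using ij step(3) by (intro \<Phi>(1)) auto
  moreover have "\<Phi> (i \<otimes> r) - act (\<Phi> i) r \<in> W"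
    using ij step(3) eps_proj0_cell[OF step(2)] by (intro \<Phi>(2)) (auto simp: i_def)
  moreover have "\<Phi> j - lam f \<in> W" using step(4) by (simp add: j_def)
  ultimately have "(\<Phi> (i \<otimes> r \<oplus> j) - (\<Phi> (i \<otimes> r) + \<Phi> j)) + ((\<Phi> (i \<otimes> r) - act (\<Phi> i) r) + (\<Phi> j - lam f)) \<in> W"
    by (intro W_add)
  moreover have "(\<Phi> (i \<otimes> r \<oplus> j) - (\<Phi> (i \<otimes> r) + \<Phi> j)) + ((\<Phi> (i \<otimes> r) - act (\<Phi> i) r) + (\<Phi> j - lam f))
      = \<Phi> (i \<otimes> r \<oplus> j) - (act (\<Phi> i) r + lam f)" by (simp add: algebra_simps)
  ultimately show ?case
    unfolding eq lam_add[OF FR_single[OF step(2,3)] step(1)] lam_single[OF step(3)] i_def[symmetric]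
    by simp
qed

lemma lam_cycle: "f \<in> FR (basis 1) \<Longrightarrow> res_boundary R f = (\<lambda>c. \<zero>) \<Longrightarrow> lam f \<in> W"
  using lam_boundary[of f] W(2)[OF \<Phi>_zero, of "\<Phi> \<zero> - lam f"]
  by (simp add: proj0_def linear_comb_zero)

lemma res_module_carrier: "carrier (res_module R N n) = FR (basis n)"
  by (simp add: res_module_def)

lemma tensor_relations_cases:
  assumes "r \<in> tensor_relations R (res_module R N n) N"
  obtains m m' c where "m \<in> FR (basis n)" "m' \<in> FR (basis n)"
      "r = frag_of ((\<lambda>s. m s \<oplus> m' s), c) - frag_of (m, c) - frag_of (m', c)"
    | m c c' where "m \<in> FR (basis n)" "r = frag_of (m, c + c') - frag_of (m, c) - frag_of (m, c')"
    | t m c where "t \<in> carrier R" "m \<in> FR (basis n)"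
      "r = frag_of ((\<lambda>s. m s \<otimes> t), c) - frag_of (m, eps t * c)"
  using assms unfolding tensor_relations_def res_module_carrier N(1)
  by (auto simp: res_module_def free_rmodule_simps(1,2) N(2,4))

lemma tensor_relations_closed:
  "tensor_relations R (res_module R N n) N \<subseteq>
    carrier (free_Abelian_group (carrier (res_module R N n) \<times> carrier N))"
proof
  have k2: "Poly_Mapping.keys (x - y) \<subseteq> A"
    if "Poly_Mapping.keys x \<subseteq> A" "Poly_Mapping.keys y \<subseteq> A"
    for x y :: "((('k, 'r) cell \<Rightarrow> 'r) \<times> 'k) \<Rightarrow>\<^sub>0 int" and A
    using that keys_diff[of x y] by blast
  fix r assume "r \<in> tensor_relations R (res_module R N n) N"
  then show "r \<in> carrier (free_Abelian_group (carrier (res_module R N n) \<times> carrier N))"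
    unfolding carrier_free_Abelian_group_iff
  proof (cases rule: tensor_relations_cases)
    case (1 m m' c)
    then show "Poly_Mapping.keys r \<subseteq> carrier (res_module R N n) \<times> carrier N"
      unfolding 1(3) by (intro k2) (auto simp: res_module_carrier FR_add N)
  next
    case (2 m c c')
    then show "Poly_Mapping.keys r \<subseteq> carrier (res_module R N n) \<times> carrier N"
      unfolding 2(2) by (intro k2) (auto simp: res_module_carrier N)
  next
    case (3 t m c)
    then show "Poly_Mapping.keys r \<subseteq> carrier (res_module R N n) \<times> carrier N"
      unfolding 3(3) by (intro k2) (auto simp: res_module_carrier FR_smult N)
  qed
qed

text \<open>
  By \<open>lam_cycle\<close> the composite of \<open>lam\<close> with the boundary of \<open>F\<^sub>2\<close> takes values in \<open>W\<close>, and \<open>\<chi>\<close> of it is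
  the 2-cocycle. An identity \<open>\<Sum> i r = 0\<close> in \<open>I\<close> gives a 2-cycle: if \<open>[i]\<close> is the cell of \<open>F\<^sub>1\<close> over \<open>i \<in> I\<close>,
  then \<open>\<Sum> [i] r\<close> is a syzygy, that is a cell of \<open>F\<^sub>2\<close>, and its boundary becomes zero after tensoring
  with \<open>N\<close> because \<open>[i] r \<otimes> 1 = [i] \<otimes> eps r = 0\<close>.
\<close>

theorem Tor_2_trivial_nonzero:
  assumes ps: "set ps \<subseteq> carrier R \<times> carrier R" "\<And>i r. (i, r) \<in> set ps \<Longrightarrow> eps i = 0 \<and> eps r = 0"
    and rel: "foldr (\<lambda>(i, r) t. i \<otimes> r \<oplus> t) ps \<zero> = \<zero>"
    and nz: "\<chi> (foldr (\<lambda>(i, r) v. act (\<Phi> i) r + v) ps 0) \<noteq> 0"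
  shows "carrier (Tor 2 R N N) \<noteq> {\<one>\<^bsub>Tor 2 R N N\<^esub>}"
proof -
  define syz :: "'r \<Rightarrow> ('k, 'r) cell" where "syz i = Syz [(Base 1, i)]" for i
  define qs where "qs = map (\<lambda>(i, r). (syz i, r)) ps"
  define c where "c = single_chain R (Syz qs) \<one>"
  define \<theta> where "\<theta> = (\<lambda>(m, n). \<chi> (lam (res_boundary R m)) * n)"
  have B: "Base 1 \<in> basis 0" by (simp add: N res_basis.simps)
  have ch1: "chain R [(Base 1 :: ('k, 'r) cell, i)] = single_chain R (Base 1) i" if "i \<in> carrier R" for i
    using that by (auto simp: chain_def single_chain_def)
  have proj: "proj0 (cell_boundary R (syz i)) = i" if "i \<in> carrier R" for i
    using that proj0_single_Base[OF that] by (simp add: syz_def ch1 sc)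
  have syz: "syz i \<in> basis 1" if "i \<in> carrier R" "eps i = 0" for i
  proof -
    have "res_aug R N (single_chain R (Base 1) i) = 0"
      using res_aug_eq[OF FR_single[OF B that(1)]] proj0_single_Base[OF that(1)] that by (simp add: sc)
    then show ?thesis using that B by (auto simp: syz_def ch1 N res_basis.simps)
  qed
  have qs: "set qs \<subseteq> basis 1 \<times> carrier R"
  proof
    fix q assume "q \<in> set qs"
    then obtain i r where ir: "(i, r) \<in> set ps" "q = (syz i, r)" unfolding qs_def by auto
    then have "i \<in> carrier R" "r \<in> carrier R" "eps i = 0" using ps(1) ps(2)[OF ir(1)] by auto
    then show "q \<in> basis 1 \<times> carrier R" using syz[of i] ir(2) by blast
  qed
  have general: "lam (chain R (map (\<lambda>(i, r). (syz i, r)) us)) = foldr (\<lambda>(i, r) v. act (\<Phi> i) r + v) us 0 \<and>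
      res_boundary R (chain R (map (\<lambda>(i, r). (syz i, r)) us)) =
        single_chain R (Base 1) (foldr (\<lambda>(i, r) t. i \<otimes> r \<oplus> t) us \<zero>) \<and>
      foldr (\<lambda>(i, r) t. i \<otimes> r \<oplus> t) us \<zero> \<in> carrier R \<and>
      frag_of (chain R (map (\<lambda>(i, r). (syz i, r)) us), 1) \<in> tensor_null R (res_module R N 1) N"
    if "set us \<subseteq> set ps" for us
    using that
  proof (induction us)
    case Nil
    have "chain R [] = (\<lambda>s :: ('k, 'r) cell. \<zero>)" by (simp add: chain_def)
    moreover have "frag_of ((\<lambda>s. \<zero>), 1) \<in> tensor_null R (res_module R N 1) N"
    proof -
      have "frag_of ((\<lambda>s. \<zero>) \<oplus>\<^bsub>res_module R N 1\<^esub> (\<lambda>s. \<zero>), 1) - frag_of ((\<lambda>s. \<zero>), 1) - frag_of ((\<lambda>s. \<zero>), 1)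
          \<in> tensor_relations R (res_module R N 1) N"
        unfolding tensor_relations_def res_module_carrier N(1) using FR_zero by blast
      then have "- frag_of ((\<lambda>s. \<zero>), 1) \<in> tensor_null R (res_module R N 1) N"
        using tensor_null_closed(2)[OF tensor_relations_closed] by (simp add: res_module_def free_rmodule_simps)
      from tensor_null_closed(4)[OF tensor_relations_closed this] show ?thesis by simp
    qed
    ultimately show ?case by (simp add: lam_zero boundary_zero single_chain_def)
  next
    case (Cons p us)
    obtain i r where p: "p = (i, r)" by (cases p)
    have ir: "i \<in> carrier R" "r \<in> carrier R" "eps i = 0" "eps r = 0"
      using Cons.prems ps(1) ps(2)[of i r] unfolding p by auto
    let ?us = "map (\<lambda>(i, r). (syz i, r)) us"
    let ?fold = "foldr (\<lambda>(i, r) t. i \<otimes> r \<oplus> t) us \<zero>"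
    have us: "set ?us \<subseteq> basis 1 \<times> carrier R"
    proof -
      have "set ?us \<subseteq> set qs" using Cons.prems unfolding qs_def by (auto simp: image_iff)
      then show ?thesis using qs by (rule subset_trans)
    qed
    have FR: "chain R ?us \<in> FR (basis 1)" by (rule chain_FR[OF us])
    have sF: "single_chain R (syz i) r \<in> FR (basis 1)" by (intro FR_single syz ir)
    have ch: "chain R (map (\<lambda>(i, r). (syz i, r)) (p # us)) = (\<lambda>c. single_chain R (syz i) r c \<oplus> chain R ?us c)"
      using chain_Cons_add[OF us, of "syz i" r] by (simp add: p)
    have IH: "lam (chain R ?us) = foldr (\<lambda>(i, r) v. act (\<Phi> i) r + v) us 0"
      "res_boundary R (chain R ?us) = single_chain R (Base 1) ?fold" "?fold \<in> carrier R"
      "frag_of (chain R ?us, 1) \<in> tensor_null R (res_module R N 1) N"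
      using Cons by auto
    have 1: "lam (\<lambda>c. single_chain R (syz i) r c \<oplus> chain R ?us c) = act (\<Phi> i) r + foldr (\<lambda>(i, r) v. act (\<Phi> i) r + v) us 0"
      unfolding lam_add[OF sF FR] IH lam_single[OF ir(2)] proj[OF ir(1)] ..
    have "res_boundary R (single_chain R (syz i) r) = (\<lambda>c. single_chain R (Base 1) i c \<otimes> r)"
      using boundary_single[of "syz i" 0 r] syz[of i] ir ch1 by (simp add: syz_def)
    then have 2: "res_boundary R (\<lambda>c. single_chain R (syz i) r c \<oplus> chain R ?us c)
        = single_chain R (Base 1) (i \<otimes> r \<oplus> ?fold)"
      using boundary_add[of "single_chain R (syz i) r" 0 "chain R ?us"] sF FR IH ir
      by (auto simp: single_chain_def)
    have 3: "frag_of ((\<lambda>c. single_chain R (syz i) r c \<oplus> chain R ?us c), 1) \<in> tensor_null R (res_module R N 1) N"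
    proof -
      let ?M = "res_module R N 1"
      let ?e = "single_chain R (syz i) \<one>"
      note null = tensor_null_closed[OF tensor_relations_closed[of 1]]
      have e: "?e \<in> FR (basis 1)" by (intro FR_single syz ir) simp
      have re: "r \<odot>\<^bsub>?M\<^esub> ?e = single_chain R (syz i) r"
        using ir by (auto simp: res_module_def free_rmodule_simps single_chain_def)
      have "frag_of (r \<odot>\<^bsub>?M\<^esub> ?e, 1) - frag_of (?e, r \<odot>\<^bsub>N\<^esub> 1) \<in> tensor_relations R ?M N"
        unfolding tensor_relations_def res_module_carrier N(1) using e ir by blast
      then have a: "frag_of (single_chain R (syz i) r, 1) - frag_of (?e, 0) \<in> tensor_null R ?M N"
        unfolding re using ir null(2) by (simp add: N)
      have "frag_of (?e, 0 \<oplus>\<^bsub>N\<^esub> 0) - frag_of (?e, 0) - frag_of (?e, 0) \<in> tensor_relations R ?M N"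
        unfolding tensor_relations_def res_module_carrier N(1) using e by blast
      then have "- frag_of (?e, 0) \<in> tensor_null R ?M N"
        using null(2) by (simp add: N)
      from null(4)[OF this] have b: "frag_of (?e, 0) \<in> tensor_null R ?M N" by simp
      have c: "frag_of (single_chain R (syz i) r, 1) \<in> tensor_null R ?M N"
        using null(3)[OF a b] by simp
      have "frag_of (single_chain R (syz i) r \<oplus>\<^bsub>?M\<^esub> chain R ?us, 1) - frag_of (single_chain R (syz i) r, 1)
          - frag_of (chain R ?us, 1) \<in> tensor_relations R ?M N"
        unfolding tensor_relations_def res_module_carrier N(1) using sF FR by blast
      from null(3)[OF null(2)[OF this] null(3)[OF c IH(4)]] show ?thesis
        by (simp add: res_module_def free_rmodule_simps)
    qed
    have 4: "i \<otimes> r \<oplus> ?fold \<in> carrier R" using ir IH(3) by simp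
    show ?case unfolding ch using 1 2 3 4 by (simp add: p)
  qed
  have cyc: "res_boundary R (chain R qs) = (\<lambda>c. \<zero>)" and lamq: "lam (chain R qs) = foldr (\<lambda>(i, r) v. act (\<Phi> i) r + v) ps 0"
    and null: "frag_of (chain R qs, 1) \<in> tensor_null R (res_module R N 1) N"
    using general[of ps] rel unfolding qs_def by (auto simp: single_chain_def)
  have Syz: "Syz qs \<in> basis (Suc 1)" using qs cyc by (simp add: res_basis.simps)
  have cF: "c \<in> FR (basis 2)"
    unfolding c_def using FR_single[OF Syz one_closed] by (simp add: numeral_2_eq_2)
  have "res_boundary R c = (\<lambda>x. chain R qs x \<otimes> \<one>)"
    unfolding c_def boundary_single[OF Syz one_closed] by simp
  then have bc: "res_boundary R c = chain R qs"
    using chain_FR[OF qs] by (auto simp: free_rmodule_simps)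
  have b2: "lam (res_boundary R m) \<in> W" "res_boundary R m \<in> FR (basis 1)" if "m \<in> FR (basis 2)" for m
  proof -
    have m: "m \<in> FR (basis (Suc (Suc 0)))" using that by (simp add: numeral_2_eq_2)
    show "res_boundary R m \<in> FR (basis 1)" using boundary_FR[OF m] by simp
    then show "lam (res_boundary R m) \<in> W" using boundary_boundary[OF m] by (intro lam_cycle)
  qed
  have add2: "res_boundary R (\<lambda>s. m s \<oplus> m' s) = (\<lambda>c. res_boundary R m c \<oplus> res_boundary R m' c)"
    if "m \<in> FR (basis 2)" "m' \<in> FR (basis 2)" for m m'
    using that boundary_add[of m 1 m'] by (simp add: numeral_2_eq_2)
  have smult2: "res_boundary R (\<lambda>s. m s \<otimes> t) = (\<lambda>c. res_boundary R m c \<otimes> t)"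
    if "m \<in> FR (basis 2)" "t \<in> carrier R" for m t
    using that boundary_smult[of m 1 t] by (simp add: numeral_2_eq_2)
  show ?thesis
  proof (rule Tor_2_nontrivial[where \<theta> = \<theta> and c = c and n = 1])
    show "tensor_relations R (res_module R N n) N \<subseteq> carrier (free_Abelian_group (carrier (res_module R N n) \<times> carrier N))" for n
      by (rule tensor_relations_closed)
    show "frag_eval \<theta> r = 0" if "r \<in> tensor_relations R (res_module R N 2) N" for r
      using that
    proof (cases rule: tensor_relations_cases)
      case (1 m m' c)
      then show ?thesis
        unfolding 1(3) frag_eval_diff
        by (simp add: \<theta>_def add2 lam_add[OF b2(2) b2(2)] \<chi>(1) distrib_right)
    next
      case (2 m c c')
      then show ?thesis
        unfolding 2(2) frag_eval_diff by (simp add: \<theta>_def distrib_left)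
    next
      case (3 t m c)
      then show ?thesis
        unfolding 3(3) frag_eval_diff
        by (simp add: \<theta>_def smult2 lam_smult[OF b2(2)] \<chi>(2) b2(1))
    qed
    show "\<theta> (res_boundary R m, n) = 0" if "m \<in> carrier (res_module R N 3)" for m n
    proof -
      have "m \<in> FR (basis (Suc (Suc 1)))" using that by (simp add: res_module_carrier numeral_3_eq_3)
      from boundary_boundary[OF this] show ?thesis by (simp add: \<theta>_def lam_zero \<chi>_zero)
    qed
    show "frag_extend (\<lambda>(m, n). frag_of (res_boundary R m, n)) r \<in> tensor_null R (res_module R N 1) N"
      if "r \<in> tensor_relations R (res_module R N 2) N" for r
    proof -
      let ?M = "res_module R N 1"
      let ?b = "res_boundary R"
      have "frag_extend (\<lambda>(m, n). frag_of (?b m, n)) r \<in> tensor_relations R ?M N"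
        using that
      proof (cases rule: tensor_relations_cases)
        case (1 m m' c)
        then have "frag_extend (\<lambda>(m, n). frag_of (?b m, n)) r
            = frag_of (?b m \<oplus>\<^bsub>?M\<^esub> ?b m', c) - frag_of (?b m, c) - frag_of (?b m', c)"
          by (simp add: frag_extend_diff add2 res_module_def free_rmodule_simps)
        then show ?thesis
          unfolding tensor_relations_def res_module_carrier N(1) using b2(2)[OF 1(1)] b2(2)[OF 1(2)] by blast
      next
        case (2 m c c')
        then have "frag_extend (\<lambda>(m, n). frag_of (?b m, n)) r
            = frag_of (?b m, c \<oplus>\<^bsub>N\<^esub> c') - frag_of (?b m, c) - frag_of (?b m, c')"
          by (simp add: frag_extend_diff N)
        then show ?thesis
          unfolding tensor_relations_def res_module_carrier N(1) using b2(2)[OF 2(1)] by blast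
      next
        case (3 t m c)
        then have "frag_extend (\<lambda>(m, n). frag_of (?b m, n)) r
            = frag_of (t \<odot>\<^bsub>?M\<^esub> ?b m, c) - frag_of (?b m, t \<odot>\<^bsub>N\<^esub> c)"
          by (simp add: frag_extend_diff smult2 res_module_def free_rmodule_simps N)
        then show ?thesis
          unfolding tensor_relations_def res_module_carrier N(1) using b2(2)[OF 3(2)] 3(1) by blast
      qed
      then show ?thesis by (rule tensor_null_closed(2)[OF tensor_relations_closed])
    qed
    show "c \<in> carrier (res_module R N 2)" using cF by (simp add: res_module_carrier)
    show "frag_of (res_boundary R c, 1) \<in> tensor_null R (res_module R N 1) N" using null by (simp add: bc)
    show "\<theta> (c, 1) \<noteq> 0" using nz by (simp add: \<theta>_def bc lamq)
  qed (simp add: N)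
qed

end


section \<open>Functionals on the universal enveloping algebra\<close>

lemma free_assoc_simps:
  "f \<in> carrier (free_assoc S) \<longleftrightarrow> finite {w. f w \<noteq> 0} \<and> {w. f w \<noteq> 0} \<subseteq> lists S"
  "f \<otimes>\<^bsub>free_assoc S\<^esub> g = (\<lambda>w. \<Sum>i\<le>length w. f (take i w) * g (drop i w))"
  "\<one>\<^bsub>free_assoc S\<^esub> = (\<lambda>w. if w = [] then 1 else 0)"
  "\<zero>\<^bsub>free_assoc S\<^esub> = (\<lambda>w. 0)"
  "f \<oplus>\<^bsub>free_assoc S\<^esub> g = (\<lambda>w. f w + g w)"
  by (auto simp: free_assoc_def lists_eq_set)

definition word_sum :: "('x list \<Rightarrow> 'k::comm_ring_1) \<Rightarrow> ('x list \<Rightarrow> 'k) \<Rightarrow> 'k" where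
  "word_sum e f = (\<Sum>w\<in>{w. f w \<noteq> 0}. f w * e w)"

lemma word_sum_superset:
  assumes "finite F" "{w. f w \<noteq> 0} \<subseteq> F"
  shows "word_sum e f = (\<Sum>w\<in>F. f w * e w)"
  unfolding word_sum_def by (rule sum.mono_neutral_left) (use assms in auto)

lemma word_sum_add:
  assumes "finite {w. f w \<noteq> 0}" "finite {w. g w \<noteq> 0}"
  shows "word_sum e (\<lambda>w. f w + g w) = word_sum e f + word_sum e g"
proof -
  let ?F = "{w. f w \<noteq> 0} \<union> {w. g w \<noteq> 0}"
  have F: "finite ?F" using assms by simp
  have "word_sum e (\<lambda>w. f w + g w) = (\<Sum>w\<in>?F. (f w + g w) * e w)"
    using F by (intro word_sum_superset) auto
  also have "\<dots> = word_sum e f + word_sum e g"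
    using word_sum_superset[OF F, of f e] word_sum_superset[OF F, of g e] by (simp add: distrib_right sum.distrib)
  finally show ?thesis .
qed

lemma word_sum_diff:
  assumes "finite {w. f w \<noteq> 0}" "finite {w. g w \<noteq> 0}"
  shows "word_sum e (\<lambda>w. f w - g w) = word_sum e f - word_sum e g"
proof -
  let ?F = "{w. f w \<noteq> 0} \<union> {w. g w \<noteq> 0}"
  have F: "finite ?F" using assms by simp
  have "word_sum e (\<lambda>w. f w - g w) = (\<Sum>w\<in>?F. (f w - g w) * e w)"
    using F by (intro word_sum_superset) auto
  also have "\<dots> = word_sum e f - word_sum e g"
    using word_sum_superset[OF F, of f e] word_sum_superset[OF F, of g e] by (simp add: left_diff_distrib sum_subtractf)
  finally show ?thesis .
qed

lemma word_sum_scaled_word: "word_sum e (\<lambda>w. c * word u w) = c * e u"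
proof -
  have "{w. c * word u w \<noteq> 0} \<subseteq> {u}" by (auto simp: word_def)
  from word_sum_superset[OF _ this, of e] show ?thesis by (simp add: word_def)
qed

lemma word_sum_word: "word_sum e (word u) = e u"
  using word_sum_scaled_word[of e 1 u] by simp

lemma finite_word_support [simp]: "finite {w. word u w \<noteq> (0 :: 'k::comm_ring_1)}"
  by (rule finite_subset[of _ "{u}"]) (auto simp: word_def)

lemma finite_scaled_word_support [simp]: "finite {w. c * word u w \<noteq> (0 :: 'k::comm_ring_1)}"
  by (rule finite_subset[of _ "{u}"]) (auto simp: word_def)

lemma word_sum_relation:
  fixes e :: "'x list \<Rightarrow> 'k::comm_ring_1"
  shows "word_sum e (\<lambda>w. word u w - word v w - word t w) = e u - e v - e t"
  "word_sum e (\<lambda>w. word u w - c * word v w) = e u - c * e v"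
proof -
  have "{w. word u w - word v w \<noteq> (0 :: 'k)} \<subseteq> {u, v}" by (auto simp: word_def)
  then have "finite {w. word u w - word v w \<noteq> (0 :: 'k)}" by (rule finite_subset) simp
  then show "word_sum e (\<lambda>w. word u w - word v w - word t w) = e u - e v - e t"
    by (subst word_sum_diff) (simp_all add: word_sum_diff word_sum_word)
  show "word_sum e (\<lambda>w. word u w - c * word v w) = e u - c * e v"
    by (simp add: word_sum_diff word_sum_word word_sum_scaled_word)
qed

lemma word_product_support:
  fixes f g :: "'x list \<Rightarrow> 'k::comm_ring_1"
  shows "{w. (\<Sum>i\<le>length w. f (take i w) * g (drop i w)) \<noteq> 0} \<subseteq>
    (\<lambda>(u, v). u @ v) ` ({w. f w \<noteq> 0} \<times> {w. g w \<noteq> 0})"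
proof
  fix w assume "w \<in> {w. (\<Sum>i\<le>length w. f (take i w) * g (drop i w)) \<noteq> 0}"
  then obtain i where "i \<le> length w" "f (take i w) * g (drop i w) \<noteq> 0"
    by (auto dest: sum.not_neutral_contains_not_neutral)
  then show "w \<in> (\<lambda>(u, v). u @ v) ` ({w. f w \<noteq> 0} \<times> {w. g w \<noteq> 0})"
    by (intro image_eqI[of _ _ "(take i w, drop i w)"]) auto
qed

lemma word_sum_product:
  fixes f g :: "'x list \<Rightarrow> 'k::comm_ring_1"
  assumes f: "finite {w. f w \<noteq> 0}" and g: "finite {w. g w \<noteq> 0}"
  shows "word_sum e (\<lambda>w. \<Sum>i\<le>length w. f (take i w) * g (drop i w)) =
    (\<Sum>u\<in>{w. f w \<noteq> 0}. \<Sum>v\<in>{w. g w \<noteq> 0}. f u * g v * e (u @ v))"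
proof -
  let ?P = "{w. f w \<noteq> 0} \<times> {w. g w \<noteq> 0}"
  let ?W = "(\<lambda>(u, v). u @ v) ` ?P"
  have W: "finite ?W" using f g by simp
  have "word_sum e (\<lambda>w. \<Sum>i\<le>length w. f (take i w) * g (drop i w))
      = (\<Sum>w\<in>?W. \<Sum>i\<le>length w. f (take i w) * g (drop i w) * e w)"
    using word_sum_superset[OF W word_product_support] by (simp add: sum_distrib_right)
  also have "\<dots> = (\<Sum>(w, i)\<in>(SIGMA w:?W. {..length w}). f (take i w) * g (drop i w) * e w)"
    using W by (subst sum.Sigma) auto
  also have "\<dots> = (\<Sum>(w, i)\<in>(\<lambda>(u, v). (u @ v, length u)) ` ?P. f (take i w) * g (drop i w) * e w)"
    (is "_ = sum _ ?T")
  proof (rule sum.mono_neutral_right)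
    show "finite (SIGMA w:?W. {..length w})" using W by auto
    show "?T \<subseteq> (SIGMA w:?W. {..length w})" by auto
    show "\<forall>p\<in>(SIGMA w:?W. {..length w}) - ?T. (case p of (w, i) \<Rightarrow> f (take i w) * g (drop i w) * e w) = 0"
    proof
      fix p assume p: "p \<in> (SIGMA w:?W. {..length w}) - ?T"
      obtain w i where wi: "p = (w, i)" by (cases p)
      have "(w, i) \<in> ?T" if "f (take i w) \<noteq> 0" "g (drop i w) \<noteq> 0"
        using that p unfolding wi by (intro image_eqI[of _ _ "(take i w, drop i w)"]) auto
      then have "f (take i w) = 0 \<or> g (drop i w) = 0" using p unfolding wi by blast
      then show "(case p of (w, i) \<Rightarrow> f (take i w) * g (drop i w) * e w) = 0"
        unfolding wi by auto
    qed
  qed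
  also have "\<dots> = (\<Sum>(u, v)\<in>?P. f u * g v * e (u @ v))"
  proof -
    have "inj_on (\<lambda>(u, v). (u @ v, length u)) ?P" by (auto simp: inj_on_def)
    then show ?thesis by (subst sum.reindex) (auto intro!: sum.cong)
  qed
  also have "\<dots> = (\<Sum>u\<in>{w. f w \<noteq> 0}. \<Sum>v\<in>{w. g w \<noteq> 0}. f u * g v * e (u @ v))"
    using f g by (subst sum.Sigma) auto
  finally show ?thesis .
qed

lemma word_product_assoc:
  fixes f g h :: "'x list \<Rightarrow> 'k::comm_ring_1"
  shows "(\<Sum>i\<le>length w. (\<Sum>j\<le>length (take i w). f (take j (take i w)) * g (drop j (take i w))) * h (drop i w)) =
    (\<Sum>j\<le>length w. f (take j w) * (\<Sum>k\<le>length (drop j w). g (take k (drop j w)) * h (drop k (drop j w))))"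
proof -
  let ?n = "length w"
  have "(\<Sum>i\<le>?n. (\<Sum>j\<le>length (take i w). f (take j (take i w)) * g (drop j (take i w))) * h (drop i w))
      = (\<Sum>i\<le>?n. \<Sum>j\<le>i. f (take j w) * g (drop j (take i w)) * h (drop i w))"
    by (intro sum.cong refl) (auto simp: sum_distrib_right min_def intro!: sum.cong)
  also have "\<dots> = (\<Sum>(i, j)\<in>(SIGMA i:{..?n}. {..i}). f (take j w) * g (drop j (take i w)) * h (drop i w))"
    by (subst sum.Sigma) auto
  also have "\<dots> = (\<Sum>(j, k)\<in>(SIGMA j:{..?n}. {..?n - j}). f (take j w) * g (take k (drop j w)) * h (drop (j + k) w))"
    by (rule sum.reindex_bij_witness[of _ "\<lambda>(j, k). (j + k, j)" "\<lambda>(i, j). (j, i - j)"])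
      (auto simp: drop_take)
  also have "\<dots> = (\<Sum>j\<le>?n. \<Sum>k\<le>?n - j. f (take j w) * g (take k (drop j w)) * h (drop (j + k) w))"
    by (subst sum.Sigma) auto
  also have "\<dots> = (\<Sum>j\<le>?n. f (take j w) * (\<Sum>k\<le>length (drop j w). g (take k (drop j w)) * h (drop k (drop j w))))"
    by (simp add: sum_distrib_left mult.assoc add.commute)
  finally show ?thesis .
qed

lemma ring_free_assoc: "ring (free_assoc S :: ('x list \<Rightarrow> 'k::comm_ring_1) ring)"
proof (rule ringI)
  let ?A = "free_assoc S :: ('x list \<Rightarrow> 'k) ring"
  have add: "(\<lambda>w. f w + g w) \<in> carrier ?A" if "f \<in> carrier ?A" "g \<in> carrier ?A" for f g
  proof -
    have "{w. f w + g w \<noteq> 0} \<subseteq> {w. f w \<noteq> 0} \<union> {w. g w \<noteq> 0}" by auto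
    then show ?thesis using that unfolding free_assoc_simps by (blast intro: finite_subset)
  qed
  show "abelian_group ?A"
  proof (rule abelian_groupI)
    show "\<exists>y\<in>carrier ?A. y \<oplus>\<^bsub>?A\<^esub> x = \<zero>\<^bsub>?A\<^esub>" if "x \<in> carrier ?A" for x
      using that by (intro bexI[of _ "\<lambda>w. - x w"]) (simp_all add: free_assoc_simps)
  qed (use add in \<open>simp_all add: free_assoc_simps(5) algebra_simps\<close>, simp_all add: free_assoc_simps)
  show "Group.monoid ?A"
  proof (rule monoidI)
    show "x \<otimes>\<^bsub>?A\<^esub> y \<in> carrier ?A" if "x \<in> carrier ?A" "y \<in> carrier ?A" for x y
    proof -
      have "finite ((\<lambda>(u, v). u @ v) ` ({w. x w \<noteq> 0} \<times> {w. y w \<noteq> 0}))"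
        using that by (simp add: free_assoc_simps)
      moreover have "(\<lambda>(u, v). u @ v) ` ({w. x w \<noteq> 0} \<times> {w. y w \<noteq> 0}) \<subseteq> lists S"
      proof (rule image_subsetI)
        fix p assume "p \<in> {w. x w \<noteq> 0} \<times> {w. y w \<noteq> 0}"
        then obtain u v where p: "p = (u, v)" "x u \<noteq> 0" "y v \<noteq> 0" by blast
        then have "u \<in> lists S" "v \<in> lists S" using that by (auto simp: free_assoc_simps)
        then show "(case p of (u, v) \<Rightarrow> u @ v) \<in> lists S" by (simp add: p(1))
      qed
      ultimately show ?thesis
        unfolding free_assoc_simps using word_product_support[of x y] by (blast intro: finite_subset)
    qed
    show "\<one>\<^bsub>?A\<^esub> \<in> carrier ?A" by (auto simp: free_assoc_simps)
    show "x \<otimes>\<^bsub>?A\<^esub> y \<otimes>\<^bsub>?A\<^esub> z = x \<otimes>\<^bsub>?A\<^esub> (y \<otimes>\<^bsub>?A\<^esub> z)" for x y z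
      unfolding free_assoc_simps by (rule ext) (rule word_product_assoc)
    show "\<one>\<^bsub>?A\<^esub> \<otimes>\<^bsub>?A\<^esub> x = x" for x
    proof
      fix w
      have "(\<one>\<^bsub>?A\<^esub> \<otimes>\<^bsub>?A\<^esub> x) w = (\<Sum>i\<le>length w. if i = 0 then x w else 0)"
        unfolding free_assoc_simps by (intro sum.cong refl) auto
      then show "(\<one>\<^bsub>?A\<^esub> \<otimes>\<^bsub>?A\<^esub> x) w = x w" by simp
    qed
    show "x \<otimes>\<^bsub>?A\<^esub> \<one>\<^bsub>?A\<^esub> = x" for x
    proof
      fix w
      have "(x \<otimes>\<^bsub>?A\<^esub> \<one>\<^bsub>?A\<^esub>) w = (\<Sum>i\<le>length w. if i = length w then x w else 0)"
        unfolding free_assoc_simps by (intro sum.cong refl) auto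
      then show "(x \<otimes>\<^bsub>?A\<^esub> \<one>\<^bsub>?A\<^esub>) w = x w" by simp
    qed
  qed
qed (auto simp: free_assoc_simps distrib_left distrib_right sum.distrib)

text \<open>
  The functions on the integers are an \<open>L\<close>-module \<open>V\<close> where \<open>x\<close> acts by \<open>wt x\<close> times the shift by one,
  and \<open>\<delta>\<close> is a derivation with values in \<open>V\<close> modulo the functions supported in positive degrees.
  This is why its properties are postulated in degrees \<open>m \<le> 0\<close>.
\<close>

locale env_functional =
  lie_algebra L for L :: "('k::comm_ring_1, 'a) module" (structure) +
  fixes wt :: "'a \<Rightarrow> 'k" and \<delta> :: "'a \<Rightarrow> int \<Rightarrow> 'k"
  assumes wt: "\<And>x y. x \<in> carrier L \<Longrightarrow> y \<in> carrier L \<Longrightarrow> wt (x \<oplus> y) = wt x + wt y"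
      "\<And>c x. x \<in> carrier L \<Longrightarrow> wt (c \<odot> x) = c * wt x"
      "\<And>x y. x \<in> carrier L \<Longrightarrow> y \<in> carrier L \<Longrightarrow> wt (x \<otimes> y) = 0"
    and \<delta>: "\<And>x y m. x \<in> carrier L \<Longrightarrow> y \<in> carrier L \<Longrightarrow> m \<le> 0 \<Longrightarrow> \<delta> (x \<oplus> y) m = \<delta> x m + \<delta> y m"
      "\<And>c x m. x \<in> carrier L \<Longrightarrow> m \<le> 0 \<Longrightarrow> \<delta> (c \<odot> x) m = c * \<delta> x m"
      "\<And>x y m. x \<in> carrier L \<Longrightarrow> y \<in> carrier L \<Longrightarrow> m \<le> 0 \<Longrightarrow>
        \<delta> (x \<otimes> y) m = wt y * \<delta> x (m - 1) - wt x * \<delta> y (m - 1)"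
begin

abbreviation FA :: "('a list \<Rightarrow> 'k) ring" where "FA \<equiv> free_assoc (carrier L)"

abbreviation J :: "('a list \<Rightarrow> 'k) set" where "J \<equiv> Idl\<^bsub>FA\<^esub> (env_relations L)"

definition word_wt :: "'a list \<Rightarrow> 'k" where
  "word_wt w = prod_list (map wt w)"

text \<open>The value in degree \<open>m\<close> of \<open>v\<close> acted on by the letters of \<open>w\<close>.\<close>

definition word_act :: "(int \<Rightarrow> 'k) \<Rightarrow> int \<Rightarrow> 'a list \<Rightarrow> 'k" where
  "word_act v m w = word_wt w * v (m - int (length w))"

text \<open>
  The crossed homomorphism that extends \<open>\<delta>\<close>: a word is sent to \<open>\<delta>\<close> of its first letter, acted on by
  the others.
\<close>

definition word_\<Phi> :: "int \<Rightarrow> 'a list \<Rightarrow> 'k" where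
  "word_\<Phi> m w = (case w of [] \<Rightarrow> 0 | x # u \<Rightarrow> word_act (\<delta> x) m u)"

definition actF :: "(int \<Rightarrow> 'k) \<Rightarrow> ('a list \<Rightarrow> 'k) \<Rightarrow> int \<Rightarrow> 'k" where
  "actF v f m = word_sum (word_act v m) f"

definition \<Phi>F :: "('a list \<Rightarrow> 'k) \<Rightarrow> int \<Rightarrow> 'k" where
  "\<Phi>F f m = word_sum (word_\<Phi> m) f"

lemma FA_finite: "f \<in> carrier FA \<Longrightarrow> finite {w. f w \<noteq> 0}"
  by (simp add: free_assoc_simps)

lemma word_FA: "set w \<subseteq> carrier L \<Longrightarrow> word w \<in> carrier FA"
  unfolding free_assoc_simps by (auto simp: word_def)

lemma word_act_append: "word_act v m (u @ w) = word_wt w * word_act v (m - int (length w)) u"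
  by (simp add: word_act_def word_wt_def algebra_simps)

lemma word_\<Phi>_append:
  "word_\<Phi> m (u @ w) = word_wt w * word_\<Phi> (m - int (length w)) u + (if u = [] then word_\<Phi> m w else 0)"
  by (cases u) (simp_all add: word_\<Phi>_def word_act_append)

lemma actF_mult:
  assumes "f \<in> carrier FA" "g \<in> carrier FA"
  shows "actF v (f \<otimes>\<^bsub>FA\<^esub> g) = actF (actF v f) g"
proof
  fix m
  have "actF v (f \<otimes>\<^bsub>FA\<^esub> g) m = (\<Sum>u\<in>{w. f w \<noteq> 0}. \<Sum>w\<in>{w. g w \<noteq> 0}. f u * g w * word_act v m (u @ w))"
    unfolding actF_def free_assoc_simps by (rule word_sum_product) (use assms FA_finite in auto)
  also have "\<dots> = (\<Sum>w\<in>{w. g w \<noteq> 0}. \<Sum>u\<in>{w. f w \<noteq> 0}. f u * g w * word_act v m (u @ w))"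
    by (rule sum.swap)
  also have "\<dots> = (\<Sum>w\<in>{w. g w \<noteq> 0}. g w * (word_wt w * (\<Sum>u\<in>{w. f w \<noteq> 0}. f u * word_act v (m - int (length w)) u)))"
    by (simp add: sum_distrib_left word_act_append algebra_simps)
  also have "\<dots> = actF (actF v f) g m"
    by (simp add: actF_def word_sum_def[of _ g] word_act_def[of _ m] word_sum_def[of _ f])
  finally show "actF v (f \<otimes>\<^bsub>FA\<^esub> g) m = actF (actF v f) g m" .
qed

lemma \<Phi>F_mult:
  assumes "f \<in> carrier FA" "g \<in> carrier FA"
  shows "\<Phi>F (f \<otimes>\<^bsub>FA\<^esub> g) m = actF (\<Phi>F f) g m + f [] * \<Phi>F g m"
proof -
  have "\<Phi>F (f \<otimes>\<^bsub>FA\<^esub> g) m = (\<Sum>u\<in>{w. f w \<noteq> 0}. \<Sum>w\<in>{w. g w \<noteq> 0}. f u * g w * word_\<Phi> m (u @ w))"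
    unfolding \<Phi>F_def free_assoc_simps by (rule word_sum_product) (use assms FA_finite in auto)
  also have "\<dots> = (\<Sum>u\<in>{w. f w \<noteq> 0}. \<Sum>w\<in>{w. g w \<noteq> 0}. f u * g w * (word_wt w * word_\<Phi> (m - int (length w)) u))
      + (\<Sum>u\<in>{w. f w \<noteq> 0}. \<Sum>w\<in>{w. g w \<noteq> 0}. f u * g w * (if u = [] then word_\<Phi> m w else 0))"
    by (simp add: word_\<Phi>_append distrib_left sum.distrib)
  also have "(\<Sum>u\<in>{w. f w \<noteq> 0}. \<Sum>w\<in>{w. g w \<noteq> 0}. f u * g w * (word_wt w * word_\<Phi> (m - int (length w)) u))
      = (\<Sum>w\<in>{w. g w \<noteq> 0}. \<Sum>u\<in>{w. f w \<noteq> 0}. f u * g w * (word_wt w * word_\<Phi> (m - int (length w)) u))"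
    by (rule sum.swap)
  also have "\<dots> = (\<Sum>w\<in>{w. g w \<noteq> 0}. g w * (word_wt w * (\<Sum>u\<in>{w. f w \<noteq> 0}. f u * word_\<Phi> (m - int (length w)) u)))"
    by (simp add: sum_distrib_left algebra_simps)
  also have "\<dots> = actF (\<Phi>F f) g m"
    by (simp add: actF_def \<Phi>F_def word_sum_def[of _ g] word_act_def word_sum_def[of _ f])
  also have "(\<Sum>u\<in>{w. f w \<noteq> 0}. \<Sum>w\<in>{w. g w \<noteq> 0}. f u * g w * (if u = [] then word_\<Phi> m w else 0))
      = (\<Sum>u\<in>{w. f w \<noteq> 0}. if u = [] then f [] * \<Phi>F g m else 0)"
    by (intro sum.cong refl) (simp add: \<Phi>F_def word_sum_def sum_distrib_left mult.assoc)
  also have "\<dots> = f [] * \<Phi>F g m"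
    using FA_finite[OF assms(1)] by (simp add: sum.delta')
  finally show ?thesis .
qed

lemma actF_add: "f \<in> carrier FA \<Longrightarrow> g \<in> carrier FA \<Longrightarrow> actF v (f \<oplus>\<^bsub>FA\<^esub> g) m = actF v f m + actF v g m"
  unfolding actF_def free_assoc_simps(5) by (rule word_sum_add) (simp_all add: FA_finite)

lemma \<Phi>F_add: "f \<in> carrier FA \<Longrightarrow> g \<in> carrier FA \<Longrightarrow> \<Phi>F (f \<oplus>\<^bsub>FA\<^esub> g) m = \<Phi>F f m + \<Phi>F g m"
  unfolding \<Phi>F_def free_assoc_simps(5) by (rule word_sum_add) (simp_all add: FA_finite)

lemma actF_add_left: "actF (v + w) f m = actF v f m + actF w f m"
  by (simp add: actF_def word_sum_def word_act_def algebra_simps sum.distrib)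

lemma actF_vanish: "(\<And>m. m \<le> 0 \<Longrightarrow> v m = 0) \<Longrightarrow> m \<le> 0 \<Longrightarrow> actF v f m = 0"
  by (simp add: actF_def word_sum_def word_act_def)

text \<open>
  Letters only shift upwards, so what \<open>v\<close> has in degree 1, its lowest, is reached from the empty word
  alone.
\<close>

lemma actF_lowest:
  assumes "\<And>m. m \<le> 0 \<Longrightarrow> v m = 0" "f \<in> carrier FA"
  shows "actF v f 1 = v 1 * f []"
proof -
  have "actF v f 1 = (\<Sum>w\<in>{w. f w \<noteq> 0}. if w = [] then v 1 * f [] else 0)"
    unfolding actF_def word_sum_def
  proof (intro sum.cong refl)
    fix w show "f w * word_act v 1 w = (if w = [] then v 1 * f [] else 0)"
      using assms(1)[of "1 - int (length w)"] by (cases w) (simp_all add: word_act_def word_wt_def)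
  qed
  then show ?thesis using FA_finite[OF assms(2)] by (auto simp: sum.delta')
qed

sublocale FA: ring FA
  by (rule ring_free_assoc)

lemma env_relations_closed: "env_relations L \<subseteq> carrier FA"
proof -
  have fin: "finite {w. h w \<noteq> 0} \<Longrightarrow> {w. h w \<noteq> 0} \<subseteq> lists (carrier L) \<Longrightarrow> h \<in> carrier FA" for h
    by (simp add: free_assoc_simps)
  have sub: "h \<in> carrier FA" if "{w. h w \<noteq> 0} \<subseteq> B" "finite B" "B \<subseteq> lists (carrier L)" for h B
    using that finite_subset by (intro fin) blast+
  have 1: "(\<lambda>w. word [x \<oplus> y] w - word [x] w - word [y] w) \<in> carrier FA" if "x \<in> carrier L" "y \<in> carrier L" for x y
    by (rule sub[of _ "{[x \<oplus> y], [x], [y]}"]) (use that in \<open>auto simp: word_def\<close>)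
  have 2: "(\<lambda>w. word [c \<odot> x] w - c * word [x] w) \<in> carrier FA" if "x \<in> carrier L" for x c
    by (rule sub[of _ "{[c \<odot> x], [x]}"]) (use that in \<open>auto simp: word_def\<close>)
  have 3: "(\<lambda>w. word [x, y] w - word [y, x] w - word [x \<otimes> y] w) \<in> carrier FA" if "x \<in> carrier L" "y \<in> carrier L" for x y
  proof (rule sub[of _ "{[x, y], [y, x], [x \<otimes> y]}"])
    show "{w. word [x, y] w - word [y, x] w - word [x \<otimes> y] w \<noteq> (0::'k)} \<subseteq> {[x, y], [y, x], [x \<otimes> y]}"
      unfolding word_def by (rule subsetI, rule ccontr) simp
  qed (use that in simp_all)
  show ?thesis unfolding env_relations_def using 1 2 3 by blast
qed

lemma J_ideal: "ideal J FA"
  by (rule FA.genideal_ideal[OF env_relations_closed])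

text \<open>
  The product rules \<open>actF_mult\<close> and \<open>\<Phi>F_mult\<close> make the common kernel an ideal, although \<open>\<Phi>F\<close> is not
  multiplicative: its kernel is compatible with products only in the presence of the other two.
\<close>

lemma ideal_of_functionals:
  "ideal {f \<in> carrier FA. f [] = 0 \<and> (\<forall>v m. actF v f m = 0) \<and> (\<forall>m\<le>0. \<Phi>F f m = 0)} FA" (is "ideal ?K FA")
proof (rule idealI)
  show "ring FA" by (rule FA.ring_axioms)
  have act0: "actF (\<lambda>m. 0) f m = 0" for f m by (simp add: actF_def word_sum_def word_act_def)
  show "subgroup ?K (add_monoid FA)"
  proof (rule FA.add.subgroupI)
    show "?K \<noteq> {}"
      by (rule ex_in_conv[THEN iffD1], rule exI[of _ "\<lambda>w. 0"])
        (simp add: free_assoc_simps actF_def \<Phi>F_def word_sum_def)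
    fix f assume f: "f \<in> ?K"
    then have m: "\<ominus>\<^bsub>FA\<^esub> f \<in> carrier FA" and s: "f \<oplus>\<^bsub>FA\<^esub> \<ominus>\<^bsub>FA\<^esub> f = \<zero>\<^bsub>FA\<^esub>" by (auto simp: FA.r_neg)
    have z: "actF v \<zero>\<^bsub>FA\<^esub> m = 0" "\<Phi>F \<zero>\<^bsub>FA\<^esub> m = 0" "\<zero>\<^bsub>FA\<^esub> [] = 0" for v m
      by (simp_all add: free_assoc_simps actF_def \<Phi>F_def word_sum_def)
    have "f [] + (\<ominus>\<^bsub>FA\<^esub> f) [] = 0"
      using s z(3) by (metis (no_types, lifting) free_assoc_simps(5))
    then have "(\<ominus>\<^bsub>FA\<^esub> f) [] = 0" using f by simp
    moreover have "actF v (\<ominus>\<^bsub>FA\<^esub> f) m = 0" for v m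
      using f m actF_add[of f "\<ominus>\<^bsub>FA\<^esub> f" v m] s z(1) by simp
    moreover have "\<Phi>F (\<ominus>\<^bsub>FA\<^esub> f) n = 0" if "n \<le> 0" for n
      using f m \<Phi>F_add[of f "\<ominus>\<^bsub>FA\<^esub> f" n] s z(2) that by simp
    ultimately show "\<ominus>\<^bsub>FA\<^esub> f \<in> ?K" using m by simp
  next
    fix f g assume "f \<in> ?K" "g \<in> ?K"
    then show "f \<oplus>\<^bsub>FA\<^esub> g \<in> ?K"
      using FA.a_closed[of f g] by (simp add: actF_add \<Phi>F_add) (simp add: free_assoc_simps(5))
  qed auto
  fix f g assume f: "f \<in> ?K" and g: "g \<in> carrier FA"
  have e: "(f \<otimes>\<^bsub>FA\<^esub> g) [] = f [] * g []" "(g \<otimes>\<^bsub>FA\<^esub> f) [] = g [] * f []" by (simp_all add: free_assoc_simps)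
  have av: "actF v f = (\<lambda>m. 0)" for v using f by auto
  have \<Phi>: "actF (\<Phi>F f) g m = 0" if "m \<le> 0" for m using f that by (intro actF_vanish) auto
  show "g \<otimes>\<^bsub>FA\<^esub> f \<in> ?K"
    using f g FA.m_closed[of g f] by (simp add: e actF_mult \<Phi>F_mult av)
  show "f \<otimes>\<^bsub>FA\<^esub> g \<in> ?K"
    using f g FA.m_closed[of f g] by (simp add: e actF_mult \<Phi>F_mult av act0 \<Phi>)
qed

lemma J_vanish:
  assumes "f \<in> J"
  shows "f \<in> carrier FA" "f [] = 0" "actF v f m = 0" "m \<le> 0 \<Longrightarrow> \<Phi>F f m = 0"
proof -
  let ?K = "{f \<in> carrier FA. f [] = 0 \<and> (\<forall>v m. actF v f m = 0) \<and> (\<forall>m\<le>0. \<Phi>F f m = 0)}"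
  have "env_relations L \<subseteq> ?K"
  proof
    fix f assume f: "f \<in> env_relations L"
    have fc: "f \<in> carrier FA" using f env_relations_closed by blast
    from f consider (add) x y where "x \<in> carrier L" "y \<in> carrier L"
        "f = (\<lambda>w. word [x \<oplus> y] w - word [x] w - word [y] w)"
      | (smult) c x where "x \<in> carrier L" "f = (\<lambda>w. word [c \<odot> x] w - c * word [x] w)"
      | (comm) x y where "x \<in> carrier L" "y \<in> carrier L"
        "f = (\<lambda>w. word [x, y] w - word [y, x] w - word [x \<otimes> y] w)"
      unfolding env_relations_def by blast
    then have "f [] = 0 \<and> (\<forall>v m. actF v f m = 0) \<and> (\<forall>m\<le>0. \<Phi>F f m = 0)"
    proof cases
      case add
      then show ?thesis
        unfolding add(3) actF_def \<Phi>F_def word_sum_relation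
        by (simp add: word_act_def word_\<Phi>_def word_wt_def wt \<delta> algebra_simps word_def)
    next
      case smult
      then show ?thesis
        unfolding smult(2) actF_def \<Phi>F_def word_sum_relation
        by (simp add: word_act_def word_\<Phi>_def word_wt_def wt \<delta> algebra_simps word_def)
    next
      case comm
      then show ?thesis
        unfolding comm(3) actF_def \<Phi>F_def word_sum_relation
        by (simp add: word_act_def word_\<Phi>_def word_wt_def wt \<delta> algebra_simps word_def)
    qed
    then show "f \<in> ?K" using fc by blast
  qed
  then have "J \<subseteq> ?K"
    using ideal_of_functionals unfolding genideal_def by blast
  then show "f \<in> carrier FA" "f [] = 0" "actF v f m = 0" "m \<le> 0 \<Longrightarrow> \<Phi>F f m = 0" using assms by blast+
qed

abbreviation U :: "('a list \<Rightarrow> 'k) set ring" where "U \<equiv> env_algebra L"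

definition cls :: "('a list \<Rightarrow> 'k) \<Rightarrow> ('a list \<Rightarrow> 'k) set" where
  "cls f = J +>\<^bsub>FA\<^esub> f"

definition rep :: "('a list \<Rightarrow> 'k) set \<Rightarrow> 'a list \<Rightarrow> 'k" where
  "rep u = (SOME f. f \<in> u)"

interpretation J: ideal J FA
  by (rule J_ideal)

lemma ring_U: "ring U"
  unfolding env_algebra_def by (rule J.quotient_is_ring)

lemma U_simps:
  "carrier U = cls ` carrier FA"
  "f \<in> carrier FA \<Longrightarrow> g \<in> carrier FA \<Longrightarrow> cls f \<oplus>\<^bsub>U\<^esub> cls g = cls (f \<oplus>\<^bsub>FA\<^esub> g)"
  "f \<in> carrier FA \<Longrightarrow> g \<in> carrier FA \<Longrightarrow> cls f \<otimes>\<^bsub>U\<^esub> cls g = cls (f \<otimes>\<^bsub>FA\<^esub> g)"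
  "\<one>\<^bsub>U\<^esub> = cls \<one>\<^bsub>FA\<^esub>"
  "\<zero>\<^bsub>U\<^esub> = J"
  unfolding env_algebra_def cls_def
  by (auto simp: FactRing_def A_RCOSETS_def' J.a_rcos_sum J.rcoset_mult_add)

lemma cls_mem:
  assumes f: "f \<in> carrier FA" and g: "g \<in> cls f"
  obtains j where "j \<in> J" "g = j \<oplus>\<^bsub>FA\<^esub> f" "g \<in> carrier FA"
proof -
  obtain j where "j \<in> J" "g = j \<oplus>\<^bsub>FA\<^esub> f"
    using g unfolding cls_def a_r_coset_def' by blast
  then show ?thesis using that J_vanish(1)[of j] f by auto
qed

lemma cls_functionals:
  assumes f: "f \<in> carrier FA" and g: "g \<in> cls f"
  shows "g \<in> carrier FA" "g [] = f []" "actF v g m = actF v f m" "m \<le> 0 \<Longrightarrow> \<Phi>F g m = \<Phi>F f m"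
proof -
  obtain j where j: "j \<in> J" "g = j \<oplus>\<^bsub>FA\<^esub> f" "g \<in> carrier FA" using cls_mem[OF f g] by blast
  note jv = J_vanish[OF j(1)]
  show "g \<in> carrier FA" by fact
  show "g [] = f []" using jv(2) by (simp add: j(2) free_assoc_simps(5))
  show "actF v g m = actF v f m" unfolding j(2) using jv f by (simp add: actF_add)
  show "m \<le> 0 \<Longrightarrow> \<Phi>F g m = \<Phi>F f m" unfolding j(2) using jv f by (simp add: \<Phi>F_add)
qed

lemma cls_self: "f \<in> carrier FA \<Longrightarrow> f \<in> cls f"
  unfolding cls_def by (rule J.a_rcos_self)

lemma rep_cls:
  assumes f: "f \<in> carrier FA"
  shows "rep (cls f) \<in> carrier FA" "rep (cls f) [] = f []" "actF v (rep (cls f)) m = actF v f m"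
    "m \<le> 0 \<Longrightarrow> \<Phi>F (rep (cls f)) m = \<Phi>F f m"
proof -
  have "rep (cls f) \<in> cls f"
    unfolding rep_def using someI[of "\<lambda>g. g \<in> cls f", OF cls_self[OF f]] .
  from cls_functionals[OF f this]
  show "rep (cls f) \<in> carrier FA" "rep (cls f) [] = f []" "actF v (rep (cls f)) m = actF v f m"
    "m \<le> 0 \<Longrightarrow> \<Phi>F (rep (cls f)) m = \<Phi>F f m" by auto
qed

lemma env_aug_cls: "f \<in> carrier FA \<Longrightarrow> env_aug (cls f) = f []"
proof -
  assume f: "f \<in> carrier FA"
  have "(\<lambda>g. g []) ` cls f = (\<lambda>g. f []) ` cls f"
    by (intro image_cong refl cls_functionals(2)[OF f])
  also have "\<dots> = {f []}" using cls_self[OF f] by blast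
  finally have "(\<lambda>g. g []) ` cls f = {f []}" .
  then show ?thesis by (simp add: env_aug_def)
qed

text \<open>
  The functionals descend to \<open>U\<close> through representatives; for \<open>\<Phi>U\<close> the choice of the representative
  only affects positive degrees.
\<close>

definition actU :: "(int \<Rightarrow> 'k) \<Rightarrow> ('a list \<Rightarrow> 'k) set \<Rightarrow> int \<Rightarrow> 'k" where
  "actU v u = actF v (rep u)"

definition \<Phi>U :: "('a list \<Rightarrow> 'k) set \<Rightarrow> int \<Rightarrow> 'k" where
  "\<Phi>U u = \<Phi>F (rep u)"

definition scalar :: "'k \<Rightarrow> ('a list \<Rightarrow> 'k) set" where
  "scalar c = cls (\<lambda>w. if w = [] then c else 0)"

lemma actU_cls: "f \<in> carrier FA \<Longrightarrow> actU v (cls f) = actF v f"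
  by (rule ext) (simp add: actU_def rep_cls)

lemma \<Phi>U_cls: "f \<in> carrier FA \<Longrightarrow> m \<le> 0 \<Longrightarrow> \<Phi>U (cls f) m = \<Phi>F f m"
  by (simp add: \<Phi>U_def rep_cls)

lemma trivial_Tor_U:
  "trivial_Tor U (trivial_module :: (('a list \<Rightarrow> 'k) set, 'k) module) env_aug scalar actU \<Phi>U
    {v. \<forall>m\<le>0. v m = 0} (\<lambda>v. v 1)"
proof (rule trivial_Tor.intro[OF ring_U], rule trivial_Tor_axioms.intro)
  let ?W = "{v :: int \<Rightarrow> 'k. \<forall>m\<le>0. v m = 0}"
  have sc: "(\<lambda>w. if w = [] then c else 0) \<in> carrier FA" for c :: 'k
    unfolding free_assoc_simps by auto
  show "carrier (trivial_module :: (('a list \<Rightarrow> 'k) set, 'k) module) = UNIV"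
    "\<zero>\<^bsub>(trivial_module :: (('a list \<Rightarrow> 'k) set, 'k) module)\<^esub> = 0"
    "x \<oplus>\<^bsub>(trivial_module :: (('a list \<Rightarrow> 'k) set, 'k) module)\<^esub> y = x + y"
    "u \<odot>\<^bsub>trivial_module\<^esub> c = env_aug u * c" for x y c and u :: "('a list \<Rightarrow> 'k) set"
    by (simp_all add: trivial_module_def ring.defs module.defs)
  show "env_aug \<one>\<^bsub>U\<^esub> = (1 :: 'k)"
    unfolding U_simps(4) env_aug_cls[OF FA.one_closed] by (simp add: free_assoc_simps(3))
  show "scalar c \<in> carrier U" "env_aug (scalar c) = c" for c
    by (simp_all add: scalar_def U_simps(1) sc env_aug_cls)
  show "scalar 1 = \<one>\<^bsub>U\<^esub>" by (simp add: scalar_def U_simps(4) free_assoc_simps(3))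
  show "actU (v + w) u = actU v u + actU w u" for v w u
    by (rule ext) (simp add: actU_def actF_add_left)
  show "actU v \<one>\<^bsub>U\<^esub> = v" for v
  proof
    fix m
    have "actU v \<one>\<^bsub>U\<^esub> m = actF v (word []) m"
      unfolding U_simps(4) actU_cls[OF FA.one_closed] by (simp add: free_assoc_simps(3) word_def)
    also have "\<dots> = v m" by (simp add: actF_def word_sum_word word_act_def word_wt_def)
    finally show "actU v \<one>\<^bsub>U\<^esub> m = v m" .
  qed
  show "0 \<in> ?W" by simp
  show "v - w \<in> ?W" if "v \<in> ?W" "w \<in> ?W" for v w using that by simp
  show "(v + w) 1 = v 1 + w 1" for v w :: "int \<Rightarrow> 'k" by simp
  fix r assume "r \<in> carrier U"
  then obtain f where f: "f \<in> carrier FA" "r = cls f" unfolding U_simps(1) by blast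
  show "actU w r \<in> ?W" if "w \<in> ?W" for w
    unfolding f(2) actU_cls[OF f(1)] using that by (auto intro: actF_vanish)
  show "actU w r 1 = w 1 * env_aug r" if "w \<in> ?W" for w
    unfolding f(2) actU_cls[OF f(1)] env_aug_cls[OF f(1)] using that by (intro actF_lowest f) auto
  fix s assume "s \<in> carrier U"
  then obtain g where g: "g \<in> carrier FA" "s = cls g" unfolding U_simps(1) by blast
  note fg = f g FA.a_closed[OF f(1) g(1)] FA.m_closed[OF f(1) g(1)] U_simps(2,3)
  show "env_aug (r \<oplus>\<^bsub>U\<^esub> s) = env_aug r + env_aug s"
    by (simp add: fg env_aug_cls) (simp add: free_assoc_simps(5))
  show "env_aug (r \<otimes>\<^bsub>U\<^esub> s) = env_aug r * env_aug s"
    by (simp add: fg env_aug_cls) (simp add: free_assoc_simps(2))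
  show "actU v (r \<oplus>\<^bsub>U\<^esub> s) = actU v r + actU v s" for v
    by (rule ext) (simp add: fg actU_cls actF_add)
  show "actU v (r \<otimes>\<^bsub>U\<^esub> s) = actU (actU v r) s" for v
    by (simp add: fg actU_cls actF_mult)
  show "\<Phi>U (r \<oplus>\<^bsub>U\<^esub> s) - (\<Phi>U r + \<Phi>U s) \<in> ?W"
    by (simp add: fg \<Phi>U_cls \<Phi>F_add)
  show "\<Phi>U (r \<otimes>\<^bsub>U\<^esub> s) - actU (\<Phi>U r) s \<in> ?W" if eps: "env_aug r = 0"
  proof -
    have "f [] = 0" using eps f by (simp add: env_aug_cls)
    have "\<Phi>U (r \<otimes>\<^bsub>U\<^esub> s) m = actU (\<Phi>U r) s m" if m: "m \<le> 0" for m
    proof -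
      have "\<Phi>U (r \<otimes>\<^bsub>U\<^esub> s) m = actF (\<Phi>F f) g m"
        using m \<open>f [] = 0\<close> by (simp add: fg \<Phi>U_cls \<Phi>F_mult)
      also have "\<dots> = actF (\<Phi>U r) g m"
        unfolding actF_def word_sum_def word_act_def f(2)
        using m by (intro sum.cong refl) (simp add: \<Phi>U_cls[OF f(1)])
      finally show ?thesis by (simp add: g actU_cls)
    qed
    then show ?thesis by simp
  qed
qed

lemma cls_eqI:
  assumes "f \<in> carrier FA" "g \<in> carrier FA" "(\<lambda>w. f w - g w) \<in> J"
  shows "cls f = cls g"
proof -
  have "f = (\<lambda>w. f w - g w) \<oplus>\<^bsub>FA\<^esub> g" by (simp add: free_assoc_simps(5))
  then have "f \<in> J +>\<^bsub>FA\<^esub> g" using assms(3) unfolding a_r_coset_def' by blast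
  from FA.a_repr_independence[OF this assms(2) J.a_subgroup] show ?thesis unfolding cls_def ..
qed

lemma relation_J: "r \<in> env_relations L \<Longrightarrow> r \<in> J"
  using FA.genideal_self[OF env_relations_closed] by blast

definition \<iota> :: "'a \<Rightarrow> ('a list \<Rightarrow> 'k) set" where
  "\<iota> x = cls (word [x])"

lemma \<iota>_closed [simp]: "x \<in> carrier L \<Longrightarrow> \<iota> x \<in> carrier U"
  by (simp add: \<iota>_def U_simps(1) word_FA)

lemma word_mult: "word u \<otimes>\<^bsub>FA\<^esub> word v = word (u @ v)"
proof
  fix w
  have summand: "word u (take i w) * word v (drop i w) = (if i = length u then word (u @ v) w else (0 :: 'k))"
    if "i \<le> length w" for i
  proof (cases "i = length u")
    case True
    have "take i w = u \<and> drop i w = v \<longleftrightarrow> w = u @ v"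
      unfolding True by (metis append_eq_conv_conj)
    then show ?thesis using True by (auto simp: word_def)
  next
    case False
    then have "take i w \<noteq> u" using that by auto
    then show ?thesis using False by (simp add: word_def)
  qed
  have "(word u \<otimes>\<^bsub>FA\<^esub> word v) w = (\<Sum>i\<le>length w. if i = length u then word (u @ v) w else 0)"
    unfolding free_assoc_simps by (intro sum.cong refl summand) simp
  also have "\<dots> = word (u @ v) w"
    by (cases "length u \<le> length w") (auto simp: word_def)
  finally show "(word u \<otimes>\<^bsub>FA\<^esub> word v) w = word (u @ v) w" .
qed

lemma \<iota>_add:
  assumes "x \<in> carrier L" "y \<in> carrier L"
  shows "\<iota> (x \<oplus> y) = \<iota> x \<oplus>\<^bsub>U\<^esub> \<iota> y"
proof -
  have "(\<lambda>w. word [x \<oplus> y] w - word [x] w - word [y] w) \<in> J"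
    using assms by (intro relation_J) (auto simp: env_relations_def)
  then have "(\<lambda>w. word [x \<oplus> y] w - (word [x] \<oplus>\<^bsub>FA\<^esub> word [y]) w) \<in> J"
    by (simp add: free_assoc_simps(5) diff_diff_add)
  then have "cls (word [x \<oplus> y]) = cls (word [x] \<oplus>\<^bsub>FA\<^esub> word [y])"
    using assms by (intro cls_eqI FA.a_closed word_FA) auto
  then show ?thesis using assms by (simp add: \<iota>_def U_simps word_FA)
qed

lemma \<iota>_comm:
  assumes "x \<in> carrier L" "y \<in> carrier L"
  shows "\<iota> x \<otimes>\<^bsub>U\<^esub> \<iota> y = \<iota> y \<otimes>\<^bsub>U\<^esub> \<iota> x \<oplus>\<^bsub>U\<^esub> \<iota> (x \<otimes> y)"
proof -
  have "(\<lambda>w. word [x, y] w - word [y, x] w - word [x \<otimes> y] w) \<in> J"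
    using assms by (intro relation_J) (auto simp: env_relations_def)
  then have "(\<lambda>w. word [x, y] w - (word [y, x] \<oplus>\<^bsub>FA\<^esub> word [x \<otimes> y]) w) \<in> J"
    by (simp add: free_assoc_simps(5) diff_diff_add)
  then have "cls (word [x, y]) = cls (word [y, x] \<oplus>\<^bsub>FA\<^esub> word [x \<otimes> y])"
    using assms by (intro cls_eqI FA.a_closed word_FA) auto
  then show ?thesis using assms by (simp add: \<iota>_def U_simps word_FA word_mult)
qed

text \<open>
  In \<open>U\<close> the relation reads \<open>y b - b y + x a - a x = 0\<close>, an identity between products in the augmentation
  ideal. The functional takes the value \<open>(\<delta>(y) b - \<delta>(b) y + \<delta>(x) a - \<delta>(a) x)(1)\<close> on it.
\<close>

theorem lie_homology_2_nonzero:
  assumes xyab: "x \<in> carrier L" "y \<in> carrier L" "a \<in> carrier L" "b \<in> carrier L"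
    and rel: "y \<otimes> b \<oplus> x \<otimes> a = \<zero>"
    and nz: "wt b * \<delta> y 0 - wt y * \<delta> b 0 + (wt a * \<delta> x 0 - wt x * \<delta> a 0) \<noteq> 0"
  shows "carrier (lie_homology 2 L) \<noteq> {\<one>\<^bsub>lie_homology 2 L\<^esub>}"
proof -
  interpret T: trivial_Tor U "trivial_module :: (('a list \<Rightarrow> 'k) set, 'k) module" env_aug scalar actU \<Phi>U
    "{v. \<forall>m\<le>0. v m = 0}" "\<lambda>v. v 1"
    by (rule trivial_Tor_U)
  define ps where "ps = [(\<iota> y, \<iota> b), (\<iota> (\<ominus> b), \<iota> y), (\<iota> x, \<iota> a), (\<iota> (\<ominus> a), \<iota> x)]"
  have aug: "env_aug (\<iota> u) = 0" if "u \<in> carrier L" for u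
    using that by (simp add: \<iota>_def env_aug_cls word_FA) (simp add: word_def)
  have \<iota>_zero: "\<iota> \<zero> = \<zero>\<^bsub>U\<^esub>"
    using \<iota>_add[of "\<zero>" "\<zero>"] T.add.r_cancel_one'[of "\<iota> \<zero>" "\<iota> \<zero>"] by simp
  have \<iota>_minus: "\<iota> (\<ominus> u) = \<ominus>\<^bsub>U\<^esub> \<iota> u" if "u \<in> carrier L" for u
    using \<iota>_add[of "\<ominus> u" u] that \<iota>_zero by (intro T.minus_equality[symmetric]) (simp_all add: M.l_neg)
  have comm: "\<iota> u \<otimes>\<^bsub>U\<^esub> \<iota> v \<oplus>\<^bsub>U\<^esub> (\<iota> (\<ominus> v) \<otimes>\<^bsub>U\<^esub> \<iota> u \<oplus>\<^bsub>U\<^esub> t) = \<iota> (u \<otimes> v) \<oplus>\<^bsub>U\<^esub> t"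
    if "u \<in> carrier L" "v \<in> carrier L" "t \<in> carrier U" for u v t
  proof -
    have "\<iota> u \<otimes>\<^bsub>U\<^esub> \<iota> v \<oplus>\<^bsub>U\<^esub> (\<iota> (\<ominus> v) \<otimes>\<^bsub>U\<^esub> \<iota> u \<oplus>\<^bsub>U\<^esub> t)
        = (\<iota> v \<otimes>\<^bsub>U\<^esub> \<iota> u \<oplus>\<^bsub>U\<^esub> \<iota> (u \<otimes> v)) \<oplus>\<^bsub>U\<^esub> (\<ominus>\<^bsub>U\<^esub> (\<iota> v \<otimes>\<^bsub>U\<^esub> \<iota> u) \<oplus>\<^bsub>U\<^esub> t)"
      using that by (simp add: \<iota>_comm[of u v] \<iota>_minus T.l_minus)
    also have "\<dots> = (\<iota> v \<otimes>\<^bsub>U\<^esub> \<iota> u \<oplus>\<^bsub>U\<^esub> \<ominus>\<^bsub>U\<^esub> (\<iota> v \<otimes>\<^bsub>U\<^esub> \<iota> u)) \<oplus>\<^bsub>U\<^esub> (\<iota> (u \<otimes> v) \<oplus>\<^bsub>U\<^esub> t)"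
      using that by (simp add: T.a_ac)
    finally show ?thesis using that by (simp add: T.r_neg)
  qed
  have "foldr (\<lambda>(i, r) t. i \<otimes>\<^bsub>U\<^esub> r \<oplus>\<^bsub>U\<^esub> t) ps \<zero>\<^bsub>U\<^esub> = \<iota> (y \<otimes> b) \<oplus>\<^bsub>U\<^esub> (\<iota> (x \<otimes> a) \<oplus>\<^bsub>U\<^esub> \<zero>\<^bsub>U\<^esub>)"
    using xyab by (simp add: ps_def comm del: T.r_zero)
  also have "\<dots> = \<iota> (y \<otimes> b) \<oplus>\<^bsub>U\<^esub> \<iota> (x \<otimes> a)"
    using xyab by simp
  also have "\<dots> = \<iota> (y \<otimes> b \<oplus> x \<otimes> a)"
    using xyab by (intro \<iota>_add[symmetric]) auto
  also have "\<dots> = \<zero>\<^bsub>U\<^esub>" unfolding rel by (rule \<iota>_zero)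
  finally have fold: "foldr (\<lambda>(i, r) t. i \<otimes>\<^bsub>U\<^esub> r \<oplus>\<^bsub>U\<^esub> t) ps \<zero>\<^bsub>U\<^esub> = \<zero>\<^bsub>U\<^esub>" .
  have act: "actU (\<Phi>U (\<iota> u)) (\<iota> v) 1 = wt v * \<delta> u 0" if "u \<in> carrier L" "v \<in> carrier L" for u v
  proof -
    have "actU (\<Phi>U (\<iota> u)) (\<iota> v) 1 = wt v * \<Phi>U (\<iota> u) 0"
      using that by (simp add: \<iota>_def actU_cls word_FA) (simp add: actF_def word_sum_word word_act_def word_wt_def)
    also have "\<Phi>U (\<iota> u) 0 = \<delta> u 0"
      using that by (simp add: \<iota>_def \<Phi>U_cls word_FA) (simp add: \<Phi>F_def word_sum_word word_\<Phi>_def word_act_def word_wt_def)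
    finally show ?thesis .
  qed
  have neg: "\<delta> (\<ominus> u) 0 = - \<delta> u 0" if "u \<in> carrier L" for u
    using that \<delta>(2)[of u 0 "- 1"] by (simp add: minus_eq_scale)
  have "(foldr (\<lambda>(i, r) v. actU (\<Phi>U i) r + v) ps 0) 1
      = wt b * \<delta> y 0 - wt y * \<delta> b 0 + (wt a * \<delta> x 0 - wt x * \<delta> a 0)"
    using xyab by (simp add: ps_def act neg)
  then have "(foldr (\<lambda>(i, r) v. actU (\<Phi>U i) r + v) ps 0) 1 \<noteq> 0" using nz by simp
  then show ?thesis
    unfolding lie_homology_def
    using xyab fold by (intro T.Tor_2_trivial_nonzero[of ps]) (auto simp: ps_def aug)
qed

end


section \<open>An element of every term of the lower central series\<close>

context lie_algebra
begin

lemma engel_add: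
  assumes "x \<in> carrier L" "y \<in> carrier L" "z \<in> carrier L"
  shows "engel L (x \<oplus> y) n z = engel L x n z \<oplus> engel L y n z"
proof (induction n)
  case (Suc n)
  have "engel L x n z \<in> carrier L" "engel L y n z \<in> carrier L"
    using engel_closed[OF nonassoc_algebra_axioms] assms by auto
  then show ?case using assms unfolding engel.simps Suc by (simp add: mult_add_left)
qed simp

lemma engel_engel: "engel L (engel L x m z) n z = engel L x (m + n) z"
  by (induction n) simp_all

context
  assumes two: "(1 + 1 :: 'k) = 0"
begin

lemma add_same: "x \<in> carrier L \<Longrightarrow> x \<oplus> x = \<zero>"
  using scale_add_left[of x 1 1] by (simp add: two del: one_add_one)

lemma add_same': "x \<in> carrier L \<Longrightarrow> y \<in> carrier L \<Longrightarrow> x \<oplus> (x \<oplus> y) = y"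
  by (simp add: M.a_assoc[symmetric] add_same)

lemma lie_commute:
  assumes "x \<in> carrier L" "y \<in> carrier L"
  shows "x \<otimes> y = y \<otimes> x"
proof -
  have "(- 1 :: 'k) = 1" using group_add_class.minus_unique[OF two] .
  then have "(- 1 :: 'k) \<odot> u = u" if "u \<in> carrier L" for u using scale_one[OF that] by (simp only:)
  then show ?thesis using lie_anticomm[OF assms(2,1)] assms by simp
qed

text \<open>The Jacobi identity without signs.\<close>

lemma bracket_derivation:
  assumes "x \<in> carrier L" "y \<in> carrier L" "z \<in> carrier L"
  shows "(x \<otimes> y) \<otimes> z = (x \<otimes> z) \<otimes> y \<oplus> x \<otimes> (y \<otimes> z)"
proof -
  let ?A = "x \<otimes> (y \<otimes> z)" and ?B = "(x \<otimes> z) \<otimes> y" and ?C = "(x \<otimes> y) \<otimes> z"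
  have c: "?A \<in> carrier L" "?B \<in> carrier L" "?C \<in> carrier L" using assms by auto
  have "y \<otimes> (z \<otimes> x) = ?B" "z \<otimes> (x \<otimes> y) = ?C"
    using lie_commute[of y "z \<otimes> x"] lie_commute[of z x] lie_commute[of z "x \<otimes> y"] assms by simp_all
  then have "?A \<oplus> ?B \<oplus> ?C = \<zero>" using lie_jacobi[OF assms] by simp
  then have "?C \<oplus> (?B \<oplus> ?A) = \<zero>" using c by (simp add: M.a_ac)
  then have "?C \<oplus> (?C \<oplus> (?B \<oplus> ?A)) = ?C" using c by simp
  then show ?thesis using c by (simp only: add_same' M.a_closed)
qed

text \<open>
  For a derivation \<open>D\<close> the square is again one in characteristic 2, because the mixed term of
  \<open>D\<^sup>2[x, y]\<close> is \<open>2[D x, D y]\<close>.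
\<close>

lemma engel_two_power_derivation:
  assumes "x \<in> carrier L" "y \<in> carrier L" "z \<in> carrier L"
  shows "engel L (x \<otimes> y) (2 ^ n) z = engel L x (2 ^ n) z \<otimes> y \<oplus> x \<otimes> engel L y (2 ^ n) z"
  using assms(1,2)
proof (induction n arbitrary: x y)
  case 0
  then show ?case using bracket_derivation[OF 0 assms(3)] by simp
next
  case (Suc n)
  define D where "D u = engel L u (2 ^ n) z" for u
  have Dc: "D u \<in> carrier L" if "u \<in> carrier L" for u
    unfolding D_def by (rule engel_closed[OF nonassoc_algebra_axioms that assms(3)])
  have DD: "engel L u (2 ^ Suc n) z = D (D u)" for u
    unfolding D_def engel_engel by (simp add: mult_2)
  have D: "D (u \<otimes> v) = D u \<otimes> v \<oplus> u \<otimes> D v" if "u \<in> carrier L" "v \<in> carrier L" for u v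
    using Suc.IH[OF that] by (simp add: D_def)
  have Da: "D (u \<oplus> v) = D u \<oplus> D v" if "u \<in> carrier L" "v \<in> carrier L" for u v
    unfolding D_def by (rule engel_add[OF that assms(3)])
  have "D (D (x \<otimes> y)) = (D (D x) \<otimes> y \<oplus> D x \<otimes> D y) \<oplus> (D x \<otimes> D y \<oplus> x \<otimes> D (D y))"
    using Suc.prems by (simp add: D Da Dc)
  also have "\<dots> = D (D x) \<otimes> y \<oplus> x \<otimes> D (D y)"
    using Suc.prems by (simp add: M.a_assoc add_same' Dc)
  finally show ?case unfolding DD .
qed

text \<open>
  The step from \<open>2\<^sup>k - 1\<close> to \<open>2\<^sup>k\<^sup>+\<^sup>1 - 1\<close> letters \<open>b\<close> applies the derivation \<open>ad b\<close> to the power \<open>2\<^sup>k\<close>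
  to \<open>[q, a]\<close> for \<open>q = [a, b, \<dots>, b]\<close> with \<open>2\<^sup>k\<close> letters \<open>b\<close>. The second term is \<open>[q, q] = 0\<close>.
\<close>

lemma engel_exchange:
  assumes a: "a \<in> carrier L" and b: "b \<in> carrier L"
  shows "engel L ((a \<otimes> b) \<otimes> a) (2 ^ Suc n - 1) b = engel L (a \<otimes> b) (2 ^ Suc n - 1) b \<otimes> a"
proof (induction n)
  case 0
  have "((a \<otimes> b) \<otimes> a) \<otimes> b = ((a \<otimes> b) \<otimes> b) \<otimes> a \<oplus> (a \<otimes> b) \<otimes> (a \<otimes> b)"
    using a b by (intro bracket_derivation) auto
  then show ?case using a b by (simp add: lie_alternating)
next
  case (Suc n)
  note e = engel_closed[OF nonassoc_algebra_axioms]
  let ?m = "2 ^ Suc n - 1 :: nat"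
  let ?q = "engel L (a \<otimes> b) ?m b"
  have pow: "2 ^ Suc (Suc n) - 1 = ?m + 2 ^ Suc n" by simp
  have q: "?q = engel L a (2 ^ Suc n) b"
    using engel_engel[of a 1 b ?m] by simp
  have "engel L ((a \<otimes> b) \<otimes> a) (2 ^ Suc (Suc n) - 1) b = engel L (?q \<otimes> a) (2 ^ Suc n) b"
    unfolding pow engel_engel[symmetric] Suc ..
  also have "\<dots> = engel L ?q (2 ^ Suc n) b \<otimes> a \<oplus> ?q \<otimes> engel L a (2 ^ Suc n) b"
    using a b by (intro engel_two_power_derivation e) auto
  also have "?q \<otimes> engel L a (2 ^ Suc n) b = \<zero>"
    unfolding q using a b by (intro lie_alternating e)
  finally show ?case using a b unfolding pow engel_engel[symmetric] by (simp add: e)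
qed

text \<open>
  Unfolding both relations once more produces the two sides of \<open>engel_exchange\<close>, which cancel in
  characteristic 2.
\<close>

lemma b_family_tower:
  assumes \<phi>: "b_family L \<phi>"
  shows "\<phi> (GenY 1) \<otimes> \<phi> GenB \<oplus> \<phi> (GenX 1) \<otimes> \<phi> GenA =
    engel L (\<phi> (GenY (Suc n))) (2 ^ Suc n - 1) (\<phi> GenB) \<oplus>
    engel L (\<phi> (GenX (Suc n))) (2 ^ Suc n - 2) (\<phi> GenB) \<otimes> \<phi> GenA"
proof (induction n)
  case 0
  show ?case by simp
next
  case (Suc n)
  let ?a = "\<phi> GenA" and ?b = "\<phi> GenB" and ?x = "\<phi> (GenX (Suc (Suc n)))" and ?y = "\<phi> (GenY (Suc (Suc n)))"
  let ?c = "(?a \<otimes> ?b) \<otimes> ?b" and ?d = "(?a \<otimes> ?b) \<otimes> ?a"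
  let ?m = "2 ^ Suc n - 1 :: nat"
  note e = engel_closed[OF nonassoc_algebra_axioms]
  have clg: "\<phi> g \<in> carrier L" if "g \<in> gens" for g using \<phi> that unfolding b_family_def by blast
  have cl: "?a \<in> carrier L" "?b \<in> carrier L" "?x \<in> carrier L" "?y \<in> carrier L"
    using clg by simp_all
  have x: "\<phi> (GenX (Suc n)) = ?c \<oplus> engel L ?x (2 ^ Suc n) ?b"
    and y: "\<phi> (GenY (Suc n)) = ?d \<oplus> engel L ?y (2 ^ Suc n) ?b"
  proof -
    have "1 \<le> Suc n" by simp
    with \<phi> show "\<phi> (GenX (Suc n)) = ?c \<oplus> engel L ?x (2 ^ Suc n) ?b"
      and "\<phi> (GenY (Suc n)) = ?d \<oplus> engel L ?y (2 ^ Suc n) ?b"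
      unfolding b_family_def Suc_eq_plus1 by blast+
  qed
  have two_le: "(2 :: nat) \<le> 2 ^ Suc n" by simp
  have pow: "2 ^ Suc n + ?m = 2 ^ Suc (Suc n) - 1" "2 ^ Suc n + (2 ^ Suc n - 2) = 2 ^ Suc (Suc n) - (2 :: nat)"
    using two_le by simp_all
  have c: "engel L ?c (2 ^ Suc n - 2) ?b = engel L (?a \<otimes> ?b) ?m ?b"
  proof -
    have "1 + (2 ^ Suc n - 2) = ?m" using two_le by linarith
    then show ?thesis using engel_engel[of "?a \<otimes> ?b" 1 ?b "2 ^ Suc n - 2"] by simp
  qed
  have "engel L (\<phi> (GenY (Suc n))) ?m ?b = engel L (?a \<otimes> ?b) ?m ?b \<otimes> ?a \<oplus> engel L ?y (2 ^ Suc (Suc n) - 1) ?b"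
    unfolding y using cl by (simp only: engel_add e mult_closed engel_engel pow engel_exchange)
  moreover have "engel L (\<phi> (GenX (Suc n))) (2 ^ Suc n - 2) ?b \<otimes> ?a
      = engel L (?a \<otimes> ?b) ?m ?b \<otimes> ?a \<oplus> engel L ?x (2 ^ Suc (Suc n) - 2) ?b \<otimes> ?a"
    unfolding x using cl by (simp only: engel_add e mult_closed engel_engel pow c mult_add_left)
  ultimately show ?case
    unfolding Suc using cl e by (simp add: M.a_ac add_same add_same')
qed

lemma b_family_omega:
  assumes \<phi>: "b_family L \<phi>"
  shows "\<phi> (GenY 1) \<otimes> \<phi> GenB \<oplus> \<phi> (GenX 1) \<otimes> \<phi> GenA \<in> lower_central_omega L" (is "?z \<in> _")
proof -
  have "?z \<in> lower_central L i" if "i \<ge> 1" for i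
  proof -
    obtain n where n: "i = Suc n" using \<open>i \<ge> 1\<close> by (cases i) auto
    have cl: "\<phi> g \<in> carrier L" if "g \<in> gens" for g using \<phi> that unfolding b_family_def by blast
    have two_le: "(2 :: nat) \<le> 2 ^ Suc n" by simp
    have pow: "Suc 0 + (2 ^ Suc n - 1) = (2 :: nat) ^ Suc n" "Suc (Suc 0 + (2 ^ Suc n - 2)) = (2 :: nat) ^ Suc n"
      using two_le by linarith+
    have "engel L (\<phi> (GenY (Suc n))) (2 ^ Suc n - 1) (\<phi> GenB) \<in> lower_central L (2 ^ Suc n)"
      using engel_lower_central[of "\<phi> (GenY (Suc n))" "Suc 0" "\<phi> GenB" "2 ^ Suc n - 1"] cl unfolding pow by simp
    moreover have "engel L (\<phi> (GenX (Suc n))) (2 ^ Suc n - 2) (\<phi> GenB) \<otimes> \<phi> GenA \<in> lower_central L (2 ^ Suc n)"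
      using lower_central_bracket[OF engel_lower_central[of "\<phi> (GenX (Suc n))" "Suc 0" "\<phi> GenB" "2 ^ Suc n - 2"], of "\<phi> GenA"] cl
      unfolding pow by simp
    ultimately have "?z \<in> lower_central L (2 ^ Suc n)"
      unfolding b_family_tower[OF \<phi>, of n] by (rule lower_central_closed(3))
    moreover have "i \<le> 2 ^ Suc n" unfolding n using less_exp[of "Suc n"] by simp
    ultimately show ?thesis using lower_central_antimono by blast
  qed
  then show ?thesis by (auto simp: lower_central_omega_def)
qed

end

end


section \<open>The second homology of \<open>\<aa>\<close>\<close>

theorem theoremA:
  assumes char_two: "CHAR('k::field) = 2"
  shows "parafree (lie_a :: ('k, _) module) \<and>
    carrier (lie_homology 2 (lie_a :: ('k, _) module)) \<noteq>
      {\<one>\<^bsub>lie_homology 2 (lie_a :: ('k, _) module)\<^esub>}"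
proof
  show "parafree (lie_a :: ('k, _) module)" by (rule parafree_a)
  have "of_nat 2 = (0 :: 'k)" by (subst of_nat_eq_0_iff_char_dvd) (simp add: char_two)
  then have two: "(1 + 1 :: 'k) = 0" by simp
  interpret b: lie_algebra "lie_b :: ('k, _) module" by (rule lie_algebra_b)
  interpret E: lie_algebra "test_alg :: ('k, 'k test) module" by (rule lie_algebra_test[OF two])
  obtain \<eta> where \<eta>: "\<eta> \<in> alg_hom lie_b (test_alg :: ('k, 'k test) module)" "\<forall>g\<in>gens. \<eta> (bgen g) = test_family g"
    using b_universal[OF lie_algebra_test[OF two] b_family_test] by blast
  define wt' where "wt' u = fst (\<eta> u)" for u
  define \<delta>' where "\<delta>' u = snd (snd (snd (\<eta> u)))" for u
  \<comment> \<open>The components \<open>wt\<close> and \<open>\<delta>\<close> of the test homomorphism pass to \<open>\<aa>\<close> through chosen preimages; in degrees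
    \<open>m \<le> 0\<close> the choice does not matter, by \<open>test_hom_omega\<close>.\<close>
  define \<rho> where "\<rho> x = (SOME u. u \<in> carrier (lie_b :: ('k, _) module) \<and> b_to_a u = x)" for x
  have \<rho>: "\<rho> x \<in> carrier lie_b" "b_to_a (\<rho> x) = x" if "x \<in> carrier lie_a" for x
    using someI_ex[of "\<lambda>u. u \<in> carrier (lie_b :: ('k, _) module) \<and> b_to_a u = x"] that
    unfolding \<rho>_def carrier_a by blast+
  have omega: "wt' u = 0 \<and> (\<forall>m\<le>0. \<delta>' u m = 0)" if u: "u \<in> omega_b" for u
  proof -
    obtain g where "\<eta> u = (0, (\<lambda>n. 0), (\<lambda>n l. 0), g)" "\<And>m. m \<le> 0 \<Longrightarrow> g m = 0"
      using test_hom_omega[OF two \<eta>(1) _ u] \<eta>(2) by blast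
    then show ?thesis by (simp add: wt'_def \<delta>'_def)
  qed
  have lin: "wt' (u \<oplus>\<^bsub>lie_b\<^esub> v) = wt' u + wt' v" "\<delta>' (u \<oplus>\<^bsub>lie_b\<^esub> v) m = \<delta>' u m + \<delta>' v m"
    "wt' (u \<otimes>\<^bsub>lie_b\<^esub> v) = 0" "\<delta>' (u \<otimes>\<^bsub>lie_b\<^esub> v) m = wt' v * \<delta>' u (m - 1) + wt' u * \<delta>' v (m - 1)"
    if "u \<in> carrier lie_b" "v \<in> carrier lie_b" for u v m
    using that unfolding wt'_def \<delta>'_def
    by (cases "\<eta> u"; cases "\<eta> v"; simp add: alg_homD[OF \<eta>(1)] shiftz_def)+
  have lin_scale: "wt' (c \<odot>\<^bsub>lie_b\<^esub> u) = c * wt' u" "\<delta>' (c \<odot>\<^bsub>lie_b\<^esub> u) m = c * \<delta>' u m"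
    if "u \<in> carrier lie_b" for u c m
    using that unfolding wt'_def \<delta>'_def by (cases "\<eta> u"; simp add: alg_homD[OF \<eta>(1)])+
  note lin = lin lin_scale
  have same: "wt' u = wt' v" "m \<le> 0 \<Longrightarrow> \<delta>' u m = \<delta>' v m"
    if "u \<in> carrier lie_b" "v \<in> carrier lie_b" "b_to_a u = b_to_a v" for u v m
  proof -
    have "u \<ominus>\<^bsub>lie_b\<^esub> v \<in> omega_b" using that b_to_a_eq_iff by blast
    then have "wt' (u \<ominus>\<^bsub>lie_b\<^esub> v) = 0" "\<forall>m\<le>0. \<delta>' (u \<ominus>\<^bsub>lie_b\<^esub> v) m = 0" using omega by blast+
    moreover have "u \<ominus>\<^bsub>lie_b\<^esub> v = u \<oplus>\<^bsub>lie_b\<^esub> (- 1) \<odot>\<^bsub>lie_b\<^esub> v"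
      using that by (simp add: a_minus_def b.minus_eq_scale)
    ultimately show "wt' u = wt' v" "m \<le> 0 \<Longrightarrow> \<delta>' u m = \<delta>' v m" using that(1,2) by (simp_all add: lin)
  qed
  note ba = alg_homD[OF b_to_a_hom[where 'k='k]]
  \<comment> \<open>The test algebra has a plus sign where the derivation rule has a minus sign.\<close>
  have minus: "c - d = c + d" for c d :: 'k
  proof -
    have "d + d = 0" using two by (metis distrib_right mult_1 mult_zero_left)
    then show ?thesis by (simp add: diff_eq_eq add.assoc)
  qed
  interpret F: env_functional "lie_a :: ('k, _) module" "\<lambda>x. wt' (\<rho> x)" "\<lambda>x. \<delta>' (\<rho> x)"
  proof (rule env_functional.intro[OF lie_algebra_a], rule env_functional_axioms.intro)
    interpret a: lie_algebra "lie_a :: ('k, _) module" by (rule lie_algebra_a)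
    fix x y :: "(gen magma \<Rightarrow> 'k) set set set" and c :: 'k and m :: int
    assume x: "x \<in> carrier lie_a"
    note \<rho>x = \<rho>[OF x]
    have cx: "c \<odot>\<^bsub>lie_a\<^esub> x \<in> carrier lie_a" using x by simp
    have eq: "b_to_a (\<rho> (c \<odot>\<^bsub>lie_a\<^esub> x)) = b_to_a (c \<odot>\<^bsub>lie_b\<^esub> \<rho> x)" using \<rho>x \<rho>(2)[OF cx] by (simp add: ba)
    show "wt' (\<rho> (c \<odot>\<^bsub>lie_a\<^esub> x)) = c * wt' (\<rho> x)"
      using same(1)[OF \<rho>(1)[OF cx] _ eq] \<rho>x by (simp add: lin)
    show "\<delta>' (\<rho> (c \<odot>\<^bsub>lie_a\<^esub> x)) m = c * \<delta>' (\<rho> x) m" if "m \<le> 0"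
      using same(2)[OF \<rho>(1)[OF cx] _ eq that] \<rho>x by (simp add: lin)
    assume y: "y \<in> carrier lie_a"
    note \<rho>y = \<rho>[OF y]
    have xy: "x \<oplus>\<^bsub>lie_a\<^esub> y \<in> carrier lie_a" "x \<otimes>\<^bsub>lie_a\<^esub> y \<in> carrier lie_a" using x y by simp_all
    have eq: "b_to_a (\<rho> (x \<oplus>\<^bsub>lie_a\<^esub> y)) = b_to_a (\<rho> x \<oplus>\<^bsub>lie_b\<^esub> \<rho> y)"
      "b_to_a (\<rho> (x \<otimes>\<^bsub>lie_a\<^esub> y)) = b_to_a (\<rho> x \<otimes>\<^bsub>lie_b\<^esub> \<rho> y)"
      using \<rho>x \<rho>y \<rho>(2)[OF xy(1)] \<rho>(2)[OF xy(2)] by (simp_all add: ba)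
    show "wt' (\<rho> (x \<oplus>\<^bsub>lie_a\<^esub> y)) = wt' (\<rho> x) + wt' (\<rho> y)"
      using same(1)[OF \<rho>(1)[OF xy(1)] _ eq(1)] \<rho>x \<rho>y by (simp add: lin)
    show "wt' (\<rho> (x \<otimes>\<^bsub>lie_a\<^esub> y)) = 0"
      using same(1)[OF \<rho>(1)[OF xy(2)] _ eq(2)] \<rho>x \<rho>y by (simp add: lin)
    show "\<delta>' (\<rho> (x \<oplus>\<^bsub>lie_a\<^esub> y)) m = \<delta>' (\<rho> x) m + \<delta>' (\<rho> y) m" if "m \<le> 0"
      using same(2)[OF \<rho>(1)[OF xy(1)] _ eq(1) that] \<rho>x \<rho>y by (simp add: lin)
    show "\<delta>' (\<rho> (x \<otimes>\<^bsub>lie_a\<^esub> y)) m = wt' (\<rho> y) * \<delta>' (\<rho> x) (m - 1) - wt' (\<rho> x) * \<delta>' (\<rho> y) (m - 1)" if "m \<le> 0"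
      using same(2)[OF \<rho>(1)[OF xy(2)] _ eq(2) that] \<rho>x \<rho>y
      by (simp add: lin minus)
  qed
  define p where "p g = b_to_a (bgen g :: (gen magma \<Rightarrow> 'k) set set)" for g
  have p: "p g \<in> carrier lie_a" if "g \<in> gens" for g using that by (simp add: p_def ba)
  have p_wt: "wt' (\<rho> (p g)) = fst (test_family g)" "\<delta>' (\<rho> (p g)) 0 = snd (snd (snd (test_family g))) 0"
    if g: "g \<in> gens" for g
    using same(1)[of "\<rho> (p g)" "bgen g"] same(2)[of "\<rho> (p g)" "bgen g" 0] \<rho>(1)[OF p[OF g]] \<rho>(2)[OF p[OF g]] g \<eta>(2)
    by (simp_all add: p_def wt'_def[of "bgen g"] \<delta>'_def[of "bgen g"])
  have rel: "p (GenY 1) \<otimes>\<^bsub>lie_a\<^esub> p GenB \<oplus>\<^bsub>lie_a\<^esub> p (GenX 1) \<otimes>\<^bsub>lie_a\<^esub> p GenA = \<zero>\<^bsub>lie_a\<^esub>"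
  proof -
    let ?z = "bgen (GenY 1) \<otimes>\<^bsub>lie_b\<^esub> bgen GenB \<oplus>\<^bsub>lie_b\<^esub> bgen (GenX 1) \<otimes>\<^bsub>lie_b\<^esub> bgen GenA :: (gen magma \<Rightarrow> 'k) set set"
    have "?z \<in> omega_b" by (rule b.b_family_omega[OF two b_family_bgen])
    moreover have "?z \<in> carrier lie_b" by simp
    ultimately have "b_to_a ?z = \<zero>\<^bsub>lie_a\<^esub>" using b_to_a_zero_iff by blast
    then show ?thesis by (simp add: p_def ba)
  qed
  show "carrier (lie_homology 2 (lie_a :: ('k, _) module)) \<noteq> {\<one>\<^bsub>lie_homology 2 (lie_a :: ('k, _) module)\<^esub>}"
    by (rule F.lie_homology_2_nonzero[OF p p p p rel]) (simp_all add: p_wt)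
qed

end
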